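(* There exist absolute constants $c_1,c_2\in(0,1)$, $c>0$ and $C>0$ such that the following holds. Let $A\in\mathbb{R}^{n\times m}$ satisfy $A=XZY^T+E$ with $X\in\mathbb{R}^{n\times k}$, $Z\in\mathbb{R}^{k\times k}$, $Y\in\mathbb{R}^{m\times k}$, $E\in\mathbb{R}^{n\times m}$, $\mathrm{rank}(XZY^T)=k$ and $\|E\|\le\varepsilon$. Assume that $Z=\mathrm{blkdiag}(Z_1,Z_2,Z_3)$ with $Z_i\in\mathbb{R}^{k_i\times k_i}$, $k_1+k_2+k_3=k$, and that $X=\begin{bmatrix}X_1&X_2&X_3\end{bmatrix}$, $Y=\begin{bmatrix}Y_1&Y_2&Y_3\end{bmatrix}$ with $X_i\in\mathbb{R}^{n\times k_i}$, $Y_i\in\mathbb{R}^{m\times k_i}$. Assume further that $\begin{bmatrix}X_1&X_2\end{bmatrix}$ and $\begin{bmatrix}Y_1&Y_3\end{bmatrix}$ have orthonormal columns and are $\mu$-coherent, and that $X_3$ and $Y_2$ have orthonormal columns, each column having at most $\beta$ nonzero entries. Let $I$ and $J$ be the row and column index sets returned by the randomized sRRQR row and column selection algorithm (described in the context) applied to $A$ with $\ell_0=\ell_b=\alpha\mu k$ and $\ell_a=k$, let $\ell=\max\{\ell_0,\ell_a,\ell_b\}$, and assume $\varepsilon\sqrt{nmk/\ell}\le c\,\sigma_k(XZY^T)$. Then $$\left\|A-A(:,J)A(:,J)^\dagger\,A\,A(I,:)^\dagger A(I,:)\right\|\le C\,\varepsilon\sqrt{\frac{nmk}{\ell}}\cdot\frac{\sigma_1(XZY^T)}{\sigma_k(XZY^T)}\cdot\left(\|X^\dagger\|+\|Y^\dagger\|\right)$$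 with probability at least $$1-2k\left(\frac{\beta\ell}{n}+\frac{\beta\ell}{m}+c_1^{\alpha}+c_2^{\alpha}\right).$$
   Context: Notation: $\|\cdot\|$ is the spectral norm; $M^\dagger$ is the Moore-Penrose pseudoinverse; $A(I,:)$ and $A(:,J)$ are the submatrices of $A$ with rows indexed by $I$, respectively columns indexed by $J$; $\sigma_i$ is the $i$-th largest singular value; $\|\cdot\|_{\max}$ is the maximum absolute value of the entries. Coherence: a matrix $U\in\mathbb{R}^{n\times r}$ with orthonormal columns is $\mu$-coherent if $\mu=n\|U\|_{\max}^2$ (with $n$ the number of rows of $U$). Strong rank-revealing QR (sRRQR), with parameter $\eta=1$: a rank-$r$ sRRQR factorization of $M\in\mathbb{R}^{p\times q}$ is $MP=Q\begin{bmatrix}A_r&B_r\\0&C_r\end{bmatrix}$ with $P$ a permutation matrix, $Q$ orthogonal, $A_r\in\mathbb{R}^{r\times r}$, such that (a) $\sigma_i(A_r)\ge\sigma_i(M)/\sqrt{1+r(q-r)}$ for $1\le i\le r$; (b) $\sigma_j(C_r)\le\sigma_{r+j}(M)\sqrt{1+r(q-r)}$ for $1\le j\le \min\{p,q\}-r$; (c) $\|A_r^{-1}B_r\|_{\max}\le1$ (when $A_r$ is invertible). "Selecting $r$ columns of $M$ by sRRQR" means taking the indices of the $r$ columns of $M$ that are moved to the first $r$ positions by $P$. Randomized sRRQR row and column selection algorithm, with input $A\in\mathbb{R}^{n\times m}$ and integers $\ell_0,\ell_a,\ell_b$: 1. Select $\ell_0$ row indices $I_0\subset\{1,\dots,n\}$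 uniformly at random (without replacement). 2. Select $\ell_a$ columns of $A(I_0,:)$ by sRRQR (index set $J_a$). 3. Select $\ell_b$ further column indices $J_b\subset\{1,\dots,m\}$ uniformly at random (without replacement). 4. Select $\ell_0$ column indices $J_0\subset\{1,\dots,m\}$ of $A$ uniformly at random (without replacement). 5. Select $\ell_a$ columns of $A(:,J_0)^T$ by sRRQR (index set $I_a$ of rows of $A$). 6. Select $\ell_b$ further row indices $I_b\subset\{1,\dots,n\}$ uniformly at random (without replacement). 7. Return $J=(J_a,J_b)$ and $I=(I_a,I_b)$. The random selections in steps 1, 3, 4, 6 are independent. The quantities prescribed for $\ell_0,\ell_a,\ell_b$ are understood to be integers, and $\alpha>0$ is a real parameter. *)

theory Defs
  imports
    "HOL-Probability.Probability_Mass_Function"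
    "HOL-Library.Monad_Syntax"
    "HOL-Combinatorics.Permutations"
    "Jordan_Normal_Form.Char_Poly"
    "Jordan_Normal_Form.DL_Rank"
    "Jordan_Normal_Form.DL_Submatrix"
begin

text \<open>Conventions: rows and columns are indexed from 0, whereas singular values are indexed
  from 1, the largest one being the first.\<close>

section \<open>Norms, singular values, pseudoinverse\<close>

definition vec_norm2 :: "real vec \<Rightarrow> real" where
  "vec_norm2 v = sqrt (scalar_prod v v)"

definition spectral_norm :: "real mat \<Rightarrow> real" where
  "spectral_norm A = (SUP v \<in> {v \<in> carrier_vec (dim_col A). vec_norm2 v \<le> 1}. vec_norm2 (A *\<^sub>v v))"

text \<open>The inserted 0 only matters for matrices without entries.\<close>

definition max_norm :: "real mat \<Rightarrow> real" where
  "max_norm A = Max (insert 0 (abs ` elements_mat A))"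

text \<open>All singular values in decreasing order, with multiplicity: the square roots of the
  eigenvalues of \<open>A\<^sup>T A\<close>. The list has length \<open>dim_col A\<close>; if \<open>dim_col A > dim_row A\<close>, it is padded
  by zeros.\<close>

definition singular_values :: "real mat \<Rightarrow> real list" where
  "singular_values A =
     rev (sorted_list_of_multiset (image_mset sqrt (proots (char_poly (transpose_mat A * A)))))"

definition sing_val :: "nat \<Rightarrow> real mat \<Rightarrow> real" where
  "sing_val i A =
     (if 1 \<le> i \<and> i \<le> length (singular_values A) then singular_values A ! (i - 1) else 0)"

definition is_pinv :: "real mat \<Rightarrow> real mat \<Rightarrow> bool" where
  "is_pinv A B \<longleftrightarrow>
     B \<in> carrier_mat (dim_col A) (dim_row A) \<and>
     A * B * A = A \<and> B * A * B = B \<and>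
     transpose_mat (A * B) = A * B \<and> transpose_mat (B * A) = B * A"

definition pinv :: "real mat \<Rightarrow> real mat" where
  "pinv A = (THE B. is_pinv A B)"

section \<open>Orthonormality, coherence, sparsity\<close>

definition orthonormal_cols :: "real mat \<Rightarrow> bool" where
  "orthonormal_cols U \<longleftrightarrow> transpose_mat U * U = 1\<^sub>m (dim_col U)"

text \<open>A matrix without columns has no entries and hence no meaningful maximum norm; it is counted
  as coherent for every \<open>\<mu>\<close>, so that blocks without columns impose no restriction.\<close>

definition coherent :: "real \<Rightarrow> real mat \<Rightarrow> bool" where
  "coherent \<mu> U \<longleftrightarrow>
     orthonormal_cols U \<and> (dim_col U = 0 \<or> \<mu> = real (dim_row U) * (max_norm U)\<^sup>2)"

definition sparse_cols :: "nat \<Rightarrow> real mat \<Rightarrow> bool" where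
  "sparse_cols \<beta> U \<longleftrightarrow> (\<forall>j < dim_col U. card {i. i < dim_row U \<and> U $$ (i, j) \<noteq> 0} \<le> \<beta>)"

definition append_cols :: "real mat \<Rightarrow> real mat \<Rightarrow> real mat" where
  "append_cols A B = four_block_mat A B (0\<^sub>m 0 (dim_col A)) (0\<^sub>m 0 (dim_col B))"

section \<open>Strong rank-revealing QR with parameter 1\<close>

text \<open>Column \<open>j\<close> of \<open>M * perm_mat q \<pi>\<close> is column \<open>\<pi> j\<close> of \<open>M\<close>.\<close>

definition perm_mat :: "nat \<Rightarrow> (nat \<Rightarrow> nat) \<Rightarrow> real mat" where
  "perm_mat q \<pi> = mat q q (\<lambda>(i, j). if i = \<pi> j then 1 else 0)"

definition is_srrqr ::
  "real mat \<Rightarrow> nat \<Rightarrow> (nat \<Rightarrow> nat) \<Rightarrow> real mat \<Rightarrow> real mat \<Rightarrow> real mat \<Rightarrow> real mat \<Rightarrow> bool" where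
  "is_srrqr M r \<pi> Q Ar Br Cr \<longleftrightarrow>
     (let p = dim_row M; q = dim_col M; \<gamma> = sqrt (1 + real r * (real q - real r)) in
        r \<le> min p q \<and>
        \<pi> permutes {..<q} \<and>
        Q \<in> carrier_mat p p \<and> orthonormal_cols Q \<and>
        Ar \<in> carrier_mat r r \<and> Br \<in> carrier_mat r (q - r) \<and> Cr \<in> carrier_mat (p - r) (q - r) \<and>
        M * perm_mat q \<pi> = Q * four_block_mat Ar Br (0\<^sub>m (p - r) r) Cr \<and>
        (\<forall>i. 1 \<le> i \<and> i \<le> r \<longrightarrow> sing_val i Ar \<ge> sing_val i M / \<gamma>) \<and>
        (\<forall>j. 1 \<le> j \<and> j \<le> min p q - r \<longrightarrow> sing_val j Cr \<le> sing_val (r + j) M * \<gamma>) \<and>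
        (\<forall>Ar'. Ar' \<in> carrier_mat r r \<and> inverts_mat Ar Ar' \<and> inverts_mat Ar' Ar \<longrightarrow>
           max_norm (Ar' * Br) \<le> 1))"

definition srrqr_selects :: "real mat \<Rightarrow> nat \<Rightarrow> nat set \<Rightarrow> bool" where
  "srrqr_selects M r S \<longleftrightarrow> (\<exists>\<pi> Q Ar Br Cr. is_srrqr M r \<pi> Q Ar Br Cr \<and> S = \<pi> ` {..<r})"

text \<open>The factorization is not unique, so an implementation amounts to a choice, for each matrix
  and each admissible rank, of one valid selection.\<close>

definition srrqr_routine :: "(real mat \<Rightarrow> nat \<Rightarrow> nat set) \<Rightarrow> bool" where
  "srrqr_routine sel \<longleftrightarrow> (\<forall>M r. r \<le> min (dim_row M) (dim_col M) \<longrightarrow> srrqr_selects M r (sel M r))"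

section \<open>Randomized row and column selection\<close>

definition row_submat :: "real mat \<Rightarrow> nat set \<Rightarrow> real mat" where
  "row_submat A I = submatrix A I UNIV"

definition col_submat :: "real mat \<Rightarrow> nat set \<Rightarrow> real mat" where
  "col_submat A J = submatrix A UNIV J"

text \<open>Only meaningful for \<open>s \<le> N\<close>.\<close>

definition uniform_subset :: "nat \<Rightarrow> nat \<Rightarrow> nat set pmf" where
  "uniform_subset N s = pmf_of_set {S. S \<subseteq> {..<N} \<and> card S = s}"

text \<open>The joint distribution of the returned pair of row and column index sets. The samples
  \<open>J\<^sub>b\<close> and \<open>I\<^sub>b\<close> are drawn from all indices and may overlap with \<open>J\<^sub>a\<close> and \<open>I\<^sub>a\<close>.\<close>

definition randomized_srrqr ::
  "(real mat \<Rightarrow> nat \<Rightarrow> nat set) \<Rightarrow> real mat \<Rightarrow> nat \<Rightarrow> nat \<Rightarrow> nat \<Rightarrow> (nat set \<times> nat set) pmf" where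
  "randomized_srrqr sel A l0 la lb = do {
     I0 \<leftarrow> uniform_subset (dim_row A) l0;
     let Ja = sel (row_submat A I0) la;
     Jb \<leftarrow> uniform_subset (dim_col A) lb;
     J0 \<leftarrow> uniform_subset (dim_col A) l0;
     let Ia = sel (transpose_mat (col_submat A J0)) la;
     Ib \<leftarrow> uniform_subset (dim_row A) lb;
     return_pmf (Ia \<union> Ib, Ja \<union> Jb)
   }"

definition skeleton_approx :: "real mat \<Rightarrow> nat set \<Rightarrow> nat set \<Rightarrow> real mat" where
  "skeleton_approx A I J =
     col_submat A J * pinv (col_submat A J) * A * pinv (row_submat A I) * row_submat A I"

end

theory Submission
  imports Defs "Jordan_Normal_Form.Schur_Decomposition"
begin

no_notation inner (infix "\<bullet>" 70)
no_notation vec_nth (infixl "$" 90)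

text \<open>Sampling: if \<open>v\<^sub>i\<close> are the rescaled rows of a coherent orthonormal matrix, then the Gram matrix
  \<open>M\<close> of a random sample grows by the rank-one updates \<open>v\<^sub>i v\<^sub>i\<^sup>T\<close> when the indices are drawn one by one.
  Expanding differences of powers telescopically shows that in every step, on average,
  \<open>tr ((\<alpha> + M)\<^sup>-\<^sup>q)\<close> contracts up to an additive term and \<open>tr ((\<alpha> + M)\<^sup>q)\<close> grows by a controlled factor. With
  \<open>q \<approx> \<alpha> / 2\<close>, Markov's inequality bounds the extreme eigenvalues of \<open>M\<close> with exponentially small
  failure probability. A union bound shows that the sparse blocks vanish on the sampled indices.

  Approximation: write \<open>A - P A Q = (A - P A) + P (A - A Q)\<close> with the orthogonal projections \<open>P\<close> and
  \<open>Q\<close> onto the selected columns and rows. By symmetry it suffices to bound \<open>(1 - P) A\<close>. Since \<open>X\<^sub>3\<close>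
  vanishes on \<open>I\<^sub>0\<close>, the rows \<open>I\<^sub>0\<close> only see the first two blocks up to \<open>\<epsilon>\<close>, so the rank-revealing
  factorization yields, for every \<open>x\<close>, a vector \<open>v\<close> supported on \<open>J\<^sub>a\<close> for which these two blocks of
  \<open>A x\<close> and \<open>A v\<close> agree. The blocks one and three are reproduced by the columns \<open>J\<^sub>b\<close>, on which \<open>Y\<^sub>2\<close>
  vanishes. Coherence, together with \<open>k l \<le> n\<close> in the case \<open>k\<^sub>3 > 0\<close>, bounds the contribution of the
  third block to \<open>A v\<close>.\<close>

section \<open>The spectral theorem\<close>

text \<open>For \<open>N = M + v v\<^sup>T\<close> the difference of integer powers is a finite
  explicit sum, so trace inequalities for matrix exponentials are avoided, and drawing index by
  index fits sampling without replacement. The shift by \<open>\<alpha> \<ge> 2 (q + 1)\<close>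
  ensures that one update changes the relevant moments by at most a factor 2.

  A bound that is not positive is void, and positivity is itself a source of information: it forces
  \<open>\<alpha> \<ge> 2\<close>, hence \<open>l \<ge> k\<close> as \<open>\<mu> \<ge> 1\<close>;
  and if \<open>k\<^sub>3 > 0\<close>, a unit column of \<open>X\<^sub>3\<close> is nonzero, so
  \<open>\<beta> \<ge> 1\<close> and \<open>k l \<le> n\<close>. The last inequality removes the
  main obstacle: moving \<open>x\<close> onto \<open>J\<^sub>a\<close> already costs a multiple of
  \<open>sqrt (m k)\<close>, and the third block of the moved vector costs a further factor.
  Coherence and \<open>k l \<le> n\<close> keep it below a multiple of \<open>sqrt (n / l)\<close>,
  and the product is \<open>sqrt (n m k / l)\<close>.

  The samples fail with probability about \<open>10 k (19/20)^q\<close>, to be covered by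
  \<open>4 k c^\<alpha> < 1\<close>. With \<open>c = (19/20)^(1/4)\<close>, half of the exponent,
  which is about \<open>\<alpha> / 2\<close>, pays for the constants.\<close>

lemma vec_norm2_sq: "v \<bullet> v = (vec_norm2 v)\<^sup>2"
  and vec_norm2_nonneg: "0 \<le> vec_norm2 v"
proof -
  have "0 \<le> v \<bullet> v" by (simp add: scalar_prod_def sum_nonneg)
  then show "v \<bullet> v = (vec_norm2 v)\<^sup>2" "0 \<le> vec_norm2 v" by (auto simp: vec_norm2_def)
qed

lemma scalar_prod_self_pos:
  fixes v :: "real vec"
  assumes "v \<in> carrier_vec n" "v \<noteq> 0\<^sub>v n"
  shows "0 < v \<bullet> v"
proof -
  obtain i where i: "i < n" "v $ i \<noteq> 0" using assms by (metis carrier_vecD eq_vecI index_zero_vec)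
  have "0 < (\<Sum>i = 0..<dim_vec v. v $ i * v $ i)"
    using i assms by (intro sum_pos2[where i = i]) (auto simp: zero_less_mult_iff)
  then show ?thesis by (simp add: scalar_prod_def)
qed

text \<open>Gram-Schmidt applied to a basis completion returns its first vector unchanged but leaves
  the others unnormalised, so only a rescaling of columns is added here. This supplies the deflation
  step of the spectral theorem.\<close>

lemma orthonormal_completion:
  fixes v :: "real vec"
  assumes v: "v \<in> carrier_vec n" and unit: "v \<bullet> v = 1"
  obtains W where "W \<in> carrier_mat n n" "transpose_mat W * W = 1\<^sub>m n" "col W 0 = v" "0 < n"
proof -
  have v0: "v \<noteq> 0\<^sub>v n" using unit v by auto
  have n: "0 < n" using v0 v by (cases n) auto
  define b where "b = basis_completion v"
  define ws where "ws = gram_schmidt n b"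
  interpret cof_vec_space n "TYPE(real)" .
  note bc = basis_completion[OF v v0, folded b_def]
  obtain vs where bv: "b = v # vs" using bc(6,7) n by (cases b) auto
  note gs = gram_schmidt_result[OF bc(2,4,5) ws_def]
  have len: "length ws = n" using gs(4) bc(6) by simp
  have hd: "hd ws = v" unfolding ws_def bv by (simp add: v)
  have wsc: "ws ! i \<in> carrier_vec n" if "i < n" for i using gs(3) that len by auto
  have orth: "(ws ! i \<bullet> ws ! j = 0) = (i \<noteq> j)" if "i < n" "j < n" for i j
    using corthogonalD[OF gs(2)] that len by simp
  have w0: "ws ! 0 = v" using hd len n by (cases ws) auto
  have pos: "0 < ws ! i \<bullet> ws ! i" if "i < n" for i
    by (metis order.order_iff_strict orth that vec_norm2_sq zero_le_power2)
  define W where "W = mat n n (\<lambda>(a, j). ws ! j $ a / sqrt (ws ! j \<bullet> ws ! j))"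
  have colW: "col W j = (1 / sqrt (ws ! j \<bullet> ws ! j)) \<cdot>\<^sub>v (ws ! j)" if "j < n" for j
    using that wsc[OF that] by (intro eq_vecI) (auto simp: W_def)
  show ?thesis
  proof
    show W: "W \<in> carrier_mat n n" by (simp add: W_def)
    show "transpose_mat W * W = 1\<^sub>m n"
    proof (rule eq_matI)
      fix i j assume ij: "i < dim_row (1\<^sub>m n)" "j < dim_col (1\<^sub>m n)"
      then have ij: "i < n" "j < n" by auto
      have "(transpose_mat W * W) $$ (i, j) = col W i \<bullet> col W j" using ij W by simp
      also have "\<dots> = (ws ! i \<bullet> ws ! j) / (sqrt (ws ! i \<bullet> ws ! i) * sqrt (ws ! j \<bullet> ws ! j))"
        using ij wsc[OF ij(1)] wsc[OF ij(2)] by (simp add: colW)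
      also have "\<dots> = 1\<^sub>m n $$ (i, j)"
        using ij pos[of j] orth[of i j] by (cases "i = j") (auto simp: real_sqrt_mult[symmetric])
      finally show "(transpose_mat W * W) $$ (i, j) = 1\<^sub>m n $$ (i, j)" .
    qed (use W in auto)
    show "col W 0 = v" using colW[OF n] unit w0 by simp
  qed (rule n)
qed

text \<open>Deflation by induction on the list of roots: in an orthonormal basis starting with a
  unit eigenvector, symmetry clears the first row along with the first column, and cancelling a
  linear factor leaves the remaining roots for the smaller block. Splitting over the reals is an
  assumption, so that complex numbers are confined to one other lemma.\<close>

lemma symmetric_diagonalization_aux:
  fixes A :: "real mat"
  assumes "A \<in> carrier_mat n n" "transpose_mat A = A" "char_poly A = (\<Prod>e\<leftarrow>es. [:- e, 1:])"
  shows "\<exists>Q \<in> carrier_mat n n. transpose_mat Q * Q = 1\<^sub>m n \<and>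
    transpose_mat Q * A * Q = mat n n (\<lambda>(i, j). if i = j then es ! i else 0)"
  using assms
proof (induction es arbitrary: A n)
  case Nil
  then have "n = 0" using degree_monic_char_poly[of A n] by auto
  then show ?case using Nil by (intro bexI[of _ "1\<^sub>m 0"]) auto
next
  case (Cons e es A n)
  note A = Cons.prems(1)
  note AT = Cons.prems(2)
  have "poly (char_poly A) e = 0" unfolding Cons.prems(3) by simp
  then have "eigenvalue A e" using eigenvalue_root_char_poly[OF A] by simp
  then obtain v' where "eigenvector A v' e" unfolding eigenvalue_def by auto
  then have v': "v' \<in> carrier_vec n" "v' \<noteq> 0\<^sub>v n" "A *\<^sub>v v' = e \<cdot>\<^sub>v v'"
    using A by (auto simp: eigenvector_def)
  define v where "v = (1 / sqrt (v' \<bullet> v')) \<cdot>\<^sub>v v'"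
  have pos: "0 < v' \<bullet> v'" by (rule scalar_prod_self_pos[OF v'(1,2)])
  have v: "v \<in> carrier_vec n" using v' by (simp add: v_def)
  have "v \<bullet> v = 1" using pos v'(1) by (simp add: v_def real_sqrt_mult[symmetric])
  from orthonormal_completion[OF v this] obtain W where
    W: "W \<in> carrier_mat n n" and WW: "transpose_mat W * W = 1\<^sub>m n" and col0: "col W 0 = v" and n: "0 < n" .
  have Av: "A *\<^sub>v v = e \<cdot>\<^sub>v v"
    using A v' by (simp add: v_def mult_mat_vec smult_smult_assoc mult.commute)
  have WT: "transpose_mat W \<in> carrier_mat n n" using W by simp
  have WW': "W * transpose_mat W = 1\<^sub>m n" by (rule mat_mult_left_right_inverse[OF WT W WW])
  define A' where "A' = transpose_mat W * A * W"
  have A': "A' \<in> carrier_mat n n" using A W by (simp add: A'_def)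
  have A'T: "transpose_mat A' = A'"
  proof -
    have "transpose_mat A' = transpose_mat W * transpose_mat (transpose_mat W * A)"
      unfolding A'_def using W A by (subst transpose_mult[of _ n n _ n]) auto
    also have "transpose_mat (transpose_mat W * A) = A * W"
      using W A AT by (subst transpose_mult[of _ n n _ n]) auto
    also have "transpose_mat W * (A * W) = A'"
      unfolding A'_def by (rule assoc_mult_mat[OF WT A W, symmetric])
    finally show ?thesis .
  qed
  have A'_col: "A' $$ (i, 0) = (if i = 0 then e else 0)" if i: "i < n" for i
  proof -
    have "A' = transpose_mat W * (A * W)" unfolding A'_def by (rule assoc_mult_mat[OF WT A W])
    then have "A' $$ (i, 0) = col W i \<bullet> col (A * W) 0" using i n W A by simp
    also have "col (A * W) 0 = A *\<^sub>v col W 0" using W A n by (intro eq_vecI) auto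
    also have "\<dots> = e \<cdot>\<^sub>v v" by (simp add: col0 Av)
    also have "col W i \<bullet> (e \<cdot>\<^sub>v v) = e * (col W i \<bullet> v)"
      using W i v by (intro scalar_prod_smult_distrib) auto
    also have "col W i \<bullet> v = (transpose_mat W * W) $$ (i, 0)" using i n W by (simp add: col0)
    also have "e * \<dots> = (if i = 0 then e else 0)" unfolding WW using i n by simp
    finally show ?thesis .
  qed
  have A'_row: "A' $$ (0, i) = (if i = 0 then e else 0)" if i: "i < n" for i
    using A'_col[OF i] A'T A' i n by (metis carrier_matD index_transpose_mat(1))
  define k where "k = n - 1"
  have nk: "n = 1 + k" using n by (simp add: k_def)
  define A3 where "A3 = mat k k (\<lambda>(i, j). A' $$ (Suc i, Suc j))"
  define E where "E = mat 1 1 (\<lambda>_. e)"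
  have A3: "A3 \<in> carrier_mat k k" by (simp add: A3_def)
  have Ec: "E \<in> carrier_mat 1 1" by (simp add: E_def)
  have blk: "A' = four_block_mat E (0\<^sub>m 1 k) (0\<^sub>m k 1) A3"
    using A' A'_row A'_col by (intro eq_matI) (auto simp: E_def A3_def nk less_Suc_eq_0_disj)
  have A3T: "transpose_mat A3 = A3"
  proof (rule eq_matI)
    fix i j assume "i < dim_row A3" "j < dim_col A3"
    then have ij: "i < k" "j < k" by (auto simp: A3_def)
    have "A' $$ (Suc j, Suc i) = transpose_mat A' $$ (Suc i, Suc j)" using ij A' nk by simp
    also have "\<dots> = A' $$ (Suc i, Suc j)" by (simp only: A'T)
    finally show "transpose_mat A3 $$ (i, j) = A3 $$ (i, j)" using ij by (simp add: A3_def)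
  qed (auto simp: A3_def)
  have "similar_mat A' A"
    unfolding similar_mat_def similar_mat_wit_def
    using A W A' WW WW' by (intro exI[of _ "transpose_mat W"] exI[of _ W]) (auto simp: A'_def Let_def)
  then have "char_poly A' = char_poly A" by (rule char_poly_similar)
  moreover have "char_poly A' = char_poly E * char_poly A3"
    unfolding blk by (rule char_poly_four_block_zeros_col) (auto simp: E_def A3_def)
  moreover have "char_poly E = [:- e, 1:]"
  proof -
    have "upper_triangular E" by (auto simp: E_def)
    from char_poly_upper_triangular[OF Ec this] show ?thesis by (simp add: E_def diag_mat_def)
  qed
  ultimately have "[:- e, 1:] * char_poly A3 = [:- e, 1:] * (\<Prod>e\<leftarrow>es. [:- e, 1:])"
    using Cons.prems(3) by simp
  then have "char_poly A3 = (\<Prod>e\<leftarrow>es. [:- e, 1:])" by (metis mult_left_cancel one_neq_zero pCons_eq_0_iff)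
  from Cons.IH[OF A3 A3T this] obtain Q3 where
    Q3: "Q3 \<in> carrier_mat k k" and QQ3: "transpose_mat Q3 * Q3 = 1\<^sub>m k"
    and QAQ3: "transpose_mat Q3 * A3 * Q3 = mat k k (\<lambda>(i, j). if i = j then es ! i else 0)" by auto
  define B where "B = four_block_mat (1\<^sub>m 1) (0\<^sub>m 1 k) (0\<^sub>m k 1) Q3"
  have B: "B \<in> carrier_mat n n" unfolding B_def nk by (rule four_block_carrier_mat[OF one_carrier_mat Q3])
  have BT: "transpose_mat B = four_block_mat (1\<^sub>m 1) (0\<^sub>m 1 k) (0\<^sub>m k 1) (transpose_mat Q3)"
    unfolding B_def using Q3 by (subst transpose_four_block_mat[of _ 1 1 _ k _ k]) auto
  have BB: "transpose_mat B * B = 1\<^sub>m n"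
    unfolding BT unfolding B_def using Q3
    by (subst mult_four_block_mat[of _ 1 1 _ k _ k _ _ 1 _ k]) (auto simp: QQ3 nk)
  have BAB: "transpose_mat B * A' * B = mat n n (\<lambda>(i, j). if i = j then (e # es) ! i else 0)"
  proof -
    have "transpose_mat B * A' = four_block_mat E (0\<^sub>m 1 k) (0\<^sub>m k 1) (transpose_mat Q3 * A3)"
      unfolding BT blk using Q3 Ec A3
      by (subst mult_four_block_mat[of _ 1 1 _ k _ k _ _ 1 _ k]) auto
    then have "transpose_mat B * A' * B = four_block_mat E (0\<^sub>m 1 k) (0\<^sub>m k 1) (transpose_mat Q3 * A3 * Q3)"
      unfolding B_def using Q3 Ec A3
      by (simp, subst mult_four_block_mat[of _ 1 1 _ k _ k _ _ 1 _ k]) auto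
    then show ?thesis unfolding QAQ3
      by (intro eq_matI) (auto simp: E_def nk nth_Cons split: nat.splits)
  qed
  have Bt: "transpose_mat B \<in> carrier_mat n n" using B by simp
  have QT: "transpose_mat (W * B) = transpose_mat B * transpose_mat W"
    by (rule transpose_mult[OF W B])
  have 1: "transpose_mat (W * B) * (W * B) = 1\<^sub>m n"
  proof -
    have "transpose_mat (W * B) * (W * B) = transpose_mat B * ((transpose_mat W * W) * B)"
      unfolding QT using assoc_mult_mat[OF Bt WT mult_carrier_mat[OF W B]] assoc_mult_mat[OF WT W B] by simp
    then show ?thesis using B BB by (simp add: WW)
  qed
  have 2: "transpose_mat (W * B) * A * (W * B) = transpose_mat B * A' * B"
    unfolding QT A'_def using Bt WT A W B
    by (simp add: assoc_mult_mat[of _ n n _ n _ n] del: assoc_mult_mat) 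
  show ?case using 1 2 BAB W B by (intro bexI[of _ "W * B"]) auto
qed

text \<open>Over the complex numbers the polynomial splits. A root \<open>a\<close> with eigenvector
  \<open>v\<close> is real since moving \<open>A\<close> across
  \<open>v \<bullet> conjugate v\<close> turns \<open>a\<close> into \<open>cnj a\<close>. The
  factorization is pulled back along the injective embedding of real polynomials.\<close>

lemma symmetric_char_poly_splits:
  fixes A :: "real mat"
  assumes A: "A \<in> carrier_mat n n" and AT: "transpose_mat A = A"
  obtains es where "char_poly A = (\<Prod>e\<leftarrow>es. [:- e, 1:])" "length es = n"
proof -
  let ?A = "map_mat complex_of_real A"
  have A': "?A \<in> carrier_mat n n" using A by simp
  obtain as where as: "char_poly ?A = (\<Prod>a\<leftarrow>as. [:- a, 1:])" "length as = n"
    using char_poly_factorized[OF A'] by auto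
  have real: "a \<in> \<real>" if "a \<in> set as" for a
  proof -
    have "poly (char_poly ?A) a = 0" unfolding as using that by (induction as) auto
    then have "eigenvalue ?A a" using eigenvalue_root_char_poly[OF A'] by simp
    then obtain v where v: "v \<in> carrier_vec n" "v \<noteq> 0\<^sub>v n" "?A *\<^sub>v v = a \<cdot>\<^sub>v v"
      using A unfolding eigenvalue_def eigenvector_def by auto
    have ATc: "transpose_mat ?A = ?A"
      by (rule eq_matI) (use A in \<open>auto simp: , metis AT carrier_matD index_transpose_mat(1)\<close>)
    have conjA: "?A *\<^sub>v conjugate v = conjugate (?A *\<^sub>v v)"
      using v(1) A by (intro eq_vecI) (auto simp: scalar_prod_def)
    have cv: "conjugate v \<in> carrier_vec n" using v by simp
    have "a * (v \<bullet> conjugate v) = (?A *\<^sub>v v) \<bullet> conjugate v" using v cv by simp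
    also have "\<dots> = v \<bullet> (?A *\<^sub>v conjugate v)"
      using transpose_vec_mult_scalar[OF A' cv v(1)] by (simp add: ATc)
    also have "\<dots> = cnj a * (v \<bullet> conjugate v)" unfolding conjA v(3)
      using v cv by (simp add: conjugate_smult_vec)
    finally have "a * (v \<bullet> conjugate v) = cnj a * (v \<bullet> conjugate v)" .
    moreover have "v \<bullet> conjugate v \<noteq> 0" using v by simp
    ultimately show ?thesis by (simp add: Reals_cnj_iff)
  qed
  define es where "es = map Re as"
  have "as = map complex_of_real es" unfolding es_def using real
    by (induction as) auto
  interpret h: map_poly_inj_comm_ring_hom complex_of_real ..
  have "char_poly ?A = map_poly complex_of_real (\<Prod>e\<leftarrow>es. [:- e, 1:])"
    unfolding as(1) \<open>as = map complex_of_real es\<close> by (simp add: h.hom_prod_list o_def)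
  moreover have "char_poly ?A = map_poly complex_of_real (char_poly A)"
    by (rule of_real_hom.char_poly_hom[OF A])
  ultimately have "char_poly A = (\<Prod>e\<leftarrow>es. [:- e, 1:])" by simp
  then show ?thesis by (rule that) (simp add: es_def as(2))
qed

text \<open>The equation with \<open>proots\<close> is what links the eigenvectors to the definition
  of \<open>singular_values\<close>.\<close>

lemma symmetric_eigenbasis:
  fixes S :: "real mat"
  assumes S: "S \<in> carrier_mat n n" and ST: "transpose_mat S = S"
  obtains Q es where "Q \<in> carrier_mat n n" "transpose_mat Q * Q = 1\<^sub>m n" "Q * transpose_mat Q = 1\<^sub>m n"
    "length es = n" "sorted (rev es)" "mset es = proots (char_poly S)"
    "\<And>j. j < n \<Longrightarrow> S *\<^sub>v col Q j = es ! j \<cdot>\<^sub>v col Q j"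
proof -
  obtain es0 where es0: "char_poly S = (\<Prod>e\<leftarrow>es0. [:- e, 1:])" "length es0 = n"
    using symmetric_char_poly_splits[OF S ST] .
  \<comment> \<open>\<open>symmetric_diagonalization_aux\<close> accepts the roots in any order; the
    descending one is the order of \<open>singular_values\<close>.\<close>
  define es where "es = rev (sort es0)"
  have ms: "mset es = mset es0" by (simp add: es_def)
  have "(\<Prod>e\<leftarrow>es. [:- e, 1:]) = prod_mset (image_mset (\<lambda>e. [:- e, 1:]) (mset es))"
    by (metis mset_map prod_mset_prod_list)
  also have "\<dots> = char_poly S" unfolding ms es0 by (metis mset_map prod_mset_prod_list)
  finally have cp: "char_poly S = (\<Prod>e\<leftarrow>es. [:- e, 1:])" ..
  have "proots (\<Prod>e\<leftarrow>es. [:- e, 1:]) = mset es"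
  proof (induction es)
    case (Cons e es)
    have "proots (\<Prod>e\<leftarrow>e # es. [:- e, 1:]) = proots [:- e, 1:] + proots (\<Prod>e\<leftarrow>es. [:- e, 1:])"
      by (simp only: list.map prod_list.Cons, rule proots_mult) (auto simp: prod_list_zero_iff)
    then show ?case by (simp add: Cons)
  qed simp
  then have pr: "mset es = proots (char_poly S)" by (simp add: cp)
  obtain Q where Q: "Q \<in> carrier_mat n n" "transpose_mat Q * Q = 1\<^sub>m n"
    and D: "transpose_mat Q * S * Q = mat n n (\<lambda>(i, j). if i = j then es ! i else 0)"
    using symmetric_diagonalization_aux[OF S ST cp] by auto
  have QT: "transpose_mat Q \<in> carrier_mat n n" using Q by simp
  have QQ: "Q * transpose_mat Q = 1\<^sub>m n" by (rule mat_mult_left_right_inverse[OF QT Q(1,2)])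
  have "S *\<^sub>v col Q j = es ! j \<cdot>\<^sub>v col Q j" if j: "j < n" for j
  proof -
    have cj: "col Q j \<in> carrier_vec n" using Q j by simp
    have eq: "Q * (transpose_mat Q * S * Q) = S * Q"
    proof -
      have "Q * (transpose_mat Q * S * Q) = (Q * transpose_mat Q) * (S * Q)"
        using Q S QT by (simp add: assoc_mult_mat[of _ n n _ n _ n])
      then show ?thesis using Q S by (simp add: QQ)
    qed
    have "S *\<^sub>v col Q j = col (S * Q) j" using Q S j by (intro eq_vecI) auto
    also have "\<dots> = Q *\<^sub>v col (mat n n (\<lambda>(i, j). if i = j then es ! i else 0)) j"
      unfolding eq[symmetric] D using Q j by (intro eq_vecI) auto
    also have "col (mat n n (\<lambda>(i, j). if i = j then es ! i else 0)) j = es ! j \<cdot>\<^sub>v unit_vec n j"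
      using j by (intro eq_vecI) auto
    also have "Q *\<^sub>v \<dots> = es ! j \<cdot>\<^sub>v (Q *\<^sub>v unit_vec n j)"
      by (rule mult_mat_vec[OF Q(1)]) simp
    also have "Q *\<^sub>v unit_vec n j = col Q j" using Q j by (intro eq_vecI) auto
    finally show ?thesis .
  qed
  then show ?thesis
    using that[OF Q(1,2) QQ _ _ pr] by (simp add: es_def es0(2))
qed

lemma parseval_columns:
  fixes Q :: "real mat"
  assumes Q: "Q \<in> carrier_mat n n" and QQ: "Q * transpose_mat Q = 1\<^sub>m n"
    and x: "x \<in> carrier_vec n" and y: "y \<in> carrier_vec n"
  shows "x \<bullet> y = (\<Sum>j<n. (col Q j \<bullet> x) * (col Q j \<bullet> y))"
proof -
  have QT: "transpose_mat Q \<in> carrier_mat n n" using Q by simp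
  have "x \<bullet> y = x \<bullet> ((Q * transpose_mat Q) *\<^sub>v y)" using y by (simp add: QQ)
  also have "\<dots> = x \<bullet> (Q *\<^sub>v (transpose_mat Q *\<^sub>v y))"
    using assoc_mult_mat_vec[OF Q QT y] by simp
  also have "\<dots> = (transpose_mat Q *\<^sub>v x) \<bullet> (transpose_mat Q *\<^sub>v y)"
    using QT y by (intro transpose_vec_mult_scalar[OF Q _ x, symmetric]) simp
  also have "\<dots> = (\<Sum>j<n. (col Q j \<bullet> x) * (col Q j \<bullet> y))"
    using Q unfolding scalar_prod_def[of "transpose_mat Q *\<^sub>v x"]
    by (intro sum.cong) (auto simp: atLeast0LessThan)
  finally show ?thesis .
qed

lemma eigenbasis_quadratic_form:
  fixes S :: "real mat"
  assumes S: "S \<in> carrier_mat n n" and ST: "transpose_mat S = S"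
    and Q: "Q \<in> carrier_mat n n" and QQ: "Q * transpose_mat Q = 1\<^sub>m n"
    and ev: "\<And>j. j < n \<Longrightarrow> S *\<^sub>v col Q j = es j \<cdot>\<^sub>v col Q j"
    and x: "x \<in> carrier_vec n" and y: "y \<in> carrier_vec n"
  shows "x \<bullet> (S *\<^sub>v y) = (\<Sum>j<n. es j * (col Q j \<bullet> x) * (col Q j \<bullet> y))"
proof -
  have Sy: "S *\<^sub>v y \<in> carrier_vec n" using S y by simp
  have "col Q j \<bullet> (S *\<^sub>v y) = es j * (col Q j \<bullet> y)" if j: "j < n" for j
  proof -
    have c: "col Q j \<in> carrier_vec n" using Q j by simp
    have "col Q j \<bullet> (S *\<^sub>v y) = (S *\<^sub>v col Q j) \<bullet> y"
      using transpose_vec_mult_scalar[OF S y c] by (simp add: ST)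
    then show ?thesis using ev[OF j] c y by simp
  qed
  then show ?thesis unfolding parseval_columns[OF Q QQ x Sy]
    by (intro sum.cong) (auto simp: algebra_simps)
qed

section \<open>Euclidean norm\<close>

lemma vec_norm2_zero [simp]: "vec_norm2 (0\<^sub>v n) = 0"
  by (simp add: vec_norm2_def)

lemma vec_norm2_eq_0: "v \<in> carrier_vec n \<Longrightarrow> vec_norm2 v = 0 \<longleftrightarrow> v = 0\<^sub>v n"
  using scalar_prod_self_pos[of v n] by (auto simp: vec_norm2_sq)

lemma vec_norm2_pos: "v \<in> carrier_vec n \<Longrightarrow> v \<noteq> 0\<^sub>v n \<Longrightarrow> 0 < vec_norm2 v"
  using vec_norm2_eq_0 vec_norm2_nonneg by (metis less_eq_real_def)

lemma vec_norm2_smult [simp]: "vec_norm2 (a \<cdot>\<^sub>v v) = \<bar>a\<bar> * vec_norm2 v"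
  by (simp add: vec_norm2_def smult_scalar_prod_distrib[OF carrier_vec_dim_vec]
      scalar_prod_smult_distrib[OF carrier_vec_dim_vec] real_sqrt_mult mult.assoc[symmetric])

lemma scalar_prod_cauchy_schwarz:
  assumes "x \<in> carrier_vec n" "y \<in> carrier_vec n"
  shows "\<bar>x \<bullet> y\<bar> \<le> vec_norm2 x * vec_norm2 y"
proof (rule abs_le_square_iff[THEN iffD2, of _ "vec_norm2 x * vec_norm2 y", simplified abs_of_nonneg[OF mult_nonneg_nonneg[OF vec_norm2_nonneg vec_norm2_nonneg]]])
  have "(x \<bullet> y)\<^sup>2 \<le> (\<Sum>i = 0..<n. (x $ i)\<^sup>2) * (\<Sum>i = 0..<n. (y $ i)\<^sup>2)"
    using assms Cauchy_Schwarz_ineq_sum[of "\<lambda>i. x $ i" "\<lambda>i. y $ i" "{0..<n}"]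
    by (simp add: scalar_prod_def)
  also have "\<dots> = (vec_norm2 x * vec_norm2 y)\<^sup>2"
    using assms unfolding power_mult_distrib vec_norm2_sq[symmetric]
    by (simp add: scalar_prod_def power2_eq_square)
  finally show "(x \<bullet> y)\<^sup>2 \<le> (vec_norm2 x * vec_norm2 y)\<^sup>2" .
qed

lemma vec_norm2_triangle:
  assumes x: "x \<in> carrier_vec n" and y: "y \<in> carrier_vec n"
  shows "vec_norm2 (x + y) \<le> vec_norm2 x + vec_norm2 y"
proof (rule power2_le_imp_le)
  have "(vec_norm2 (x + y))\<^sup>2 = x \<bullet> x + 2 * (x \<bullet> y) + y \<bullet> y"
    using x y comm_scalar_prod[OF x y]
    by (simp add: vec_norm2_sq[symmetric] add_scalar_prod_distrib[of _ n] scalar_prod_add_distrib[of _ n])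
  also have "\<dots> \<le> (vec_norm2 x + vec_norm2 y)\<^sup>2"
    using scalar_prod_cauchy_schwarz[OF x y] by (simp add: vec_norm2_sq power2_sum)
  finally show "(vec_norm2 (x + y))\<^sup>2 \<le> (vec_norm2 x + vec_norm2 y)\<^sup>2" .
qed (simp add: vec_norm2_nonneg)

lemma vec_norm2_minus_le:
  assumes "x \<in> carrier_vec n" "y \<in> carrier_vec n"
  shows "vec_norm2 (x - y) \<le> vec_norm2 x + vec_norm2 y"
proof -
  have "x - y = x + (-1) \<cdot>\<^sub>v y" using assms by (intro eq_vecI) auto
  then show ?thesis using vec_norm2_triangle[of x n "(-1) \<cdot>\<^sub>v y"] assms by simp
qed

lemma vec_norm2_orthonormal_mult:
  assumes K: "K \<in> carrier_mat n r" and KK: "transpose_mat K * K = 1\<^sub>m r" and z: "z \<in> carrier_vec r"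
  shows "vec_norm2 (K *\<^sub>v z) = vec_norm2 z"
proof -
  have KT: "transpose_mat K \<in> carrier_mat r n" using K by simp
  have "(K *\<^sub>v z) \<bullet> (K *\<^sub>v z) = (transpose_mat K *\<^sub>v (K *\<^sub>v z)) \<bullet> z"
    using transpose_vec_mult_scalar[OF K z, of "K *\<^sub>v z"] K z by simp
  also have "transpose_mat K *\<^sub>v (K *\<^sub>v z) = z"
    using assoc_mult_mat_vec[OF KT K z] z by (simp add: KK)
  finally show ?thesis by (simp add: vec_norm2_def)
qed

text \<open>Testing \<open>A\<close> at the vector \<open>A\<^sup>T y\<close> itself produces the
  square of the left-hand side. Operator bounds are kept as pointwise inequalities with an arbitrary
  constant, so that they pass to the transpose without computing a norm.\<close>

lemma adjoint_norm_le:
  assumes A: "A \<in> carrier_mat n m" and c: "\<And>x. x \<in> carrier_vec m \<Longrightarrow> vec_norm2 (A *\<^sub>v x) \<le> c * vec_norm2 x"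
    and c0: "0 \<le> c" and y: "y \<in> carrier_vec n"
  shows "vec_norm2 (transpose_mat A *\<^sub>v y) \<le> c * vec_norm2 y"
proof -
  let ?w = "transpose_mat A *\<^sub>v y"
  have w: "?w \<in> carrier_vec m" using A y by simp
  have "(vec_norm2 ?w)\<^sup>2 = y \<bullet> (A *\<^sub>v ?w)"
    using transpose_vec_mult_scalar[OF A w y] by (simp add: vec_norm2_sq)
  also have "\<dots> \<le> vec_norm2 y * vec_norm2 (A *\<^sub>v ?w)"
    using scalar_prod_cauchy_schwarz[OF y, of "A *\<^sub>v ?w"] A w by simp
  also have "\<dots> \<le> vec_norm2 y * (c * vec_norm2 ?w)"
    by (intro mult_left_mono c w vec_norm2_nonneg)
  finally have "vec_norm2 ?w * vec_norm2 ?w \<le> (c * vec_norm2 y) * vec_norm2 ?w"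
    by (simp add: power2_eq_square algebra_simps)
  moreover have "0 \<le> c * vec_norm2 y" using c0 vec_norm2_nonneg by simp
  ultimately show ?thesis using vec_norm2_nonneg[of ?w]
    by (metis less_eq_real_def mult_right_le_imp_le)
qed

section \<open>Singular values and the spectral norm\<close>

text \<open>Links the definition by roots of a characteristic polynomial to an orthonormal basis of
  right singular vectors. Later arguments rely on these properties and no longer mention the
  polynomial.\<close>

lemma singular_value_basis:
  assumes A: "A \<in> carrier_mat n m"
  obtains Q where "Q \<in> carrier_mat m m" "transpose_mat Q * Q = 1\<^sub>m m" "Q * transpose_mat Q = 1\<^sub>m m"
    "length (singular_values A) = m"
    "\<forall>j<m. 0 \<le> singular_values A ! j"
    "\<forall>i j. i \<le> j \<longrightarrow> j < m \<longrightarrow> singular_values A ! j \<le> singular_values A ! i"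
    "\<forall>x\<in>carrier_vec m.
      (vec_norm2 (A *\<^sub>v x))\<^sup>2 = (\<Sum>j<m. (singular_values A ! j)\<^sup>2 * (col Q j \<bullet> x)\<^sup>2)"
proof -
  let ?S = "transpose_mat A * A"
  have AT: "transpose_mat A \<in> carrier_mat m n" using A by simp
  have S: "?S \<in> carrier_mat m m" using A by simp
  have ST: "transpose_mat ?S = ?S" using transpose_mult[OF AT A] by simp
  obtain Q es where Q: "Q \<in> carrier_mat m m" "transpose_mat Q * Q = 1\<^sub>m m" "Q * transpose_mat Q = 1\<^sub>m m"
    and es: "length es = m" "sorted (rev es)" "mset es = proots (char_poly ?S)"
    and ev: "\<And>j. j < m \<Longrightarrow> ?S *\<^sub>v col Q j = es ! j \<cdot>\<^sub>v col Q j"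
    using symmetric_eigenbasis[OF S ST] by metis
  have quad: "(vec_norm2 (A *\<^sub>v x))\<^sup>2 = (\<Sum>j<m. es ! j * (col Q j \<bullet> x)\<^sup>2)" if x: "x \<in> carrier_vec m" for x
  proof -
    have "(vec_norm2 (A *\<^sub>v x))\<^sup>2 = (transpose_mat A *\<^sub>v (A *\<^sub>v x)) \<bullet> x"
      using transpose_vec_mult_scalar[OF A x, of "A *\<^sub>v x"] A x by (simp add: vec_norm2_sq)
    also have "\<dots> = x \<bullet> (?S *\<^sub>v x)"
      unfolding assoc_mult_mat_vec[OF AT A x, symmetric]
      by (rule comm_scalar_prod[OF mult_mat_vec_carrier[OF S x] x])
    also have "\<dots> = (\<Sum>j<m. es ! j * (col Q j \<bullet> x)\<^sup>2)"
      using eigenbasis_quadratic_form[where es = "\<lambda>j. es ! j", OF S ST Q(1,3) ev x x]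
      by (simp add: power2_eq_square mult.assoc)
    finally show ?thesis .
  qed
  have nonneg: "0 \<le> es ! j" if j: "j < m" for j
  proof -
    have c: "col Q j \<in> carrier_vec m" using Q j by simp
    have d: "col Q i \<bullet> col Q j = (if i = j then 1 else 0)" if i: "i < m" for i
    proof -
      have "col Q i \<bullet> col Q j = (transpose_mat Q * Q) $$ (i, j)" using Q(1) i j by simp
      then show ?thesis unfolding Q(2) using i j by simp
    qed
    \<comment> \<open>Evaluated at its own eigenvector, the quadratic form returns the eigenvalue,
      which is therefore nonnegative.\<close>
    have "(\<Sum>i<m. es ! i * (col Q i \<bullet> col Q j)\<^sup>2) = (\<Sum>i<m. if i = j then es ! j else 0)"
      by (intro sum.cong) (auto simp: d)
    then have "(vec_norm2 (A *\<^sub>v col Q j))\<^sup>2 = es ! j" using j by (simp add: quad[OF c])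
    then show ?thesis by (metis zero_le_power2)
  qed
  \<comment> \<open>\<open>sqrt\<close> is monotone, so taking roots keeps the descending order and
    the sorting in the definition changes nothing.\<close>
  have sv: "singular_values A = map sqrt es"
  proof -
    have "sorted (map sqrt (rev es))"
      using es(2) by (auto simp: sorted_iff_nth_mono_less intro: real_sqrt_le_mono)
    then have "sorted_list_of_multiset (image_mset sqrt (mset es)) = rev (map sqrt es)"
      by (metis mset_map mset_rev rev_map sorted_list_of_multiset_mset sorted_sort_id)
    then show ?thesis unfolding singular_values_def es(3)[symmetric] by simp
  qed
  show ?thesis
  proof (rule that[OF Q])
    show "length (singular_values A) = m" by (simp add: sv es(1))
    show "\<forall>j<m. 0 \<le> singular_values A ! j" using nonneg by (simp add: sv es(1))
    show "\<forall>i j. i \<le> j \<longrightarrow> j < m \<longrightarrow> singular_values A ! j \<le> singular_values A ! i"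
      using sorted_rev_nth_mono[OF es(2)] by (simp add: sv es(1))
    show "\<forall>x\<in>carrier_vec m. (vec_norm2 (A *\<^sub>v x))\<^sup>2
        = (\<Sum>j<m. (singular_values A ! j)\<^sup>2 * (col Q j \<bullet> x)\<^sup>2)"
    proof
      fix x :: "real vec" assume x: "x \<in> carrier_vec m"
      show "(vec_norm2 (A *\<^sub>v x))\<^sup>2 = (\<Sum>j<m. (singular_values A ! j)\<^sup>2 * (col Q j \<bullet> x)\<^sup>2)"
        unfolding quad[OF x] by (intro sum.cong) (auto simp: sv es(1) nonneg)
    qed
  qed
qed

text \<open>Padding with zero rows gives a square matrix whose last row vanishes, hence a zero
  determinant.\<close>

lemma wide_matrix_kernel:
  fixes B :: "real mat"
  assumes B: "B \<in> carrier_mat p r" and pr: "p < r"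
  obtains z where "z \<in> carrier_vec r" "z \<noteq> 0\<^sub>v r" "B *\<^sub>v z = 0\<^sub>v p"
proof -
  define B' where "B' = mat r r (\<lambda>(i, j). if i < p then B $$ (i, j) else 0)"
  have B': "B' \<in> carrier_mat r r" by (simp add: B'_def)
  have row0: "row B' (r - 1) = 0\<^sub>v r" using pr by (intro eq_vecI) (auto simp: B'_def)
  have "transpose_mat B' *\<^sub>v unit_vec r (r - 1) = 0\<^sub>v r"
  proof (rule eq_vecI)
    fix i assume "i < dim_vec (0\<^sub>v r :: real vec)"
    then show "(transpose_mat B' *\<^sub>v unit_vec r (r - 1)) $ i = (0\<^sub>v r :: real vec) $ i"
      using pr by (simp add: B'_def)
  qed (simp add: B'_def)
  then have "det (transpose_mat B') = 0"
    using B' pr by (subst det_0_iff_vec_prod_zero_field[of _ r]) (auto intro!: exI[of _ "unit_vec r (r - 1)"])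
  then have "det B' = 0" using B' by (simp add: det_transpose)
  then obtain z where z: "z \<in> carrier_vec r" "z \<noteq> 0\<^sub>v r" "B' *\<^sub>v z = 0\<^sub>v r"
    using det_0_iff_vec_prod_zero_field[OF B'] by auto
  have "B *\<^sub>v z = 0\<^sub>v p"
  proof (rule eq_vecI)
    fix i assume "i < dim_vec (0\<^sub>v p :: real vec)"
    then have i: "i < p" by simp
    then have "row B i = row B' i" using B pr by (intro eq_vecI) (auto simp: B'_def)
    moreover have "(B' *\<^sub>v z) $ i = 0" using z(3) i pr by simp
    ultimately show "(B *\<^sub>v z) $ i = (0\<^sub>v p :: real vec) $ i" using B B' i pr by simp
  qed (use B in simp)
  then show ?thesis using that z by blast
qed

lemma sing_val_nonneg: "0 \<le> sing_val i A"
proof -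
  obtain Q where "length (singular_values A) = dim_col A"
    "\<And>j. j < dim_col A \<Longrightarrow> 0 \<le> singular_values A ! j"
    using singular_value_basis[OF carrier_mat_triv[of A]] by metis
  then show ?thesis by (auto simp: sing_val_def)
qed

text \<open>The two halves of the Courant--Fischer principle.\<close>

lemma sing_val_ge:
  assumes A: "A \<in> carrier_mat n m" and K: "K \<in> carrier_mat m r" and r: "1 \<le> r" and s: "0 \<le> s"
    and inj: "\<And>z. z \<in> carrier_vec r \<Longrightarrow> z \<noteq> 0\<^sub>v r \<Longrightarrow> K *\<^sub>v z \<noteq> 0\<^sub>v m"
    and lower: "\<And>z. z \<in> carrier_vec r \<Longrightarrow> s * vec_norm2 (K *\<^sub>v z) \<le> vec_norm2 (A *\<^sub>v (K *\<^sub>v z))"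
  shows "s \<le> sing_val r A"
proof -
  obtain Q where Q: "Q \<in> carrier_mat m m" "transpose_mat Q * Q = 1\<^sub>m m" "Q * transpose_mat Q = 1\<^sub>m m"
    and len: "length (singular_values A) = m"
    and nonneg': "\<forall>j<m. 0 \<le> singular_values A ! j"
    and mono': "\<forall>i j. i \<le> j \<longrightarrow> j < m \<longrightarrow> singular_values A ! j \<le> singular_values A ! i"
    and quad': "\<forall>x\<in>carrier_vec m.
      (vec_norm2 (A *\<^sub>v x))\<^sup>2 = (\<Sum>j<m. (singular_values A ! j)\<^sup>2 * (col Q j \<bullet> x)\<^sup>2)"
    using singular_value_basis[OF A] .
  note nonneg = nonneg'[rule_format] and mono = mono'[rule_format] and quad = quad'[rule_format]
  have rm: "r \<le> m"
    using wide_matrix_kernel[OF K] inj by (metis not_le)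
  \<comment> \<open>Only \<open>r - 1\<close> conditions are imposed on \<open>r\<close>
    coordinates, so some nonzero vector in the range of \<open>K\<close> is orthogonal to the
    leading \<open>r - 1\<close> singular vectors; there \<open>A\<close> stretches by at most the
    \<open>r\<close>-th singular value.\<close>
  define B where "B = mat (r - 1) r (\<lambda>(i, j). col Q i \<bullet> col K j)"
  have B: "B \<in> carrier_mat (r - 1) r" by (simp add: B_def)
  obtain z where z: "z \<in> carrier_vec r" "z \<noteq> 0\<^sub>v r" "B *\<^sub>v z = 0\<^sub>v (r - 1)"
    using wide_matrix_kernel[OF B] r by auto
  define x where "x = K *\<^sub>v z"
  have x: "x \<in> carrier_vec m" using K z by (simp add: x_def)
  have xpos: "0 < vec_norm2 x" using inj[OF z(1,2)] x by (simp add: x_def vec_norm2_pos)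
  have orth: "col Q j \<bullet> x = 0" if j: "j < r - 1" for j
  proof -
    have c: "col Q j \<in> carrier_vec m" by (rule col_carrier_vec[OF _ Q(1)]) (use j rm in linarith)
    have "col Q j \<bullet> x = (transpose_mat K *\<^sub>v col Q j) \<bullet> z"
      unfolding x_def by (rule transpose_vec_mult_scalar[OF K z(1) c, symmetric])
    also have "transpose_mat K *\<^sub>v col Q j = row B j"
      using K j c by (intro eq_vecI) (auto simp: B_def comm_scalar_prod[of _ m])
    also have "row B j \<bullet> z = (B *\<^sub>v z) $ j" using j by (simp add: B_def)
    finally show ?thesis using z(3) j by simp
  qed
  have "(vec_norm2 (A *\<^sub>v x))\<^sup>2 \<le> (\<Sum>j<m. (singular_values A ! (r - 1))\<^sup>2 * (col Q j \<bullet> x)\<^sup>2)"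
    unfolding quad[OF x]
  proof (rule sum_mono)
    fix j assume j: "j \<in> {..<m}"
    show "(singular_values A ! j)\<^sup>2 * (col Q j \<bullet> x)\<^sup>2 \<le> (singular_values A ! (r - 1))\<^sup>2 * (col Q j \<bullet> x)\<^sup>2"
    proof (cases "j < r - 1")
      case False
      then show ?thesis using j nonneg mono by (intro mult_right_mono power_mono) auto
    qed (simp add: orth)
  qed
  also have "\<dots> = (singular_values A ! (r - 1) * vec_norm2 x)\<^sup>2"
    by (simp add: sum_distrib_left[symmetric] power_mult_distrib vec_norm2_sq[symmetric]
        parseval_columns[OF Q(1,3) x x] power2_eq_square[symmetric])
  finally have "(vec_norm2 (A *\<^sub>v x))\<^sup>2 \<le> (singular_values A ! (r - 1) * vec_norm2 x)\<^sup>2" .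
  moreover have "0 \<le> singular_values A ! (r - 1) * vec_norm2 x"
    using rm r nonneg[of "r - 1"] vec_norm2_nonneg by simp
  ultimately have "vec_norm2 (A *\<^sub>v x) \<le> singular_values A ! (r - 1) * vec_norm2 x"
    by (rule power2_le_imp_le)
  then have "s * vec_norm2 x \<le> singular_values A ! (r - 1) * vec_norm2 x"
    using lower[OF z(1)] by (simp add: x_def)
  then show ?thesis using xpos r rm by (simp add: sing_val_def len)
qed

lemma sing_val_subspace:
  assumes A: "A \<in> carrier_mat n m" and r: "1 \<le> r" "r \<le> m"
  obtains K where "K \<in> carrier_mat m r" "transpose_mat K * K = 1\<^sub>m r"
    "\<And>z. z \<in> carrier_vec r \<Longrightarrow> sing_val r A * vec_norm2 z \<le> vec_norm2 (A *\<^sub>v (K *\<^sub>v z))"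
proof -
  obtain Q where Q: "Q \<in> carrier_mat m m" "transpose_mat Q * Q = 1\<^sub>m m" "Q * transpose_mat Q = 1\<^sub>m m"
    and len: "length (singular_values A) = m"
    and nonneg': "\<forall>j<m. 0 \<le> singular_values A ! j"
    and mono': "\<forall>i j. i \<le> j \<longrightarrow> j < m \<longrightarrow> singular_values A ! j \<le> singular_values A ! i"
    and quad': "\<forall>x\<in>carrier_vec m.
      (vec_norm2 (A *\<^sub>v x))\<^sup>2 = (\<Sum>j<m. (singular_values A ! j)\<^sup>2 * (col Q j \<bullet> x)\<^sup>2)"
    using singular_value_basis[OF A] .
  note nonneg = nonneg'[rule_format] and mono = mono'[rule_format] and quad = quad'[rule_format]
  define K where "K = mat m r (\<lambda>(i, j). Q $$ (i, j))"
  have K: "K \<in> carrier_mat m r" by (simp add: K_def)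
  have colK: "col K j = col Q j" if "j < r" for j
    using that r Q(1) by (intro eq_vecI) (auto simp: K_def)
  have QK: "col Q i \<bullet> col Q j = (if i = j then 1 else 0)" if "i < m" "j < m" for i j
  proof -
    have "col Q i \<bullet> col Q j = (transpose_mat Q * Q) $$ (i, j)" using Q(1) that by simp
    then show ?thesis unfolding Q(2) using that by simp
  qed
  have KK: "transpose_mat K * K = 1\<^sub>m r"
    using K r by (intro eq_matI) (auto simp: colK QK)
  have sv: "sing_val r A = singular_values A ! (r - 1)" using r by (simp add: sing_val_def len)
  have "sing_val r A * vec_norm2 z \<le> vec_norm2 (A *\<^sub>v (K *\<^sub>v z))" if z: "z \<in> carrier_vec r" for z
  proof (rule power2_le_imp_le)
    have Kz: "K *\<^sub>v z \<in> carrier_vec m" using K z by simp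
    have cz: "col Q j \<bullet> (K *\<^sub>v z) = z $ j" if j: "j < r" for j
    proof -
      have c: "col Q j \<in> carrier_vec m" by (rule col_carrier_vec[OF _ Q(1)]) (use j r in linarith)
      have "col Q j \<bullet> (K *\<^sub>v z) = (transpose_mat K *\<^sub>v col K j) \<bullet> z"
        using transpose_vec_mult_scalar[OF K z c] by (simp add: colK[OF j])
      also have "transpose_mat K *\<^sub>v col K j = unit_vec r j"
        using K j r by (intro eq_vecI) (auto simp: colK QK)
      finally show ?thesis using z j by simp
    qed
    have "(sing_val r A * vec_norm2 z)\<^sup>2 = (\<Sum>j<r. (sing_val r A)\<^sup>2 * (z $ j)\<^sup>2)"
      using z unfolding power_mult_distrib vec_norm2_sq[symmetric]
      by (simp add: scalar_prod_def sum_distrib_left power2_eq_square[of "z $ _"] atLeast0LessThan)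
    also have "\<dots> \<le> (\<Sum>j<r. (singular_values A ! j)\<^sup>2 * (col Q j \<bullet> (K *\<^sub>v z))\<^sup>2)"
      using r mono nonneg by (intro sum_mono) (auto simp: cz sv intro!: mult_right_mono power_mono)
    also have "\<dots> \<le> (\<Sum>j<m. (singular_values A ! j)\<^sup>2 * (col Q j \<bullet> (K *\<^sub>v z))\<^sup>2)"
      using r by (intro sum_mono2) auto
    also have "\<dots> = (vec_norm2 (A *\<^sub>v (K *\<^sub>v z)))\<^sup>2" by (rule quad[OF Kz, symmetric])
    finally show "(sing_val r A * vec_norm2 z)\<^sup>2 \<le> (vec_norm2 (A *\<^sub>v (K *\<^sub>v z)))\<^sup>2" .
  qed (rule vec_norm2_nonneg)
  then show ?thesis using that K KK by blast
qed

text \<open>The subspace bound \<open>sing_val_ge\<close>, applied to the line through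
  \<open>x\<close>.\<close>

lemma norm_mult_le_sing_val:
  assumes A: "A \<in> carrier_mat n m" and x: "x \<in> carrier_vec m"
  shows "vec_norm2 (A *\<^sub>v x) \<le> sing_val 1 A * vec_norm2 x"
proof (cases "x = 0\<^sub>v m")
  case True
  then have "A *\<^sub>v x = 0\<^sub>v n" using A by (intro eq_vecI) auto
  then show ?thesis by (simp add: True)
next
  case False
  define K where "K = mat m 1 (\<lambda>(i, j). x $ i)"
  have K: "K \<in> carrier_mat m 1" by (simp add: K_def)
  have Kz: "K *\<^sub>v z = z $ 0 \<cdot>\<^sub>v x" if "z \<in> carrier_vec 1" for z
    using that x by (intro eq_vecI) (auto simp: K_def scalar_prod_def)
  have pos: "0 < vec_norm2 x" using False x by (rule vec_norm2_pos[rotated])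
  have "vec_norm2 (A *\<^sub>v x) / vec_norm2 x \<le> sing_val 1 A"
  proof (rule sing_val_ge[OF A K])
    fix z :: "real vec" assume z: "z \<in> carrier_vec 1"
    show "vec_norm2 (A *\<^sub>v x) / vec_norm2 x * vec_norm2 (K *\<^sub>v z) \<le> vec_norm2 (A *\<^sub>v (K *\<^sub>v z))"
      using pos by (simp add: Kz[OF z] mult_mat_vec[OF A x])
    assume z0: "z \<noteq> 0\<^sub>v 1"
    then have "z $ 0 \<noteq> 0" using z by (intro notI, elim notE) (auto intro!: eq_vecI)
    then have "0 < vec_norm2 (K *\<^sub>v z)" using pos by (simp add: Kz[OF z])
    then show "K *\<^sub>v z \<noteq> 0\<^sub>v m" by auto
  qed (auto simp: vec_norm2_nonneg)
  then show ?thesis using pos by (simp add: field_simps)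
qed

section \<open>The spectral norm as an operator bound\<close>

lemma spectral_norm_bdd:
  "bdd_above ((\<lambda>v. vec_norm2 (A *\<^sub>v v)) ` {v \<in> carrier_vec (dim_col A). vec_norm2 v \<le> 1})"
\<comment> \<open>A real supremum is only meaningful for a bounded set; here the largest singular
  value is an upper bound.\<close>
proof (rule bdd_aboveI2)
  fix v assume v: "v \<in> {v \<in> carrier_vec (dim_col A). vec_norm2 v \<le> 1}"
  then have "vec_norm2 (A *\<^sub>v v) \<le> sing_val 1 A * vec_norm2 v"
    using norm_mult_le_sing_val[OF carrier_mat_triv, of v A] by simp
  also have "\<dots> \<le> sing_val 1 A * 1" using v sing_val_nonneg by (intro mult_left_mono) auto
  finally show "vec_norm2 (A *\<^sub>v v) \<le> sing_val 1 A" by simp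
qed

lemma spectral_norm_bound:
  assumes A: "A \<in> carrier_mat n m" and v: "v \<in> carrier_vec m"
  shows "vec_norm2 (A *\<^sub>v v) \<le> spectral_norm A * vec_norm2 v"
proof -
  show ?thesis
  proof (cases "v = 0\<^sub>v m")
    case True
    then have "A *\<^sub>v v = 0\<^sub>v n" using A by (intro eq_vecI) auto
    then show ?thesis by (simp add: True)
  next
    case False
    have pos: "0 < vec_norm2 v" by (rule vec_norm2_pos[OF v False])
    have "vec_norm2 (A *\<^sub>v ((1 / vec_norm2 v) \<cdot>\<^sub>v v)) \<le> spectral_norm A"
      unfolding spectral_norm_def by (rule cSUP_upper[OF _ spectral_norm_bdd]) (use pos v A in auto)
    then show ?thesis using pos by (simp add: mult_mat_vec[OF A v] field_simps)
  qed
qed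

lemma spectral_norm_le:
  assumes A: "A \<in> carrier_mat n m" and c: "0 \<le> c"
    and "\<And>v. v \<in> carrier_vec m \<Longrightarrow> vec_norm2 (A *\<^sub>v v) \<le> c * vec_norm2 v"
  shows "spectral_norm A \<le> c"
  unfolding spectral_norm_def
proof (rule cSUP_least)
  have "0\<^sub>v (dim_col A) \<in> {v \<in> carrier_vec (dim_col A). vec_norm2 v \<le> 1}" by simp
  then show "{v \<in> carrier_vec (dim_col A). vec_norm2 v \<le> 1} \<noteq> {}" by blast
  fix v assume v: "v \<in> {v \<in> carrier_vec (dim_col A). vec_norm2 v \<le> 1}"
  then have "vec_norm2 (A *\<^sub>v v) \<le> c * vec_norm2 v" using assms by simp
  also have "\<dots> \<le> c * 1" using v c by (intro mult_left_mono) auto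
  finally show "vec_norm2 (A *\<^sub>v v) \<le> c" by simp
qed

lemma spectral_norm_nonneg: "0 \<le> spectral_norm A"
proof -
  have "vec_norm2 (A *\<^sub>v 0\<^sub>v (dim_col A)) \<le> spectral_norm A"
    unfolding spectral_norm_def by (rule cSUP_upper[OF _ spectral_norm_bdd]) simp
  then show ?thesis using vec_norm2_nonneg order_trans by blast
qed

section \<open>The pseudoinverse\<close>

text \<open>Functional calculus: \<open>F f\<close> has the eigenvectors of \<open>S\<close> and the
  eigenvalues \<open>f j\<close>, and \<open>F\<close> turns pointwise products into matrix
  products. All identities reduce to identities between real numbers.\<close>

lemma symmetric_pinv_exists:
  fixes S :: "real mat"
  assumes S: "S \<in> carrier_mat m m" and ST: "transpose_mat S = S"
  obtains G where "G \<in> carrier_mat m m" "transpose_mat G = G" "S * G * S = S" "G * S * G = G" "G * S = S * G"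
proof -
  obtain Q es where Q: "Q \<in> carrier_mat m m" "transpose_mat Q * Q = 1\<^sub>m m" "Q * transpose_mat Q = 1\<^sub>m m"
    and ev: "\<And>j. j < m \<Longrightarrow> S *\<^sub>v col Q j = es ! j \<cdot>\<^sub>v col Q j"
    using symmetric_eigenbasis[OF S ST] by metis
  define F where "F f = mat m m (\<lambda>(a, b). \<Sum>j<m. f j * Q $$ (a, j) * Q $$ (b, j))" for f
  have Fc: "F f \<in> carrier_mat m m" for f by (simp add: F_def)
  have FT: "transpose_mat (F f) = F f" for f
    by (rule eq_matI) (auto simp: F_def mult.assoc mult.left_commute intro!: sum.cong)
  have QQ: "(\<Sum>c<m. Q $$ (c, i) * Q $$ (c, j)) = (if i = j then 1 else 0)" if "i < m" "j < m" for i j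
  proof -
    have "(\<Sum>c<m. Q $$ (c, i) * Q $$ (c, j)) = (transpose_mat Q * Q) $$ (i, j)"
      using that Q(1) by (simp add: scalar_prod_def atLeast0LessThan)
    then show ?thesis unfolding Q(2) using that by simp
  qed
  have FF: "F f * F g = F (\<lambda>j. f j * g j)" for f g
  proof (rule eq_matI)
    fix a b assume "a < dim_row (F (\<lambda>j. f j * g j))" "b < dim_col (F (\<lambda>j. f j * g j))"
    then have ab: "a < m" "b < m" by (auto simp: F_def)
    have "(F f * F g) $$ (a, b) =
      (\<Sum>c<m. (\<Sum>i<m. f i * Q $$ (a, i) * Q $$ (c, i)) * (\<Sum>j<m. g j * Q $$ (c, j) * Q $$ (b, j)))"
      using ab by (simp add: F_def scalar_prod_def atLeast0LessThan)
    also have "\<dots> = (\<Sum>c<m. \<Sum>i<m. \<Sum>j<m. f i * Q $$ (a, i) * g j * Q $$ (b, j) * (Q $$ (c, i) * Q $$ (c, j)))"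
      by (simp add: sum_product algebra_simps)
    also have "\<dots> = (\<Sum>i<m. \<Sum>j<m. \<Sum>c<m. f i * Q $$ (a, i) * g j * Q $$ (b, j) * (Q $$ (c, i) * Q $$ (c, j)))"
      by (subst sum.swap, rule sum.cong[OF refl], rule sum.swap)
    also have "\<dots> = (\<Sum>i<m. \<Sum>j<m. f i * Q $$ (a, i) * g j * Q $$ (b, j) * (if i = j then 1 else 0))"
      by (simp only: sum_distrib_left[symmetric], intro sum.cong refl) (simp add: QQ)
    also have "\<dots> = (\<Sum>i<m. f i * g i * Q $$ (a, i) * Q $$ (b, i))"
      by (intro sum.cong refl) (simp add: if_distrib[of "(*) _"] sum.delta cong: if_cong)
    also have "\<dots> = F (\<lambda>j. f j * g j) $$ (a, b)" using ab by (simp add: F_def)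
    finally show "(F f * F g) $$ (a, b) = F (\<lambda>j. f j * g j) $$ (a, b)" .
  qed (auto simp: F_def)
  have SF: "S = F (\<lambda>j. es ! j)"
  proof (rule eq_matI)
    fix a b assume "a < dim_row (F ((!) es))" "b < dim_col (F ((!) es))"
    then have ab: "a < m" "b < m" by (auto simp: F_def)
    have "S $$ (a, b) = unit_vec m a \<bullet> (S *\<^sub>v unit_vec m b)"
      using ab S by simp
    also have "\<dots> = (\<Sum>j<m. es ! j * (col Q j \<bullet> unit_vec m a) * (col Q j \<bullet> unit_vec m b))"
      by (rule eigenbasis_quadratic_form[where es = "\<lambda>j. es ! j", OF S ST Q(1,3) ev]) auto
    also have "\<dots> = F ((!) es) $$ (a, b)" using ab Q(1) by (simp add: F_def)
    finally show "S $$ (a, b) = F ((!) es) $$ (a, b)" .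
  qed (use S in \<open>auto simp: F_def\<close>)
  \<comment> \<open>The convention \<open>inverse 0 = 0\<close> makes this the pseudoinverse of
    every eigenvalue, zero included.\<close>
  define g where "g = (\<lambda>j. inverse (es ! j))"
  have 1: "(\<lambda>j. es ! j * g j * es ! j) = (!) es" "(\<lambda>j. g j * es ! j * g j) = g"
    by (auto simp: g_def fun_eq_iff field_simps)
  show ?thesis
  proof (rule that[of "F g"])
    show "S * F g * S = S" "F g * S * F g = F g"
      unfolding SF FF 1 by simp_all
    show "F g * S = S * F g" unfolding SF FF by (simp add: mult.commute)
  qed (auto simp: Fc FT)
qed

text \<open>Reduction to the symmetric matrix \<open>A\<^sup>T A\<close>: if \<open>G\<close> is its
  pseudoinverse, then \<open>G A\<^sup>T\<close> works for \<open>A\<close>. The point that needs an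
  argument is \<open>A P = A\<close> for \<open>P = G A\<^sup>T A\<close>: the defect
  \<open>D\<close> satisfies \<open>D\<^sup>T D = 0\<close>, so its columns vanish.\<close>

lemma is_pinv_exists: "\<exists>B. is_pinv A B"
proof -
  define n m where "n = dim_row A" and "m = dim_col A"
  have A: "A \<in> carrier_mat n m" by (auto simp: n_def m_def)
  have AT: "transpose_mat A \<in> carrier_mat m n" using A by simp
  let ?S = "transpose_mat A * A"
  have S: "?S \<in> carrier_mat m m" using A by simp
  have ST: "transpose_mat ?S = ?S" using transpose_mult[OF AT A] by simp
  obtain G where G: "G \<in> carrier_mat m m" "transpose_mat G = G" "?S * G * ?S = ?S" "G * ?S * G = G" "G * ?S = ?S * G"
    using symmetric_pinv_exists[OF S ST] .
  define P where "P = G * ?S"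
  have P: "P \<in> carrier_mat m m" using G S by (simp add: P_def)
  have PT: "transpose_mat P = P"
    unfolding P_def using transpose_mult[OF G(1) S] by (simp add: ST G)
  define D where "D = A * P - A"
  have D: "D \<in> carrier_mat n m" unfolding D_def by (rule minus_carrier_mat[OF A])
  have SP: "?S * P = ?S" unfolding P_def using G(3) S G(1) assoc_mult_mat[OF S G(1) S] by simp
  have "transpose_mat A * D = ?S * P - ?S"
    unfolding D_def using mult_minus_distrib_mat[OF AT mult_carrier_mat[OF A P] A] assoc_mult_mat[OF AT A P] by simp
  then have AD: "transpose_mat A * D = 0\<^sub>m m m" using SP S by simp
  have DT: "transpose_mat D = P * transpose_mat A - transpose_mat A"
    unfolding D_def using transpose_minus[OF mult_carrier_mat[OF A P] A] transpose_mult[OF A P] by (simp add: PT)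
  have "transpose_mat D * D = P * (transpose_mat A * D) - transpose_mat A * D"
    unfolding DT using minus_mult_distrib_mat[OF mult_carrier_mat[OF P AT] AT D] assoc_mult_mat[OF P AT D] by simp
  then have DD: "transpose_mat D * D = 0\<^sub>m m m" unfolding AD using P by simp
  have AP: "A * P = A"
  proof (rule eq_matI)
    fix i j assume "i < dim_row A" "j < dim_col A"
    then have ij: "i < n" "j < m" using A by auto
    have "col D j \<bullet> col D j = (transpose_mat D * D) $$ (j, j)" using D ij by simp
    then have "col D j \<bullet> col D j = 0" unfolding DD using ij by simp
    moreover have cD: "col D j \<in> carrier_vec n" using D ij by simp
    ultimately have "col D j = 0\<^sub>v n" using scalar_prod_self_pos[OF cD] by fastforce
    then have "D $$ (i, j) = 0" using D ij by (metis carrier_matD index_col index_zero_vec(1))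
    then show "(A * P) $$ (i, j) = A $$ (i, j)" using ij A P by (simp add: D_def)
  qed (use A P in auto)
  define B where "B = G * transpose_mat A"
  have B: "B \<in> carrier_mat m n" using G A by (simp add: B_def)
  have BA: "B * A = P" unfolding B_def P_def by (rule assoc_mult_mat[OF G(1) AT A])
  have BT: "transpose_mat B = A * G" unfolding B_def using transpose_mult[OF G(1) AT] by (simp add: G)
  have AB: "A * B = A * G * transpose_mat A" unfolding B_def using assoc_mult_mat[OF A G(1) AT] by simp
  have ABT: "transpose_mat (A * B) = A * B"
    using transpose_mult[OF A B] BT AB by simp
  have ABA: "A * B * A = A" using assoc_mult_mat[OF A B A] by (simp add: BA AP)
  have BAB: "B * A * B = B"
    unfolding BA unfolding B_def P_def
    using assoc_mult_mat[OF mult_carrier_mat[OF G(1) S] G(1) AT] by (simp add: G(4))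
  have "is_pinv A B" unfolding is_pinv_def
    using B ABT ABA BAB by (auto simp: n_def m_def BA PT)
  then show ?thesis by blast
qed

text \<open>Each of \<open>A B\<close> and \<open>A C\<close> absorbs the other, and transposing
  exchanges the order of the factors; so they coincide, and so do \<open>B A\<close> and
  \<open>C A\<close>. A pseudoinverse is determined by these products.\<close>

lemma is_pinv_unique:
  assumes B: "is_pinv A B" and C: "is_pinv A C"
  shows "B = C"
proof -
  define n m where "n = dim_row A" and "m = dim_col A"
  have A: "A \<in> carrier_mat n m" by (auto simp: n_def m_def)
  have Bc: "B \<in> carrier_mat m n" and Cc: "C \<in> carrier_mat m n"
    using B C by (auto simp: is_pinv_def n_def m_def)
  note b = B[unfolded is_pinv_def] and c = C[unfolded is_pinv_def]
  have "A * B = (A * C) * (A * B)"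
    using assoc_mult_mat[OF mult_carrier_mat[OF A Cc] A Bc] c by simp
  then have "transpose_mat (A * B) = transpose_mat (A * B) * transpose_mat (A * C)"
    using transpose_mult[OF mult_carrier_mat[OF A Cc] mult_carrier_mat[OF A Bc]] by metis
  then have AB: "A * B = (A * B) * (A * C)" using b c by simp
  have "(A * B) * (A * C) = A * C"
    using assoc_mult_mat[OF mult_carrier_mat[OF A Bc] A Cc] b by simp
  then have 1: "A * B = A * C" using AB by simp
  have "B * A = (B * A) * (C * A)"
    using assoc_mult_mat[OF Bc A mult_carrier_mat[OF Cc A]] assoc_mult_mat[OF A Cc A] c by simp
  then have "transpose_mat (B * A) = transpose_mat (C * A) * transpose_mat (B * A)"
    using transpose_mult[OF mult_carrier_mat[OF Bc A] mult_carrier_mat[OF Cc A]] by metis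
  then have BA: "B * A = (C * A) * (B * A)" using b c by simp
  have "(C * A) * (B * A) = C * A"
    using assoc_mult_mat[OF Cc A mult_carrier_mat[OF Bc A]] assoc_mult_mat[OF A Bc A] b by simp
  then have 2: "B * A = C * A" using BA by simp
  have "B = B * A * B" using b by simp
  also have "\<dots> = C * A * B" by (simp add: 2)
  also have "\<dots> = C * (A * C)" using assoc_mult_mat[OF Cc A Bc] 1 by simp
  also have "\<dots> = C * A * C" using assoc_mult_mat[OF Cc A Cc] by simp
  also have "\<dots> = C" using c by simp
  finally show ?thesis .
qed

lemma is_pinv_pinv: "is_pinv A (pinv A)"
  unfolding pinv_def by (rule theI') (use is_pinv_exists is_pinv_unique in blast)

lemma pinv_carrier: "A \<in> carrier_mat n m \<Longrightarrow> pinv A \<in> carrier_mat m n"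
  using is_pinv_pinv[of A] by (auto simp: is_pinv_def)

lemma pinv_left_inverse:
  assumes A: "A \<in> carrier_mat n m" and w: "w \<in> carrier_vec m"
    and inj: "\<And>v. v \<in> carrier_vec m \<Longrightarrow> A *\<^sub>v v = 0\<^sub>v n \<Longrightarrow> v = 0\<^sub>v m"
  shows "pinv A *\<^sub>v (A *\<^sub>v w) = w"
proof -
  note B = pinv_carrier[OF A]
  have Aw: "A *\<^sub>v w \<in> carrier_vec n" using A w by simp
  define u where "u = pinv A *\<^sub>v (A *\<^sub>v w) - w"
  have u: "u \<in> carrier_vec m" using B w Aw by (simp add: u_def)
  have "A * pinv A * A = A" using is_pinv_pinv[of A] by (auto simp: is_pinv_def)
  then have "A *\<^sub>v (pinv A *\<^sub>v (A *\<^sub>v w)) = A *\<^sub>v w"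
    using assoc_mult_mat_vec[OF A B Aw] assoc_mult_mat_vec[OF mult_carrier_mat[OF A B] A w] by simp
  then have "A *\<^sub>v u = A *\<^sub>v w - A *\<^sub>v w"
    unfolding u_def using mult_minus_distrib_mat_vec[OF A mult_mat_vec_carrier[OF B Aw] w] by simp
  then have "A *\<^sub>v u = 0\<^sub>v n" using Aw by simp
  then have u0: "u = 0\<^sub>v m" by (rule inj[OF u])
  show ?thesis
  proof (rule eq_vecI)
    fix i assume "i < dim_vec w"
    then have i: "i < m" using w by simp
    have "u $ i = 0" using u0 i by simp
    then show "(pinv A *\<^sub>v (A *\<^sub>v w)) $ i = w $ i" using i w B by (simp add: u_def)
  qed (use B w in auto)
qed

text \<open>Both \<open>A A\<^sup>\<dagger>\<close> and \<open>A\<^sup>\<dagger> A\<close> are orthogonal projections.\<close>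

lemma orthogonal_projection_norm_le:
  assumes P: "P \<in> carrier_mat n n" and PT: "transpose_mat P = P" and PP: "P * P = P"
    and x: "x \<in> carrier_vec n"
  shows "vec_norm2 (P *\<^sub>v x) \<le> vec_norm2 x" "vec_norm2 (x - P *\<^sub>v x) \<le> vec_norm2 x"
proof -
  have Px: "P *\<^sub>v x \<in> carrier_vec n" using P x by simp
  have "(P *\<^sub>v x) \<bullet> (P *\<^sub>v x) = x \<bullet> (P *\<^sub>v (P *\<^sub>v x))"
    using transpose_vec_mult_scalar[OF P Px x] PT by simp
  then have e: "(P *\<^sub>v x) \<bullet> (P *\<^sub>v x) = x \<bullet> (P *\<^sub>v x)"
    using assoc_mult_mat_vec[OF P P x] PP by simp
  have "(x - P *\<^sub>v x) \<bullet> (x - P *\<^sub>v x) = x \<bullet> x - 2 * (x \<bullet> (P *\<^sub>v x)) + (P *\<^sub>v x) \<bullet> (P *\<^sub>v x)"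
    using x Px comm_scalar_prod[OF x Px]
    by (simp add: minus_scalar_prod_distrib[of _ n] scalar_prod_minus_distrib[of _ n])
  then have "(vec_norm2 x)\<^sup>2 = (vec_norm2 (x - P *\<^sub>v x))\<^sup>2 + (vec_norm2 (P *\<^sub>v x))\<^sup>2"
    using e by (simp add: vec_norm2_sq[symmetric])
  then show "vec_norm2 (P *\<^sub>v x) \<le> vec_norm2 x" "vec_norm2 (x - P *\<^sub>v x) \<le> vec_norm2 x"
    by (auto intro!: power2_le_imp_le[OF _ vec_norm2_nonneg])
qed

lemma pinv_projections:
  assumes A: "A \<in> carrier_mat n m"
  shows "transpose_mat (A * pinv A) = A * pinv A" "A * pinv A * (A * pinv A) = A * pinv A"
    "A * pinv A * A = A" "A * pinv A \<in> carrier_mat n n"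
    "transpose_mat (pinv A * A) = pinv A * A" "pinv A * A * (pinv A * A) = pinv A * A"
    "A * (pinv A * A) = A" "pinv A * A \<in> carrier_mat m m"
proof -
  note B = pinv_carrier[OF A]
  note p = is_pinv_pinv[of A, unfolded is_pinv_def]
  show "transpose_mat (A * pinv A) = A * pinv A" "transpose_mat (pinv A * A) = pinv A * A"
    "A * pinv A * A = A" using p by auto
  show "A * pinv A \<in> carrier_mat n n" "pinv A * A \<in> carrier_mat m m" using A B by auto
  show "A * (pinv A * A) = A" using p assoc_mult_mat[OF A B A] by simp
  show "A * pinv A * (A * pinv A) = A * pinv A"
    using p assoc_mult_mat[OF mult_carrier_mat[OF A B] A B] by simp
  show "pinv A * A * (pinv A * A) = pinv A * A"
    using p assoc_mult_mat[OF mult_carrier_mat[OF B A] B A] by simp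
qed

section \<open>Rank-one updates of a spectrum\<close>

text \<open>Chebyshev's sum inequality by symmetrization: the differences of \<open>a\<close>-th and
  of \<open>b\<close>-th powers of \<open>u i\<close> and \<open>u j\<close> have the same sign, so
  their product is nonnegative; it is summed over all pairs with weights.\<close>

lemma chebyshev_moments:
  fixes c u :: "nat \<Rightarrow> real"
  assumes u: "\<And>i. i < d \<Longrightarrow> 0 \<le> u i"
  shows "(\<Sum>i<d. (c i)\<^sup>2 * u i ^ a) * (\<Sum>i<d. (c i)\<^sup>2 * u i ^ b)
    \<le> (\<Sum>i<d. (c i)\<^sup>2) * (\<Sum>i<d. (c i)\<^sup>2 * u i ^ (a + b))"
proof -
  define g where "g p = (\<Sum>i<d. (c i)\<^sup>2 * u i ^ p)" for p
  have "0 \<le> (\<Sum>i<d. \<Sum>j<d. (c i)\<^sup>2 * (c j)\<^sup>2 * ((u i ^ a - u j ^ a) * (u i ^ b - u j ^ b)))"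
  proof (intro sum_nonneg)
    fix i j assume ij: "i \<in> {..<d}" "j \<in> {..<d}"
    have "0 \<le> (u i ^ a - u j ^ a) * (u i ^ b - u j ^ b)"
    proof (cases "u i \<le> u j")
      case True
      then have "u i ^ a \<le> u j ^ a" "u i ^ b \<le> u j ^ b" using u ij by (auto intro: power_mono)
      then show ?thesis by (simp add: mult_nonpos_nonpos)
    next
      case False
      then have "u j ^ a \<le> u i ^ a" "u j ^ b \<le> u i ^ b" using u ij by (auto intro: power_mono)
      then show ?thesis by simp
    qed
    then show "0 \<le> (c i)\<^sup>2 * (c j)\<^sup>2 * ((u i ^ a - u j ^ a) * (u i ^ b - u j ^ b))"
      by (intro mult_nonneg_nonneg[of "(c i)\<^sup>2 * (c j)\<^sup>2"]) auto
  qed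
  also have "\<dots> = (\<Sum>i<d. \<Sum>j<d. (c j)\<^sup>2 * ((c i)\<^sup>2 * u i ^ (a + b)))
      - (\<Sum>i<d. \<Sum>j<d. ((c i)\<^sup>2 * u i ^ a) * ((c j)\<^sup>2 * u j ^ b))
      - (\<Sum>i<d. \<Sum>j<d. ((c i)\<^sup>2 * u i ^ b) * ((c j)\<^sup>2 * u j ^ a))
      + (\<Sum>i<d. \<Sum>j<d. (c i)\<^sup>2 * ((c j)\<^sup>2 * u j ^ (a + b)))"
    by (simp add: sum_subtractf[symmetric] sum.distrib[symmetric] power_add algebra_simps)
  also have "\<dots> = g 0 * g (a + b) - g a * g b - g b * g a + g 0 * g (a + b)"
    by (simp add: g_def sum_distrib_right[symmetric] sum_distrib_left[symmetric])
  finally show ?thesis by (simp add: g_def)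
qed

text \<open>Here \<open>x\<close> and \<open>y\<close> are the eigenvalues of a symmetric \<open>M\<close> and of \<open>M + v v\<^sup>T\<close>, \<open>c\<close> and \<open>c'\<close> the
  coordinates of \<open>v\<close> in the two eigenbases, and \<open>W\<close> the matrix of inner products of the eigenvectors.
  Thus \<open>g p = v\<^sup>T M\<^sup>-\<^sup>p v\<close> and \<open>h p = v\<^sup>T M\<^sup>p v\<close>.\<close>

locale rank_one_update =
  fixes d :: nat and x y c c' :: "nat \<Rightarrow> real" and W :: "nat \<Rightarrow> nat \<Rightarrow> real" and lam :: real
  assumes lam: "0 < lam"
    and x_ge: "i < d \<Longrightarrow> lam \<le> x i" and y_ge: "i < d \<Longrightarrow> lam \<le> y i"
    and rows: "i < d \<Longrightarrow> (\<Sum>j<d. (W i j)\<^sup>2) = 1"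
    and cols: "j < d \<Longrightarrow> (\<Sum>i<d. (W i j)\<^sup>2) = 1"
    and c_eq: "i < d \<Longrightarrow> c i = (\<Sum>j<d. W i j * c' j)"
    and c'_eq: "j < d \<Longrightarrow> c' j = (\<Sum>i<d. W i j * c i)"
    and update: "i < d \<Longrightarrow> j < d \<Longrightarrow> (y j - x i) * W i j = c i * c' j"
    and c_le: "(\<Sum>i<d. (c i)\<^sup>2) \<le> 1"
begin

text \<open>The squared inner products of two orthonormal bases form a doubly stochastic matrix,
  which couples the two spectra and allows a comparison eigenvalue by eigenvalue.\<close>

lemma trace_diff: "(\<Sum>i<d. \<phi> (x i)) - (\<Sum>j<d. \<phi> (y j)) = (\<Sum>i<d. \<Sum>j<d. (W i j)\<^sup>2 * (\<phi> (x i) - \<phi> (y j)))"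
proof -
  have "(\<Sum>i<d. \<phi> (x i)) = (\<Sum>i<d. \<Sum>j<d. (W i j)\<^sup>2 * \<phi> (x i))"
    by (intro sum.cong refl) (simp add: sum_distrib_right[symmetric] rows)
  moreover have "(\<Sum>j<d. \<phi> (y j)) = (\<Sum>j<d. \<Sum>i<d. (W i j)\<^sup>2 * \<phi> (y j))"
    by (intro sum.cong refl) (simp add: sum_distrib_right[symmetric] cols)
  moreover have "\<dots> = (\<Sum>i<d. \<Sum>j<d. (W i j)\<^sup>2 * \<phi> (y j))" by (rule sum.swap)
  ultimately show ?thesis by (simp add: sum_subtractf[symmetric] right_diff_distrib)
qed

text \<open>Both moments are quadratic forms in the same vector \<open>v\<close>. Writing one of its
  two occurrences in the other basis puts them under a common double sum.\<close>

lemma moment_diff: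
  "(\<Sum>i<d. (c i)\<^sup>2 * \<phi> (x i)) - (\<Sum>j<d. (c' j)\<^sup>2 * \<phi> (y j))
    = (\<Sum>i<d. \<Sum>j<d. W i j * c i * c' j * (\<phi> (x i) - \<phi> (y j)))"
proof -
  have "(\<Sum>i<d. (c i)\<^sup>2 * \<phi> (x i)) = (\<Sum>i<d. c i * \<phi> (x i) * (\<Sum>j<d. W i j * c' j))"
    by (intro sum.cong refl) (simp add: c_eq[symmetric] power2_eq_square)
  also have "\<dots> = (\<Sum>i<d. \<Sum>j<d. W i j * c i * c' j * \<phi> (x i))"
    by (simp add: sum_distrib_left algebra_simps)
  finally have 1: "(\<Sum>i<d. (c i)\<^sup>2 * \<phi> (x i)) = (\<Sum>i<d. \<Sum>j<d. W i j * c i * c' j * \<phi> (x i))" .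
  have "(\<Sum>j<d. (c' j)\<^sup>2 * \<phi> (y j)) = (\<Sum>j<d. c' j * \<phi> (y j) * (\<Sum>i<d. W i j * c i))"
    by (intro sum.cong refl) (simp add: c'_eq[symmetric] power2_eq_square)
  also have "\<dots> = (\<Sum>j<d. \<Sum>i<d. W i j * c i * c' j * \<phi> (y j))"
    by (simp add: sum_distrib_left algebra_simps)
  also have "\<dots> = (\<Sum>i<d. \<Sum>j<d. W i j * c i * c' j * \<phi> (y j))" by (rule sum.swap)
  finally show ?thesis unfolding 1 by (simp add: sum_subtractf[symmetric] right_diff_distrib)
qed

section \<open>Moments of the update vector before and after the update\<close>

definition "g p = (\<Sum>i<d. (c i)\<^sup>2 * (1 / x i) ^ p)"
definition "g' p = (\<Sum>i<d. (c' i)\<^sup>2 * (1 / y i) ^ p)"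
definition "h p = (\<Sum>i<d. (c i)\<^sup>2 * x i ^ p)"
definition "h' p = (\<Sum>i<d. (c' i)\<^sup>2 * y i ^ p)"

lemma x_pos: "i < d \<Longrightarrow> 0 < x i" and y_pos: "i < d \<Longrightarrow> 0 < y i"
  using x_ge y_ge lam by fastforce+

lemma moments_nonneg: "0 \<le> g p" "0 \<le> g' p" "0 \<le> h p" "0 \<le> h' p"
proof -
  have "0 \<le> x i" "0 \<le> y i" if "i < d" for i using x_pos[OF that] y_pos[OF that] by auto
  then show "0 \<le> g p" "0 \<le> g' p" "0 \<le> h p" "0 \<le> h' p"
    unfolding g_def g'_def h_def h'_def
    by (auto intro!: sum_nonneg mult_nonneg_nonneg[OF zero_le_power2] zero_le_power)
qed

lemma g_chebyshev: "g a * g b \<le> g (a + b)"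
proof -
  have "g a * g b \<le> (\<Sum>i<d. (c i)\<^sup>2) * g (a + b)"
    unfolding g_def using x_pos by (intro chebyshev_moments) (simp add: less_imp_le)
  also have "\<dots> \<le> 1 * g (a + b)" by (intro mult_right_mono c_le moments_nonneg)
  finally show ?thesis by simp
qed

lemma h_chebyshev: "h a * h b \<le> h (a + b)"
proof -
  have "h a * h b \<le> (\<Sum>i<d. (c i)\<^sup>2) * h (a + b)"
    unfolding h_def using x_pos by (intro chebyshev_moments) (simp add: less_imp_le)
  also have "\<dots> \<le> 1 * h (a + b)" by (intro mult_right_mono c_le moments_nonneg)
  finally show ?thesis by simp
qed

lemma g_Suc_le: "lam * g (Suc p) \<le> g p"
  unfolding g_def sum_distrib_left
proof (rule sum_mono)
  fix i assume i: "i \<in> {..<d}"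
  then have "lam * (1 / x i) \<le> 1" using x_ge[of i] x_pos[of i] by simp
  then have "lam * (1 / x i) * ((c i)\<^sup>2 * (1 / x i) ^ p) \<le> 1 * ((c i)\<^sup>2 * (1 / x i) ^ p)"
    using i x_pos[of i] by (intro mult_right_mono) auto
  then show "lam * ((c i)\<^sup>2 * (1 / x i) ^ Suc p) \<le> (c i)\<^sup>2 * (1 / x i) ^ p" by (simp add: algebra_simps)
qed

lemma h_Suc_ge: "lam * h p \<le> h (Suc p)"
  unfolding h_def sum_distrib_left
proof (rule sum_mono)
  fix i assume i: "i \<in> {..<d}"
  then have "lam * ((c i)\<^sup>2 * x i ^ p) \<le> x i * ((c i)\<^sup>2 * x i ^ p)"
    using x_pos[of i] x_ge[of i] by (intro mult_right_mono) auto
  then show "lam * ((c i)\<^sup>2 * x i ^ p) \<le> (c i)\<^sup>2 * x i ^ Suc p" by (simp add: algebra_simps)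
qed

text \<open>With \<open>N = M + v v\<^sup>T\<close>, this is the telescoping expansion of
  \<open>M^-p - N^-p\<close> into terms \<open>M^-(a+1) (N - M) N^-(p-a)\<close>, tested with
  \<open>v\<close> on both sides; the rank-one middle factor splits each term into a product of two
  moments.\<close>

lemma g_diff: "g p - g' p = (\<Sum>a<p. g (Suc a) * g' (p - a))"
proof -
  have e: "W i j * c i * c' j * ((1 / x i) ^ p - (1 / y j) ^ p)
      = (\<Sum>a<p. ((c i)\<^sup>2 * (1 / x i) ^ Suc a) * ((c' j)\<^sup>2 * (1 / y j) ^ (p - a)))"
    if ij: "i < d" "j < d" for i j
  proof -
    have "(1 / x i) ^ p - (1 / y j) ^ p = (1 / x i - 1 / y j) * (\<Sum>a<p. (1 / y j) ^ (p - Suc a) * (1 / x i) ^ a)"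
      by (rule power_diff_sumr2)
    also have "1 / x i - 1 / y j = (y j - x i) * (1 / x i) * (1 / y j)"
      using x_pos[OF ij(1)] y_pos[OF ij(2)] by (simp add: field_simps)
    finally have "W i j * c i * c' j * ((1 / x i) ^ p - (1 / y j) ^ p)
      = c i * c' j * ((y j - x i) * W i j) * (\<Sum>a<p. (1 / x i) * (1 / y j) * ((1 / y j) ^ (p - Suc a) * (1 / x i) ^ a))"
      by (simp only: sum_distrib_left[symmetric]) (simp only: ac_simps)
    also have "\<dots> = (\<Sum>a<p. (c i)\<^sup>2 * (c' j)\<^sup>2 * ((1 / x i) * (1 / y j) * ((1 / y j) ^ (p - Suc a) * (1 / x i) ^ a)))"
      unfolding update[OF ij] by (simp only: sum_distrib_left power2_eq_square ac_simps)
    also have "\<dots> = (\<Sum>a<p. ((c i)\<^sup>2 * (1 / x i) ^ Suc a) * ((c' j)\<^sup>2 * (1 / y j) ^ (p - a)))"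
    proof (intro sum.cong refl)
      fix a assume "a \<in> {..<p}"
      then have "p - a = Suc (p - Suc a)" by auto
      then show "(c i)\<^sup>2 * (c' j)\<^sup>2 * ((1 / x i) * (1 / y j) * ((1 / y j) ^ (p - Suc a) * (1 / x i) ^ a))
        = ((c i)\<^sup>2 * (1 / x i) ^ Suc a) * ((c' j)\<^sup>2 * (1 / y j) ^ (p - a))"
        by (simp only: power_Suc ac_simps)
    qed
    finally show ?thesis .
  qed
  have "g p - g' p = (\<Sum>i<d. \<Sum>j<d. \<Sum>a<p. ((c i)\<^sup>2 * (1 / x i) ^ Suc a) * ((c' j)\<^sup>2 * (1 / y j) ^ (p - a)))"
    unfolding g_def g'_def moment_diff[of "\<lambda>t. (1 / t) ^ p"] by (intro sum.cong refl e) auto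
  also have "\<dots> = (\<Sum>a<p. \<Sum>i<d. \<Sum>j<d. ((c i)\<^sup>2 * (1 / x i) ^ Suc a) * ((c' j)\<^sup>2 * (1 / y j) ^ (p - a)))"
    by (subst (2) sum.swap, subst sum.swap) (rule refl)
  also have "\<dots> = (\<Sum>a<p. g (Suc a) * g' (p - a))"
    by (simp only: g_def g'_def sum_product)
  finally show ?thesis .
qed

text \<open>The same expansion for positive powers, with terms
  \<open>M^(p-1-a) (N - M) N^a\<close>.\<close>

lemma h_diff: "h' p - h p = (\<Sum>a<p. h (p - Suc a) * h' a)"
proof -
  have e: "W i j * c i * c' j * (x i ^ p - y j ^ p)
      = - (\<Sum>a<p. ((c i)\<^sup>2 * x i ^ (p - Suc a)) * ((c' j)\<^sup>2 * y j ^ a))"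
    if ij: "i < d" "j < d" for i j
  proof -
    have "x i ^ p - y j ^ p = - ((y j - x i) * (\<Sum>a<p. x i ^ (p - Suc a) * y j ^ a))"
      using power_diff_sumr2[of "y j" p "x i"] by simp
    then have "W i j * c i * c' j * (x i ^ p - y j ^ p)
      = - (c i * c' j * ((y j - x i) * W i j) * (\<Sum>a<p. x i ^ (p - Suc a) * y j ^ a))"
      by simp
    also have "\<dots> = - (\<Sum>a<p. ((c i)\<^sup>2 * x i ^ (p - Suc a)) * ((c' j)\<^sup>2 * y j ^ a))"
      unfolding update[OF ij] by (simp only: sum_distrib_left power2_eq_square ac_simps)
    finally show ?thesis .
  qed
  have "h p - h' p = (\<Sum>i<d. \<Sum>j<d. - (\<Sum>a<p. ((c i)\<^sup>2 * x i ^ (p - Suc a)) * ((c' j)\<^sup>2 * y j ^ a)))"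
    unfolding h_def h'_def moment_diff[of "\<lambda>t. t ^ p"] by (intro sum.cong refl e) auto
  also have "\<dots> = - (\<Sum>i<d. \<Sum>j<d. \<Sum>a<p. ((c i)\<^sup>2 * x i ^ (p - Suc a)) * ((c' j)\<^sup>2 * y j ^ a))"
    by (simp add: sum_negf)
  also have "(\<Sum>i<d. \<Sum>j<d. \<Sum>a<p. ((c i)\<^sup>2 * x i ^ (p - Suc a)) * ((c' j)\<^sup>2 * y j ^ a))
      = (\<Sum>a<p. \<Sum>i<d. \<Sum>j<d. ((c i)\<^sup>2 * x i ^ (p - Suc a)) * ((c' j)\<^sup>2 * y j ^ a))"
    by (subst (2) sum.swap, subst sum.swap) (rule refl)
  also have "\<dots> = (\<Sum>a<p. h (p - Suc a) * h' a)"
    by (simp only: h_def h'_def sum_product)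
  finally show ?thesis by simp
qed

lemma g'_le: "g' p \<le> g p"
  using g_diff[of p] sum_nonneg[of "{..<p}" "\<lambda>a. g (Suc a) * g' (p - a)"] moments_nonneg by simp

text \<open>Since updated moments are no larger, Chebyshev bounds each of the \<open>p\<close> terms
  of \<open>g_diff\<close> by \<open>g (Suc p)\<close>. A spectrum above
  \<open>lam \<ge> 2 p\<close> makes their sum at most half of \<open>g p\<close>.\<close>

lemma g'_ge:
  assumes "2 * real p \<le> lam"
  shows "g p / 2 \<le> g' p"
proof -
  have "g p - g' p \<le> (\<Sum>a<p. g (Suc p))"
    unfolding g_diff
  proof (rule sum_mono)
    fix a assume a: "a \<in> {..<p}"
    have "g (Suc a) * g' (p - a) \<le> g (Suc a) * g (p - a)" by (intro mult_left_mono g'_le moments_nonneg)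
    also have "\<dots> \<le> g (Suc a + (p - a))" by (rule g_chebyshev)
    finally show "g (Suc a) * g' (p - a) \<le> g (Suc p)" using a by simp
  qed
  also have "\<dots> = real p * g (Suc p)" by simp
  also have "\<dots> \<le> (lam / 2) * g (Suc p)" using assms moments_nonneg by (intro mult_right_mono) auto
  also have "\<dots> \<le> g p / 2" using g_Suc_le[of p] by simp
  finally show ?thesis by simp
qed

text \<open>\<open>h_diff\<close> expresses \<open>h' p\<close> by lower moments of the updated
  matrix, hence strong induction. The factor 2 reproduces itself because the \<open>p\<close> terms,
  each at most \<open>2 * h (p - 1)\<close>, add up to at most \<open>h p\<close>.\<close>

lemma h'_le:
  assumes "2 * real p \<le> lam"
  shows "h' p \<le> 2 * h p"
  using assms
proof (induction p rule: less_induct)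
  case (less p)
  show ?case
  proof (cases p)
    case 0
    then show ?thesis using h_diff[of 0] moments_nonneg(3)[of 0] by simp
  next
    case (Suc r)
    have "h' p - h p \<le> (\<Sum>a<p. 2 * h r)"
      unfolding h_diff
    proof (rule sum_mono)
      fix a assume a: "a \<in> {..<p}"
      have "h (p - Suc a) * h' a \<le> h (p - Suc a) * (2 * h a)"
        using less a by (intro mult_left_mono moments_nonneg) auto
      also have "\<dots> \<le> 2 * h (p - Suc a + a)" using h_chebyshev[of "p - Suc a" a] by simp
      also have "p - Suc a + a = r" using a Suc by auto
      finally show "h (p - Suc a) * h' a \<le> 2 * h r" .
    qed
    also have "\<dots> = (2 * real p) * h r" by simp
    also have "\<dots> \<le> lam * h r" using less.prems moments_nonneg by (intro mult_right_mono) auto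
    also have "\<dots> \<le> h p" using h_Suc_ge[of r] Suc by simp
    finally show ?thesis by simp
  qed
qed

text \<open>Convexity of the inverse power, with the tangent taken at the new eigenvalue:
  \<open>update\<close> then collapses the double sum to \<open>q * g' (Suc q)\<close>. Returning to
  the old moment costs the factor 2 of \<open>g'_ge\<close>; the old moment is wanted because its
  basis does not depend on the index drawn next, so that it can be averaged over this index.\<close>

lemma inverse_power_trace_decrease:
  assumes "2 * real (Suc q) \<le> lam"
  shows "real q / 2 * (\<Sum>i<d. (c i)\<^sup>2 * (1 / x i) ^ Suc q) \<le> (\<Sum>i<d. (1 / x i) ^ q) - (\<Sum>i<d. (1 / y i) ^ q)"
proof -
  \<comment> \<open>The tangent inequality at \<open>t\<close>, obtained from Bernoulli's inequality
    for \<open>t / s\<close>.\<close>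
  have conv: "real q * (1 / t) ^ Suc q * (t - s) \<le> (1 / s) ^ q - (1 / t) ^ q" if "0 < s" "0 < t" for s t :: real
  proof -
    have "1 + real q * (t / s - 1) \<le> (1 + (t / s - 1)) ^ q"
      using that by (intro Bernoulli_inequality) simp
    moreover have "1 - s / t \<le> t / s - 1"
    proof -
      have "0 \<le> (t - s)\<^sup>2 / (s * t)" using that by simp
      also have "\<dots> = t / s - 1 - (1 - s / t)" using that by (simp add: field_simps power2_eq_square)
      finally show ?thesis by simp
    qed
    ultimately have "real q * (1 - s / t) \<le> (t / s) ^ q - 1"
      by (smt (verit) mult_left_mono of_nat_0_le_iff)
    then have "(1 / t) ^ q * (real q * (1 - s / t)) \<le> (1 / t) ^ q * ((t / s) ^ q - 1)"
      using that by (intro mult_left_mono) auto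
    also have "\<dots> = (1 / s) ^ q - (1 / t) ^ q"
      using that by (simp add: right_diff_distrib power_mult_distrib[symmetric])
    also have "(1 / t) ^ q * (real q * (1 - s / t)) = real q * (1 / t) ^ Suc q * (t - s)"
      using that by (simp add: field_simps)
    finally show ?thesis .
  qed
  have "real q / 2 * g (Suc q) \<le> real q * g' (Suc q)"
    using g'_ge[OF assms] mult_left_mono[of "g (Suc q) / 2" "g' (Suc q)" "real q"] by simp
  also have "\<dots> = (\<Sum>j<d. real q * (c' j * (1 / y j) ^ Suc q) * c' j)"
    by (simp add: g'_def sum_distrib_left power2_eq_square algebra_simps)
  also have "\<dots> = (\<Sum>j<d. real q * (c' j * (1 / y j) ^ Suc q) * (\<Sum>i<d. W i j * c i))"
    by (intro sum.cong refl) (simp add: c'_eq[symmetric])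
  also have "\<dots> = (\<Sum>i<d. \<Sum>j<d. real q * (1 / y j) ^ Suc q * W i j * (c i * c' j))"
    unfolding sum_distrib_left by (subst sum.swap) (simp only: ac_simps)
  also have "\<dots> = (\<Sum>i<d. \<Sum>j<d. (W i j)\<^sup>2 * (real q * (1 / y j) ^ Suc q * (y j - x i)))"
  proof (intro sum.cong refl)
    fix i j assume ij: "i \<in> {..<d}" "j \<in> {..<d}"
    then have "c i * c' j = (y j - x i) * W i j" using update by simp
    then show "real q * (1 / y j) ^ Suc q * W i j * (c i * c' j) = (W i j)\<^sup>2 * (real q * (1 / y j) ^ Suc q * (y j - x i))"
      by (simp only: power2_eq_square ac_simps)
  qed
  also have "\<dots> \<le> (\<Sum>i<d. \<Sum>j<d. (W i j)\<^sup>2 * ((1 / x i) ^ q - (1 / y j) ^ q))"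
    using x_pos y_pos by (intro sum_mono mult_left_mono conv) auto
  also have "\<dots> = (\<Sum>i<d. (1 / x i) ^ q) - (\<Sum>i<d. (1 / y i) ^ q)"
    by (rule trace_diff[of "\<lambda>t. (1 / t) ^ q", symmetric])
  finally show ?thesis by (simp add: g_def)
qed

text \<open>Counterpart for positive powers: the tangent is again taken at the new eigenvalue, and
  \<open>h'_le\<close> leads back to the old moment.\<close>

lemma power_trace_increase:
  assumes "2 * real q \<le> lam"
  shows "(\<Sum>i<d. y i ^ Suc q) - (\<Sum>i<d. x i ^ Suc q) \<le> 2 * real (Suc q) * (\<Sum>i<d. (c i)\<^sup>2 * x i ^ q)"
proof -
  have conv: "real (Suc q) * t ^ q * (s - t) \<le> s ^ Suc q - t ^ Suc q" if "0 < s" "0 < t" for s t :: real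
  proof -
    have "1 + real (Suc q) * (s / t - 1) \<le> (1 + (s / t - 1)) ^ Suc q"
      using that by (intro Bernoulli_inequality) simp
    then have "t ^ Suc q * (real (Suc q) * (s / t - 1)) \<le> t ^ Suc q * ((s / t) ^ Suc q - 1)"
      using that by (intro mult_left_mono) auto
    also have "\<dots> = s ^ Suc q - t ^ Suc q"
      using that by (simp add: right_diff_distrib power_divide del: power_Suc)
    also have "t ^ Suc q * (real (Suc q) * (s / t - 1)) = real (Suc q) * t ^ q * (s - t)"
      using that by (simp add: field_simps)
    finally show ?thesis .
  qed
  have "- (2 * real (Suc q) * h q) \<le> - (real (Suc q) * h' q)"
    using mult_left_mono[OF h'_le[OF assms], of "real (Suc q)"] by (simp add: algebra_simps)
  also have "real (Suc q) * h' q = (\<Sum>j<d. real (Suc q) * (c' j * y j ^ q) * c' j)"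
    by (simp add: h'_def sum_distrib_left power2_eq_square algebra_simps)
  also have "\<dots> = (\<Sum>j<d. real (Suc q) * (c' j * y j ^ q) * (\<Sum>i<d. W i j * c i))"
    by (intro sum.cong refl) (simp add: c'_eq[symmetric])
  also have "\<dots> = (\<Sum>i<d. \<Sum>j<d. real (Suc q) * y j ^ q * W i j * (c i * c' j))"
    unfolding sum_distrib_left by (subst sum.swap) (simp only: ac_simps)
  also have "- \<dots> = (\<Sum>i<d. \<Sum>j<d. (W i j)\<^sup>2 * (real (Suc q) * y j ^ q * (x i - y j)))"
    unfolding sum_negf[symmetric]
  proof (intro sum.cong refl)
    fix i j assume ij: "i \<in> {..<d}" "j \<in> {..<d}"
    then have "c i * c' j = (y j - x i) * W i j" using update by simp
    then show "- (real (Suc q) * y j ^ q * W i j * (c i * c' j)) = (W i j)\<^sup>2 * (real (Suc q) * y j ^ q * (x i - y j))"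
      by (simp only: power2_eq_square) (simp add: algebra_simps)
  qed
  also have "\<dots> \<le> (\<Sum>i<d. \<Sum>j<d. (W i j)\<^sup>2 * (x i ^ Suc q - y j ^ Suc q))"
    using x_pos y_pos by (intro sum_mono mult_left_mono conv) auto
  also have "\<dots> = (\<Sum>i<d. x i ^ Suc q) - (\<Sum>i<d. y i ^ Suc q)"
    by (rule trace_diff[of "\<lambda>t. t ^ Suc q", symmetric])
  finally show ?thesis by (simp add: h_def)
qed

end

section \<open>Averages over subsets\<close>

definition subsets_of_size :: "nat \<Rightarrow> nat \<Rightarrow> nat set set" where
  "subsets_of_size n t = {I. I \<subseteq> {..<n} \<and> card I = t}"

lemma finite_subsets_of_size [simp]: "finite (subsets_of_size n t)"
  unfolding subsets_of_size_def by (rule finite_subset[of _ "Pow {..<n}"]) auto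

lemma card_subsets_of_size: "card (subsets_of_size n t) = n choose t"
  unfolding subsets_of_size_def using n_subsets[of "{..<n}" t] by simp

lemma subsets_of_sizeD:
  "I \<in> subsets_of_size n t \<Longrightarrow> finite I" "I \<in> subsets_of_size n t \<Longrightarrow> I \<subseteq> {..<n}"
  "I \<in> subsets_of_size n t \<Longrightarrow> card I = t"
  by (auto simp: subsets_of_size_def intro: finite_subset)

text \<open>Double counting: a set of size \<open>t + 1\<close> arises from exactly
  \<open>t + 1\<close> pairs of a set of size \<open>t\<close> and a new index. In this form
  sampling without replacement becomes a process that adds one index at a time.\<close>

lemma sum_insert_subsets:
  fixes \<Phi> :: "nat set \<Rightarrow> real"
  shows "(\<Sum>I\<in>subsets_of_size n t. \<Sum>i\<in>{..<n} - I. \<Phi> (insert i I))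
    = real (Suc t) * (\<Sum>J\<in>subsets_of_size n (Suc t). \<Phi> J)"
proof -
  have "(\<Sum>I\<in>subsets_of_size n t. \<Sum>i\<in>{..<n} - I. \<Phi> (insert i I))
      = (\<Sum>(I, i)\<in>(SIGMA I:subsets_of_size n t. {..<n} - I). \<Phi> (insert i I))"
    by (rule sum.Sigma) auto
  also have "\<dots> = (\<Sum>(J, i)\<in>(SIGMA J:subsets_of_size n (Suc t). J). \<Phi> J)"
    by (rule sum.reindex_bij_witness[where i = "\<lambda>(J, i). (J - {i}, i)" and j = "\<lambda>(I, i). (insert i I, i)"])
      (auto simp: subsets_of_size_def card_insert_if card_Diff_singleton insert_absorb
        dest: finite_subset[OF _ finite_lessThan])
  also have "\<dots> = (\<Sum>J\<in>subsets_of_size n (Suc t). \<Sum>i\<in>J. \<Phi> J)"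
    by (rule sum.Sigma[symmetric]) (auto dest: subsets_of_sizeD)
  also have "\<dots> = (\<Sum>J\<in>subsets_of_size n (Suc t). real (Suc t) * \<Phi> J)"
    by (intro sum.cong refl) (simp add: subsets_of_sizeD)
  finally show ?thesis by (simp add: sum_distrib_left)
qed

text \<open>Affine one-step bounds pass to averages because of the absorption identity for
  binomials. The lower tail uses the additive term \<open>b\<close>; for the upper tail it is
  0.\<close>

lemma subset_average_step:
  fixes \<Phi> :: "nat set \<Rightarrow> real"
  assumes t: "t < n"
    and step: "\<And>I. I \<in> subsets_of_size n t \<Longrightarrow>
      (\<Sum>i\<in>{..<n} - I. \<Phi> (insert i I)) \<le> real (n - t) * (a * \<Phi> I + b)"
  shows "(\<Sum>J\<in>subsets_of_size n (Suc t). \<Phi> J) / (n choose Suc t)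
    \<le> a * ((\<Sum>I\<in>subsets_of_size n t. \<Phi> I) / (n choose t)) + b"
proof -
  let ?S = "\<Sum>I\<in>subsets_of_size n t. \<Phi> I" and ?S' = "\<Sum>J\<in>subsets_of_size n (Suc t). \<Phi> J"
  have c: "Suc t * (n choose Suc t) = (n - t) * (n choose t)"
    by (simp only: binomial_absorb_comp binomial_absorption)
  have pos: "0 < n choose t" "0 < n choose Suc t" using t by auto
  have "real (Suc t) * ?S' \<le> (\<Sum>I\<in>subsets_of_size n t. real (n - t) * (a * \<Phi> I + b))"
    unfolding sum_insert_subsets[symmetric] by (intro sum_mono step)
  also have "\<dots> = real (n - t) * (a * ?S + b * (n choose t))"
    by (simp add: sum_distrib_left[symmetric] sum.distrib card_subsets_of_size mult.commute)
  finally have "real (Suc t) * ?S' \<le> real (n - t) * (a * ?S + b * (n choose t))" .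
  then have "real (Suc t) * ?S' / (real (Suc t) * (n choose Suc t))
      \<le> real (n - t) * (a * ?S + b * (n choose t)) / (real (Suc t) * (n choose Suc t))"
    using pos by (intro divide_right_mono) auto
  also have "real (Suc t) * ?S' / (real (Suc t) * (n choose Suc t)) = ?S' / (n choose Suc t)"
    by simp
  also have "real (Suc t) * (n choose Suc t) = real (n - t) * (n choose t)"
    using c by (metis of_nat_mult)
  also have "real (n - t) * (a * ?S + b * (n choose t)) / (real (n - t) * (n choose t))
      = a * (?S / (n choose t)) + b"
    using pos t by (simp add: field_simps)
  finally show ?thesis .
qed

lemma subset_average_markov:
  fixes \<Phi> :: "nat set \<Rightarrow> real"
  assumes avg: "(\<Sum>I\<in>subsets_of_size n l. \<Phi> I) / (n choose l) \<le> B" and l: "l \<le> n" and \<theta>: "0 < \<theta>"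
    and nonneg: "\<And>I. I \<in> subsets_of_size n l \<Longrightarrow> 0 \<le> \<Phi> I"
    and bad: "\<And>I. I \<in> subsets_of_size n l \<Longrightarrow> bad I \<Longrightarrow> \<theta> \<le> \<Phi> I"
  shows "real (card {I \<in> subsets_of_size n l. bad I}) / (n choose l) \<le> B / \<theta>"
proof -
  have "\<theta> * real (card {I \<in> subsets_of_size n l. bad I}) = (\<Sum>I\<in>{I \<in> subsets_of_size n l. bad I}. \<theta>)"
    by (simp add: mult.commute)
  also have "\<dots> \<le> (\<Sum>I\<in>{I \<in> subsets_of_size n l. bad I}. \<Phi> I)" by (intro sum_mono bad) auto
  also have "\<dots> \<le> (\<Sum>I\<in>subsets_of_size n l. \<Phi> I)" by (intro sum_mono2 nonneg) auto
  also have "\<dots> \<le> B * (n choose l)" using avg l by (simp add: divide_le_eq)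
  finally show ?thesis using \<theta> l by (simp add: field_simps)
qed

section \<open>Concentration of random Gram matrices\<close>

definition gram :: "nat \<Rightarrow> (nat \<Rightarrow> real vec) \<Rightarrow> nat set \<Rightarrow> real mat" where
  "gram d v I = mat d d (\<lambda>(a, b). \<Sum>i\<in>I. v i $ a * v i $ b)"

lemma gram_carrier [simp]: "gram d v I \<in> carrier_mat d d"
  by (simp add: gram_def)

lemma transpose_gram [simp]: "transpose_mat (gram d v I) = gram d v I"
  by (rule eq_matI) (auto simp: gram_def mult.commute)

lemma gram_bilinear:
  assumes v: "\<And>i. v i \<in> carrier_vec d" and x: "x \<in> carrier_vec d" and y: "y \<in> carrier_vec d"
  shows "x \<bullet> (gram d v I *\<^sub>v y) = (\<Sum>i\<in>I. (v i \<bullet> x) * (v i \<bullet> y))"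
proof -
  have "x \<bullet> (gram d v I *\<^sub>v y) = (\<Sum>a<d. x $ a * (\<Sum>b<d. (\<Sum>i\<in>I. v i $ a * v i $ b) * y $ b))"
    using y by (simp add: scalar_prod_def gram_def atLeast0LessThan)
  also have "\<dots> = (\<Sum>a<d. \<Sum>b<d. \<Sum>i\<in>I. (v i $ a * x $ a) * (v i $ b * y $ b))"
    by (simp add: sum_distrib_left sum_distrib_right algebra_simps)
  also have "\<dots> = (\<Sum>i\<in>I. \<Sum>a<d. \<Sum>b<d. (v i $ a * x $ a) * (v i $ b * y $ b))"
    by (subst (2) sum.swap, subst sum.swap) (rule refl)
  also have "\<dots> = (\<Sum>i\<in>I. (v i \<bullet> x) * (v i \<bullet> y))"
    using x y by (simp only: sum_product[symmetric]) (simp add: scalar_prod_def atLeast0LessThan)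
  finally show ?thesis .
qed

text \<open>For every sample \<open>I\<close> the columns of \<open>Q I\<close> diagonalise the Gram matrix of the sample, with
  eigenvalues \<open>s I\<close>; the expected Gram matrix of a sample of size \<open>l\<close> is \<open>\<alpha>\<close> times the identity.\<close>

locale isotropic_sample =
  fixes d n l :: nat and v :: "nat \<Rightarrow> real vec" and \<alpha> :: real
    and Q :: "nat set \<Rightarrow> real mat" and s :: "nat set \<Rightarrow> nat \<Rightarrow> real"
  assumes d: "0 < d" and l: "0 < l" "l \<le> n" and \<alpha>: "0 < \<alpha>"
    and v: "\<And>i. v i \<in> carrier_vec d" and v_le: "\<And>i. i < n \<Longrightarrow> v i \<bullet> v i \<le> 1"
    and isotropic: "\<And>x y. x \<in> carrier_vec d \<Longrightarrow> y \<in> carrier_vec d \<Longrightarrow>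
      (\<Sum>i<n. (v i \<bullet> x) * (v i \<bullet> y)) = \<alpha> * real n / real l * (x \<bullet> y)"
    and Q: "\<And>I. Q I \<in> carrier_mat d d" "\<And>I. transpose_mat (Q I) * Q I = 1\<^sub>m d"
      "\<And>I. Q I * transpose_mat (Q I) = 1\<^sub>m d"
    and ev: "\<And>I j. j < d \<Longrightarrow> gram d v I *\<^sub>v col (Q I) j = s I j \<cdot>\<^sub>v col (Q I) j"
begin

definition "T = \<alpha> * real n / real l"

lemma col_Q: "j < d \<Longrightarrow> col (Q I) j \<in> carrier_vec d"
  using Q(1)[of I] by simp

lemma col_Q_orthonormal: "i < d \<Longrightarrow> j < d \<Longrightarrow> col (Q I) i \<bullet> col (Q I) j = (if i = j then 1 else 0)"
proof -
  assume ij: "i < d" "j < d"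
  have "col (Q I) i \<bullet> col (Q I) j = (transpose_mat (Q I) * Q I) $$ (i, j)" using Q(1)[of I] ij by simp
  then show ?thesis unfolding Q(2) using ij by simp
qed

lemma sample_quadratic_form:
  assumes x: "x \<in> carrier_vec d" and y: "y \<in> carrier_vec d"
  shows "(\<Sum>i\<in>I. (v i \<bullet> x) * (v i \<bullet> y)) = (\<Sum>j<d. s I j * (col (Q I) j \<bullet> x) * (col (Q I) j \<bullet> y))"
  unfolding gram_bilinear[OF v x y, symmetric]
  by (rule eigenbasis_quadratic_form[OF gram_carrier transpose_gram Q(1,3) ev x y])

lemma eigenvalue_eq:
  assumes "j < d"
  shows "(\<Sum>i\<in>I. (v i \<bullet> col (Q I) j)\<^sup>2) = s I j"
proof -
  have "(\<Sum>i\<in>I. (v i \<bullet> col (Q I) j)\<^sup>2) = (\<Sum>k<d. s I k * (col (Q I) k \<bullet> col (Q I) j)\<^sup>2)"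
    using sample_quadratic_form[OF col_Q[OF assms, of I] col_Q[OF assms, of I], of I] by (simp add: power2_eq_square mult.assoc)
  also have "\<dots> = (\<Sum>k<d. if k = j then s I j else 0)"
    using assms by (intro sum.cong) (auto simp: col_Q_orthonormal)
  finally show ?thesis using assms by simp
qed

lemma eigenvalue_nonneg: "j < d \<Longrightarrow> 0 \<le> s I j"
  by (subst eigenvalue_eq[symmetric]) (auto intro: sum_nonneg)

text \<open>Isotropy fixes the total over all indices at \<open>T\<close>, and what the sample has
  already used in the direction of its eigenvector is the eigenvalue. The rest is what the next draw
  averages over.\<close>

lemma complement_sum:
  assumes "j < d" "I \<subseteq> {..<n}"
  shows "(\<Sum>i\<in>{..<n} - I. (v i \<bullet> col (Q I) j)\<^sup>2) = T - s I j"
proof -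
  have "(\<Sum>i<n. (v i \<bullet> col (Q I) j)\<^sup>2) = T"
    using isotropic[OF col_Q[OF assms(1), of I] col_Q[OF assms(1), of I]] assms(1) col_Q_orthonormal[of j j I]
    by (simp add: T_def power2_eq_square)
  moreover have "(\<Sum>i<n. (v i \<bullet> col (Q I) j)\<^sup>2)
      = (\<Sum>i\<in>{..<n} - I. (v i \<bullet> col (Q I) j)\<^sup>2) + (\<Sum>i\<in>I. (v i \<bullet> col (Q I) j)\<^sup>2)"
    using assms(2) by (intro sum.subset_diff) auto
  ultimately show ?thesis using eigenvalue_eq[OF assms(1)] by simp
qed

lemma eigenvalue_le: "j < d \<Longrightarrow> I \<subseteq> {..<n} \<Longrightarrow> s I j \<le> T"
  using complement_sum[of j I] sum_nonneg[of "{..<n} - I" "\<lambda>i. (v i \<bullet> col (Q I) j)\<^sup>2"] by simp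

text \<open>Isotropy in a single coordinate direction: \<open>n\<close> squares, each at most 1, add
  up to \<open>\<alpha> n / l\<close>. This keeps the contraction rate of the lower tail at most
  1.\<close>

lemma \<alpha>_le: "\<alpha> \<le> real l"
proof -
  have c: "unit_vec d 0 \<in> carrier_vec d" by simp
  have "(\<Sum>i<n. (v i \<bullet> unit_vec d 0)\<^sup>2) = T"
    using isotropic[OF c c] d by (simp add: T_def power2_eq_square)
  moreover have "(v i \<bullet> unit_vec d 0)\<^sup>2 \<le> 1" if "i < n" for i
  proof -
    have "v i \<bullet> unit_vec d 0 = v i $ 0" using d by simp
    moreover have "(v i $ 0)\<^sup>2 \<le> (\<Sum>a = 0..<d. (v i $ a)\<^sup>2)"
      using d by (intro member_le_sum) auto
    moreover have "(\<Sum>a = 0..<d. (v i $ a)\<^sup>2) = v i \<bullet> v i"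
      using v[of i] by (simp add: scalar_prod_def power2_eq_square)
    ultimately show ?thesis using v_le[OF that] by simp
  qed
  ultimately have "T \<le> (\<Sum>i<n. 1)" by (metis (no_types, lifting) lessThan_iff sum_mono)
  then show ?thesis using l by (simp add: T_def field_simps)
qed

text \<open>Gram matrices are positive semidefinite, so shifting by \<open>\<alpha>\<close> puts
  both spectra above \<open>lam = \<alpha>\<close>, whatever the sample.\<close>

lemma rank_one_update_sample:
  assumes i: "i < n" "i \<notin> I" and I: "finite I"
  shows "rank_one_update d (\<lambda>j. \<alpha> + s I j) (\<lambda>j. \<alpha> + s (insert i I) j)
    (\<lambda>j. v i \<bullet> col (Q I) j) (\<lambda>j. v i \<bullet> col (Q (insert i I)) j)
    (\<lambda>j k. col (Q I) j \<bullet> col (Q (insert i I)) k) \<alpha>"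
proof
  let ?I = "insert i I"
  note cq = col_Q
  have comm: "x \<bullet> y = y \<bullet> x" if "x \<in> carrier_vec d" "y \<in> carrier_vec d" for x y :: "real vec"
    by (rule comm_scalar_prod[OF that])
  show "0 < \<alpha>" by (rule \<alpha>)
  show "\<alpha> \<le> \<alpha> + s I j" "\<alpha> \<le> \<alpha> + s ?I j" if "j < d" for j
    using eigenvalue_nonneg[OF that] by auto
  show "(\<Sum>k<d. (col (Q I) j \<bullet> col (Q ?I) k)\<^sup>2) = 1" if j: "j < d" for j
    using parseval_columns[OF Q(1)[of ?I] Q(3)[of ?I] cq[OF j, of I] cq[OF j, of I]] col_Q_orthonormal[OF j j, of I]
    by (simp add: power2_eq_square comm[OF cq cq[OF j]])
  show "(\<Sum>j<d. (col (Q I) j \<bullet> col (Q ?I) k)\<^sup>2) = 1" if k: "k < d" for k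
    using parseval_columns[OF Q(1)[of I] Q(3)[of I] cq[OF k, of ?I] cq[OF k, of ?I]] col_Q_orthonormal[OF k k, of ?I]
    by (simp add: power2_eq_square)
  show "v i \<bullet> col (Q I) j = (\<Sum>k<d. (col (Q I) j \<bullet> col (Q ?I) k) * (v i \<bullet> col (Q ?I) k))" if j: "j < d" for j
    using parseval_columns[OF Q(1)[of ?I] Q(3)[of ?I] v[of i] cq[OF j, of I]]
    by (simp add: comm[OF cq cq[OF j]] comm[OF cq v] mult.commute)
  show "v i \<bullet> col (Q ?I) k = (\<Sum>j<d. (col (Q I) j \<bullet> col (Q ?I) k) * (v i \<bullet> col (Q I) j))" if k: "k < d" for k
    using parseval_columns[OF Q(1)[of I] Q(3)[of I] v[of i] cq[OF k, of ?I]]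
    by (simp add: comm[OF cq v] mult.commute)
  \<comment> \<open>Evaluate the form at an old and a new eigenvector, once with each Gram matrix;
    the two values differ by the single term of index \<open>i\<close>.\<close>
  show "((\<alpha> + s ?I k) - (\<alpha> + s I j)) * (col (Q I) j \<bullet> col (Q ?I) k) = (v i \<bullet> col (Q I) j) * (v i \<bullet> col (Q ?I) k)"
    if j: "j < d" and k: "k < d" for j k
  proof -
    have e1: "s ?I k * (col (Q I) j \<bullet> col (Q ?I) k) = (\<Sum>a\<in>?I. (v a \<bullet> col (Q I) j) * (v a \<bullet> col (Q ?I) k))"
      unfolding gram_bilinear[OF v cq[OF j, of I] cq[OF k, of ?I], symmetric] ev[OF k]
      using scalar_prod_smult_distrib[OF cq[OF j, of I] cq[OF k, of ?I]] by simp
    have "s I j * (col (Q ?I) k \<bullet> col (Q I) j) = (\<Sum>a\<in>I. (v a \<bullet> col (Q ?I) k) * (v a \<bullet> col (Q I) j))"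
      unfolding gram_bilinear[OF v cq[OF k, of ?I] cq[OF j, of I], symmetric] ev[OF j]
      using scalar_prod_smult_distrib[OF cq[OF k, of ?I] cq[OF j, of I]] by simp
    then have e2: "s I j * (col (Q I) j \<bullet> col (Q ?I) k) = (\<Sum>a\<in>I. (v a \<bullet> col (Q I) j) * (v a \<bullet> col (Q ?I) k))"
      by (simp add: comm[OF cq[OF k] cq[OF j]] mult.commute)
    show ?thesis using e1 e2 i I by (simp add: algebra_simps)
  qed
  show "(\<Sum>j<d. (v i \<bullet> col (Q I) j)\<^sup>2) \<le> 1"
    using parseval_columns[OF Q(1)[of I] Q(3)[of I] v[of i] v[of i]] v_le[OF i(1)]
    by (simp add: comm[OF cq v] power2_eq_square)
qed

lemma empty_eigenvalue: "j < d \<Longrightarrow> s {} j = 0"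
  using eigenvalue_eq[of j "{}"] by simp

lemma subsets_of_size_0: "subsets_of_size n 0 = {{}}"
  by (auto simp: subsets_of_size_def dest: finite_subset[OF _ finite_lessThan])

text \<open>The potential is the trace of the inverse \<open>q\<close>-th power. An eigenvalue below
  \<open>\<alpha> / 2\<close> leaves at least half of the mass \<open>T\<close> in its direction to
  the remaining draws, so its contribution shrinks at a fixed rate; larger eigenvalues contribute at
  most \<open>(1 / \<tau>) ^ q\<close> each, which is the additive term. A final eigenvalue below
  \<open>\<alpha> / 10\<close> would make the potential much larger than its average.\<close>

lemma lower_tail:
  assumes q: "2 * real (Suc q) \<le> \<alpha>"
  shows "real (card {I \<in> subsets_of_size n l. \<exists>x\<in>carrier_vec d. (\<Sum>i\<in>I. (v i \<bullet> x)\<^sup>2) < \<alpha> / 10 * (x \<bullet> x)}) / (n choose l)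
    \<le> 2 * real d * (19 / 20) ^ q"
proof -
  define \<Phi> where "\<Phi> I = (\<Sum>j<d. (1 / (\<alpha> + s I j)) ^ q)" for I
  \<comment> \<open>The shifted value of the threshold \<open>\<alpha> / 2\<close> between small and
    large eigenvalues.\<close>
  define \<tau> where "\<tau> = 3 / 2 * \<alpha>"
  \<comment> \<open>The rate: \<open>q / 2\<close> from the trace decrease, times the mass
    \<open>\<alpha> n / (2 l)\<close> and the bound \<open>2 / (3 \<alpha>)\<close> for the inverse
    shifted eigenvalue, spread over at most \<open>n\<close> possible draws.\<close>
  define \<eta> where "\<eta> = real q / (6 * real l)"
  have \<tau>: "0 < \<tau>" using \<alpha> by (simp add: \<tau>_def)
  have \<eta>1: "\<eta> \<le> 1" "0 \<le> \<eta>" using q \<alpha>_le l by (auto simp: \<eta>_def field_simps)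
  have xpos: "0 < \<alpha> + s I j" if "j < d" for I j using eigenvalue_nonneg[OF that, of I] \<alpha> by simp
  have step: "(\<Sum>i\<in>{..<n} - I. \<Phi> (insert i I)) \<le> real (n - t) * ((1 - \<eta>) * \<Phi> I + \<eta> * (real d * (1 / \<tau>) ^ q))"
    if I: "I \<in> subsets_of_size n t" and t: "t < l" for I t
  proof -
    note I' = subsets_of_sizeD[OF I]
    have c: "real (card ({..<n} - I)) = real (n - t)" using I' by (simp add: card_Diff_subset)
    have "(\<Sum>i\<in>{..<n} - I. \<Phi> (insert i I))
      \<le> (\<Sum>i\<in>{..<n} - I. \<Phi> I - real q / 2 * (\<Sum>j<d. (v i \<bullet> col (Q I) j)\<^sup>2 * (1 / (\<alpha> + s I j)) ^ Suc q))"
    proof (rule sum_mono)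
      fix i assume i: "i \<in> {..<n} - I"
      interpret rank_one_update d "\<lambda>j. \<alpha> + s I j" "\<lambda>j. \<alpha> + s (insert i I) j"
        "\<lambda>j. v i \<bullet> col (Q I) j" "\<lambda>j. v i \<bullet> col (Q (insert i I)) j"
        "\<lambda>j k. col (Q I) j \<bullet> col (Q (insert i I)) k" \<alpha>
        using i I' by (intro rank_one_update_sample) auto
      show "\<Phi> (insert i I) \<le> \<Phi> I - real q / 2 * (\<Sum>j<d. (v i \<bullet> col (Q I) j)\<^sup>2 * (1 / (\<alpha> + s I j)) ^ Suc q)"
        using inverse_power_trace_decrease[OF q] by (simp add: \<Phi>_def)
    qed
    also have "\<dots> = real (n - t) * \<Phi> I - real q / 2 * (\<Sum>j<d. (T - s I j) * (1 / (\<alpha> + s I j)) ^ Suc q)"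
    proof -
      have "(\<Sum>i\<in>{..<n} - I. \<Sum>j<d. (v i \<bullet> col (Q I) j)\<^sup>2 * (1 / (\<alpha> + s I j)) ^ Suc q)
        = (\<Sum>j<d. (T - s I j) * (1 / (\<alpha> + s I j)) ^ Suc q)"
        by (subst sum.swap, intro sum.cong refl) (simp only: sum_distrib_right[symmetric], simp add: complement_sum I')
      then show ?thesis by (simp only: sum_subtractf sum_constant c sum_distrib_left[symmetric])
    qed
    also have "\<dots> \<le> real (n - t) * \<Phi> I - real (n - t) * \<eta> * (\<Sum>j<d. (1 / (\<alpha> + s I j)) ^ q - (1 / \<tau>) ^ q)"
    proof -
      have "real (n - t) * \<eta> * ((1 / (\<alpha> + s I j)) ^ q - (1 / \<tau>) ^ q) \<le> real q / 2 * ((T - s I j) * (1 / (\<alpha> + s I j)) ^ Suc q)"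
        if j: "j < d" for j
      proof -
        let ?u = "1 / (\<alpha> + s I j)"
        have u: "0 < ?u" using xpos[OF j] by simp
        have Ts: "0 \<le> T - s I j" using eigenvalue_le[OF j I'(2)] by simp
        show ?thesis
        proof (cases "s I j \<le> \<alpha> / 2")
          case True
          have "\<alpha> * real n / (2 * real l) \<le> T - s I j"
          proof -
            have "\<alpha> / 2 \<le> \<alpha> * real n / (2 * real l)" using \<alpha> l by (simp add: field_simps)
            then show ?thesis using True by (simp add: T_def field_simps)
          qed
          moreover have "2 / (3 * \<alpha>) \<le> ?u" using True \<alpha> xpos[OF j] by (simp add: field_simps)
          ultimately have "\<alpha> * real n / (2 * real l) * (2 / (3 * \<alpha>)) \<le> (T - s I j) * ?u"
            using \<alpha> Ts by (intro mult_mono) auto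
          then have "real n / (3 * real l) \<le> (T - s I j) * ?u" using \<alpha> by simp
          then have "real q / 2 * ?u ^ q * (real n / (3 * real l)) \<le> real q / 2 * ?u ^ q * ((T - s I j) * ?u)"
            using u by (intro mult_left_mono) auto
          moreover have "real (n - t) * \<eta> * (?u ^ q - (1 / \<tau>) ^ q) \<le> real n * \<eta> * ?u ^ q"
          proof -
            have "real (n - t) * \<eta> * (?u ^ q - (1 / \<tau>) ^ q) \<le> real (n - t) * \<eta> * ?u ^ q"
              using \<tau> \<eta>1 by (intro mult_left_mono) auto
            also have "\<dots> \<le> real n * \<eta> * ?u ^ q"
              using u \<eta>1 by (intro mult_right_mono zero_le_power) auto
            finally show ?thesis .
          qed
          moreover have "real n * \<eta> * ?u ^ q = real q / 2 * ?u ^ q * (real n / (3 * real l))"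
            by (simp add: \<eta>_def)
          moreover have "real q / 2 * ?u ^ q * ((T - s I j) * ?u) = real q / 2 * ((T - s I j) * ?u ^ Suc q)" by simp
          ultimately show ?thesis by linarith
        next
          case False
          then have "?u \<le> 1 / \<tau>" using \<tau> xpos[OF j] by (simp add: \<tau>_def field_simps)
          then have "?u ^ q \<le> (1 / \<tau>) ^ q" using u by (intro power_mono) auto
          then have "real (n - t) * \<eta> * (?u ^ q - (1 / \<tau>) ^ q) \<le> 0"
            using \<eta>1 by (intro mult_nonneg_nonpos) auto
          also have "0 \<le> real q / 2 * ((T - s I j) * ?u ^ Suc q)"
            using u Ts by (intro mult_nonneg_nonneg zero_le_power) auto
          finally show ?thesis .
        qed
      qed
      then have "(\<Sum>j<d. real (n - t) * \<eta> * ((1 / (\<alpha> + s I j)) ^ q - (1 / \<tau>) ^ q))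
        \<le> (\<Sum>j<d. real q / 2 * ((T - s I j) * (1 / (\<alpha> + s I j)) ^ Suc q))"
        by (intro sum_mono) auto
      then show ?thesis by (simp only: sum_distrib_left[symmetric])
    qed
    also have "\<dots> = real (n - t) * ((1 - \<eta>) * \<Phi> I + \<eta> * (real d * (1 / \<tau>) ^ q))"
      by (simp add: \<Phi>_def sum_subtractf algebra_simps)
    finally show ?thesis .
  qed
  have avg: "(\<Sum>I\<in>subsets_of_size n t. \<Phi> I) / (n choose t) \<le> real d * (1 / \<tau>) ^ q + (1 - \<eta>) ^ t * (real d * (1 / \<alpha>) ^ q)"
    if "t \<le> l" for t
    using that
  proof (induction t)
    case 0
    show ?case using \<tau> by (simp add: subsets_of_size_0 \<Phi>_def empty_eigenvalue)
  next
    case (Suc t)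
    have "(\<Sum>I\<in>subsets_of_size n (Suc t). \<Phi> I) / (n choose Suc t)
      \<le> (1 - \<eta>) * ((\<Sum>I\<in>subsets_of_size n t. \<Phi> I) / (n choose t)) + \<eta> * (real d * (1 / \<tau>) ^ q)"
      using Suc.prems l by (intro subset_average_step step) auto
    also have "\<dots> \<le> (1 - \<eta>) * (real d * (1 / \<tau>) ^ q + (1 - \<eta>) ^ t * (real d * (1 / \<alpha>) ^ q)) + \<eta> * (real d * (1 / \<tau>) ^ q)"
      using Suc \<eta>1 by (intro add_right_mono mult_left_mono) auto
    also have "\<dots> = real d * (1 / \<tau>) ^ q + (1 - \<eta>) ^ Suc t * (real d * (1 / \<alpha>) ^ q)"
      by (simp add: algebra_simps)
    finally show ?case .
  qed
  let ?bad = "\<lambda>I. \<exists>x\<in>carrier_vec d. (\<Sum>i\<in>I. (v i \<bullet> x)\<^sup>2) < \<alpha> / 10 * (x \<bullet> x)"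
  \<comment> \<open>A bad eigenvalue, once shifted, lies below \<open>11/10 * \<alpha>\<close>. The
    ratios of the two terms of the average to this value are governed by \<open>11/15\<close> and by
    \<open>6/7 * 11/10 = 66/70\<close>, both below \<open>19/20\<close>.\<close>
  let ?\<theta> = "(1 / (11 / 10 * \<alpha>)) ^ q"
  have "real (card {I \<in> subsets_of_size n l. ?bad I}) / (n choose l)
    \<le> (real d * (1 / \<tau>) ^ q + (1 - \<eta>) ^ l * (real d * (1 / \<alpha>) ^ q)) / ?\<theta>"
  proof (rule subset_average_markov[OF avg[OF order_refl] l(2)])
    show "0 < ?\<theta>" using \<alpha> by simp
    show "0 \<le> \<Phi> I" for I unfolding \<Phi>_def
      using xpos by (intro sum_nonneg zero_le_power) (simp add: less_imp_le)
    fix I assume "?bad I"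
    then obtain x where x: "x \<in> carrier_vec d" and lt: "(\<Sum>i\<in>I. (v i \<bullet> x)\<^sup>2) < \<alpha> / 10 * (x \<bullet> x)" by blast
    have "\<exists>j<d. s I j < \<alpha> / 10"
    proof (rule ccontr)
      assume "\<not> ?thesis"
      then have "(\<Sum>j<d. \<alpha> / 10 * (col (Q I) j \<bullet> x)\<^sup>2) \<le> (\<Sum>j<d. s I j * (col (Q I) j \<bullet> x)\<^sup>2)"
        by (intro sum_mono mult_right_mono) auto
      moreover have "(\<Sum>j<d. \<alpha> / 10 * (col (Q I) j \<bullet> x)\<^sup>2) = \<alpha> / 10 * (x \<bullet> x)"
        unfolding parseval_columns[OF Q(1)[of I] Q(3)[of I] x x] by (simp add: sum_distrib_left power2_eq_square)
      moreover have "(\<Sum>i\<in>I. (v i \<bullet> x)\<^sup>2) = (\<Sum>j<d. s I j * (col (Q I) j \<bullet> x)\<^sup>2)"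
        using sample_quadratic_form[OF x x, of I] by (simp add: power2_eq_square mult.assoc)
      ultimately show False using lt by linarith
    qed
    then obtain j where j: "j < d" "s I j < \<alpha> / 10" by blast
    have "?\<theta> \<le> (1 / (\<alpha> + s I j)) ^ q"
      using j xpos[of j I] \<alpha> by (intro power_mono divide_left_mono) auto
    also have "\<dots> \<le> \<Phi> I" unfolding \<Phi>_def
      using j xpos by (intro member_le_sum) (auto intro!: zero_le_power less_imp_le)
    finally show "?\<theta> \<le> \<Phi> I" .
  qed
  also have "\<dots> = real d * ((11 / 15) ^ q + (1 - \<eta>) ^ l * (11 / 10) ^ q)"
  proof -
    have "(1 / \<tau>) ^ q / ?\<theta> = (11 / 15) ^ q" "(1 / \<alpha>) ^ q / ?\<theta> = (11 / 10) ^ q"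
      using \<alpha> by (simp_all add: power_divide[symmetric] \<tau>_def)
    moreover have "(D * A + X * (D * B)) / t = D * (A / t + X * (B / t))" for A B D X t :: real
      by (simp add: add_divide_distrib algebra_simps)
    ultimately show ?thesis by (simp only:)
  qed
  \<comment> \<open>As \<open>\<eta> l = q / 6\<close>, the dependence on \<open>l\<close>
    disappears: the product is at most \<open>exp (-1/6) ^ q\<close>.\<close>
  also have "(1 - \<eta>) ^ l \<le> (6 / 7) ^ q"
  proof -
    have "(1 - \<eta>) ^ l \<le> exp (- \<eta>) ^ l"
      using exp_ge_add_one_self[of "- \<eta>"] \<eta>1 by (intro power_mono) auto
    also have "\<dots> = exp (- (1 / 6)) ^ q"
      using l by (simp add: exp_of_nat_mult[symmetric] \<eta>_def)
    also have "\<dots> \<le> (6 / 7) ^ q"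
    proof (rule power_mono)
      have "7 / 6 \<le> exp (1 / 6 :: real)" using exp_ge_add_one_self[of "1 / 6 :: real"] by simp
      then show "exp (- (1 / 6)) \<le> (6 / 7 :: real)" by (simp add: exp_minus field_simps)
    qed simp
    finally show ?thesis .
  qed
  then have "real d * ((11 / 15) ^ q + (1 - \<eta>) ^ l * (11 / 10) ^ q) \<le> real d * ((11 / 15) ^ q + (6 / 7) ^ q * (11 / 10) ^ q)"
    by (intro mult_left_mono add_left_mono mult_right_mono) auto
  also have "\<dots> = real d * ((11 / 15) ^ q + (66 / 70) ^ q)"
    by (simp add: power_mult_distrib[symmetric])
  also have "\<dots> \<le> real d * ((19 / 20) ^ q + (19 / 20) ^ q)"
    by (intro mult_left_mono add_mono power_mono) auto
  finally show ?thesis by simp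
qed

text \<open>The average trace of the power \<open>q + 1\<close> grows by at most the factor
  \<open>1 + 4 (q + 1) / l\<close> per draw, hence by at most \<open>exp 4 ^ (q + 1)\<close> over
  \<open>l\<close> draws. As \<open>exp 1 \<le> 3\<close>, this is at most
  \<open>81 ^ (q + 1)\<close>, which explains the threshold \<open>100 * \<alpha>\<close> for
  shifted eigenvalues.\<close>

lemma upper_tail:
  assumes q: "2 * real (Suc q) \<le> \<alpha>"
  shows "real (card {I \<in> subsets_of_size n l. \<exists>x\<in>carrier_vec d. 99 * \<alpha> * (x \<bullet> x) < (\<Sum>i\<in>I. (v i \<bullet> x)\<^sup>2)}) / (n choose l)
    \<le> real d * (19 / 20) ^ q"
proof -
  let ?bad = "\<lambda>I. \<exists>x\<in>carrier_vec d. 99 * \<alpha> * (x \<bullet> x) < (\<Sum>i\<in>I. (v i \<bullet> x)\<^sup>2)"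
  have bad: "\<exists>j<d. 99 * \<alpha> < s I j" if b: "?bad I" for I
  proof (rule ccontr)
    assume c: "\<not> ?thesis"
    obtain x where x: "x \<in> carrier_vec d" and lt: "99 * \<alpha> * (x \<bullet> x) < (\<Sum>i\<in>I. (v i \<bullet> x)\<^sup>2)" using b by blast
    have "(\<Sum>j<d. s I j * (col (Q I) j \<bullet> x)\<^sup>2) \<le> (\<Sum>j<d. 99 * \<alpha> * (col (Q I) j \<bullet> x)\<^sup>2)"
      using c by (intro sum_mono mult_right_mono) auto
    moreover have "(\<Sum>j<d. 99 * \<alpha> * (col (Q I) j \<bullet> x)\<^sup>2) = 99 * \<alpha> * (x \<bullet> x)"
      unfolding parseval_columns[OF Q(1)[of I] Q(3)[of I] x x] by (simp add: sum_distrib_left power2_eq_square)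
    moreover have "(\<Sum>i\<in>I. (v i \<bullet> x)\<^sup>2) = (\<Sum>j<d. s I j * (col (Q I) j \<bullet> x)\<^sup>2)"
      using sample_quadratic_form[OF x x, of I] by (simp add: power2_eq_square mult.assoc)
    ultimately show False using lt by linarith
  qed
  show ?thesis
  \<comment> \<open>If more than half of the indices are drawn, every eigenvalue is at most
    \<open>T\<close>, hence below \<open>2 * \<alpha>\<close>, with certainty. Otherwise at least
    \<open>n / 2\<close> indices are left at each draw, which bounds the mass per remaining
    index.\<close>
  proof (cases "2 * l \<le> n")
    case False
    have "{I \<in> subsets_of_size n l. ?bad I} = {}"
    proof (rule ccontr)
      assume "\<not> ?thesis"
      then obtain I where I: "I \<in> subsets_of_size n l" "?bad I" by blast
      from bad[OF I(2)] obtain j where j: "j < d" "99 * \<alpha> < s I j" by blast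
      have "s I j \<le> T" by (rule eigenvalue_le[OF j(1) subsets_of_sizeD(2)[OF I(1)]])
      also have "T \<le> 2 * \<alpha>" using False \<alpha> l by (simp add: T_def field_simps)
      finally show False using j \<alpha> by simp
    qed
    then show ?thesis by (simp only: card.empty) simp
  next
    case True
    define \<Psi> where "\<Psi> I = (\<Sum>j<d. (\<alpha> + s I j) ^ Suc q)" for I
    \<comment> \<open>One factor 2 comes from \<open>power_trace_increase\<close>, the other from
      \<open>n \<le> 2 (n - t)\<close>.\<close>
    define a where "a = 1 + 4 * real (Suc q) / real l"
    have xpos: "0 < \<alpha> + s I j" if "j < d" for I j using eigenvalue_nonneg[OF that, of I] \<alpha> by simp
    have step: "(\<Sum>i\<in>{..<n} - I. \<Psi> (insert i I)) \<le> real (n - t) * (a * \<Psi> I + 0)"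
      if I: "I \<in> subsets_of_size n t" and t: "t < l" for I t
    proof -
      note I' = subsets_of_sizeD[OF I]
      have c: "real (card ({..<n} - I)) = real (n - t)" using I' by (simp add: card_Diff_subset)
      have "(\<Sum>i\<in>{..<n} - I. \<Psi> (insert i I))
        \<le> (\<Sum>i\<in>{..<n} - I. \<Psi> I + 2 * real (Suc q) * (\<Sum>j<d. (v i \<bullet> col (Q I) j)\<^sup>2 * (\<alpha> + s I j) ^ q))"
      proof (rule sum_mono)
        fix i assume i: "i \<in> {..<n} - I"
        interpret rank_one_update d "\<lambda>j. \<alpha> + s I j" "\<lambda>j. \<alpha> + s (insert i I) j"
          "\<lambda>j. v i \<bullet> col (Q I) j" "\<lambda>j. v i \<bullet> col (Q (insert i I)) j"
          "\<lambda>j k. col (Q I) j \<bullet> col (Q (insert i I)) k" \<alpha>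
          using i I' by (intro rank_one_update_sample) auto
        have "2 * real q \<le> \<alpha>" using q by simp
        from power_trace_increase[OF this]
        show "\<Psi> (insert i I) \<le> \<Psi> I + 2 * real (Suc q) * (\<Sum>j<d. (v i \<bullet> col (Q I) j)\<^sup>2 * (\<alpha> + s I j) ^ q)"
          by (simp add: \<Psi>_def)
      qed
      also have "\<dots> = real (n - t) * \<Psi> I + 2 * real (Suc q) * (\<Sum>j<d. (T - s I j) * (\<alpha> + s I j) ^ q)"
      proof -
        have "(\<Sum>i\<in>{..<n} - I. \<Sum>j<d. (v i \<bullet> col (Q I) j)\<^sup>2 * (\<alpha> + s I j) ^ q)
          = (\<Sum>j<d. (T - s I j) * (\<alpha> + s I j) ^ q)"
          by (subst sum.swap, intro sum.cong refl) (simp only: sum_distrib_right[symmetric], simp add: complement_sum I')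
        then show ?thesis by (simp add: sum.distrib c sum_distrib_left[symmetric])
      qed
      also have "\<dots> \<le> real (n - t) * \<Psi> I + 2 * real (Suc q) * (2 * real (n - t) / real l * \<Psi> I)"
        unfolding \<Psi>_def sum_distrib_left[of "2 * real (n - t) / real l"]
      proof (intro add_left_mono mult_left_mono sum_mono)
        fix j assume "j \<in> {..<d}"
        then have j: "j < d" by simp
        have "T - s I j \<le> (2 * real (n - t) / real l) * (\<alpha> + s I j)"
        proof -
          have "real n \<le> 2 * real (n - t)" using True t by simp
          then have "\<alpha> * real n / real l \<le> \<alpha> * (2 * real (n - t)) / real l"
            using \<alpha> by (intro divide_right_mono mult_left_mono) auto
          also have "\<dots> \<le> (2 * real (n - t) / real l) * (\<alpha> + s I j)"
            using mult_left_mono[of \<alpha> "\<alpha> + s I j" "2 * real (n - t) / real l"] eigenvalue_nonneg[OF j, of I]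
            by (simp add: mult.commute)
          finally show ?thesis using eigenvalue_nonneg[OF j, of I] by (simp add: T_def)
        qed
        then have "(T - s I j) * (\<alpha> + s I j) ^ q \<le> (2 * real (n - t) / real l) * (\<alpha> + s I j) * (\<alpha> + s I j) ^ q"
          using xpos[OF j, of I] by (intro mult_right_mono) auto
        then show "(T - s I j) * (\<alpha> + s I j) ^ q \<le> (2 * real (n - t) / real l) * (\<alpha> + s I j) ^ Suc q"
          by (simp add: mult.assoc)
      qed auto
      also have "\<dots> = real (n - t) * (a * \<Psi> I + 0)" by (simp add: a_def algebra_simps)
      finally show ?thesis .
    qed
    have avg: "(\<Sum>I\<in>subsets_of_size n t. \<Psi> I) / (n choose t) \<le> a ^ t * (real d * \<alpha> ^ Suc q)" if "t \<le> l" for t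
      using that
    proof (induction t)
      case 0
      show ?case by (simp add: subsets_of_size_0 \<Psi>_def empty_eigenvalue)
    next
      case (Suc t)
      have "(\<Sum>I\<in>subsets_of_size n (Suc t). \<Psi> I) / (n choose Suc t)
        \<le> a * ((\<Sum>I\<in>subsets_of_size n t. \<Psi> I) / (n choose t)) + 0"
        using Suc.prems l by (intro subset_average_step step) auto
      also have "\<dots> \<le> a * (a ^ t * (real d * \<alpha> ^ Suc q)) + 0"
        using Suc by (intro add_right_mono mult_left_mono) (auto simp: a_def)
      finally show ?case by (simp add: mult.assoc)
    qed
    have "real (card {I \<in> subsets_of_size n l. ?bad I}) / (n choose l) \<le> a ^ l * (real d * \<alpha> ^ Suc q) / (100 * \<alpha>) ^ Suc q"
    proof (rule subset_average_markov[OF avg[OF order_refl] l(2)])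
      show "0 < (100 * \<alpha>) ^ Suc q" using \<alpha> by simp
      show "0 \<le> \<Psi> I" for I unfolding \<Psi>_def
        using xpos by (intro sum_nonneg zero_le_power) (simp add: less_imp_le)
      fix I assume "?bad I"
      from bad[OF this] obtain j where j: "j < d" "99 * \<alpha> < s I j" by blast
      have "(100 * \<alpha>) ^ Suc q \<le> (\<alpha> + s I j) ^ Suc q" using j \<alpha> by (intro power_mono) auto
      also have "\<dots> \<le> \<Psi> I" unfolding \<Psi>_def
        using j xpos by (intro member_le_sum) (auto intro!: zero_le_power less_imp_le simp del: power_Suc)
      finally show "(100 * \<alpha>) ^ Suc q \<le> \<Psi> I" .
    qed
    also have "a ^ l * (real d * \<alpha> ^ Suc q) / (100 * \<alpha>) ^ Suc q = real d * (a ^ l * (1 / 100) ^ Suc q)"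
      using \<alpha> by (simp add: power_mult_distrib power_divide del: power_Suc)
    also have "\<dots> \<le> real d * (81 ^ Suc q * (1 / 100) ^ Suc q)"
    proof -
      have "a ^ l \<le> exp (4 * real (Suc q) / real l) ^ l"
        unfolding a_def using exp_ge_add_one_self by (intro power_mono) auto
      also have "\<dots> = exp (4 * real (Suc q))"
        using l by (simp only: exp_of_nat_mult[symmetric]) simp
      also have "\<dots> = exp 1 ^ (4 * Suc q)"
        by (simp only: exp_of_nat_mult[symmetric]) simp
      also have "\<dots> = (exp 1 ^ 4) ^ Suc q" by (rule power_mult)
      also have "\<dots> \<le> (3 ^ 4) ^ Suc q" using exp_le by (intro power_mono) auto
      finally show ?thesis by (intro mult_left_mono mult_right_mono) auto
    qed
    also have "\<dots> = real d * (81 / 100) ^ Suc q" by (simp only: power_mult_distrib[symmetric]) simp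
    also have "\<dots> \<le> real d * (19 / 20) ^ Suc q" by (intro mult_left_mono power_mono) auto
    also have "\<dots> \<le> real d * (19 / 20) ^ q" by (intro mult_left_mono) auto
    finally show ?thesis .
  qed
qed

end

text \<open>An eigenbasis is fixed for every index set by choice, since the bases of a sample and of
  its one-point extensions are compared.\<close>

lemma isotropic_sample_exists:
  assumes "0 < d" "0 < l" "l \<le> n" "0 < \<alpha>"
    and "\<And>i. v i \<in> carrier_vec d" "\<And>i. i < n \<Longrightarrow> v i \<bullet> v i \<le> 1"
    and "\<And>x y. x \<in> carrier_vec d \<Longrightarrow> y \<in> carrier_vec d \<Longrightarrow>
      (\<Sum>i<n. (v i \<bullet> x) * (v i \<bullet> y)) = \<alpha> * real n / real l * (x \<bullet> y)"
  shows "\<exists>Q s. isotropic_sample d n l v \<alpha> Q s"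
proof -
  have "\<exists>Q s. Q \<in> carrier_mat d d \<and> transpose_mat Q * Q = 1\<^sub>m d \<and> Q * transpose_mat Q = 1\<^sub>m d \<and>
    (\<forall>j<d. gram d v I *\<^sub>v col Q j = s j \<cdot>\<^sub>v col Q j)" for I
    using symmetric_eigenbasis[OF gram_carrier transpose_gram] by metis
  then obtain Q s where "\<And>I. Q I \<in> carrier_mat d d \<and> transpose_mat (Q I) * Q I = 1\<^sub>m d \<and>
    Q I * transpose_mat (Q I) = 1\<^sub>m d \<and> (\<forall>j<d. gram d v I *\<^sub>v col (Q I) j = s I j \<cdot>\<^sub>v col (Q I) j)"
    by metis
  then show ?thesis using assms by (intro exI[of _ Q] exI[of _ s]) (auto simp: isotropic_sample_def)
qed

section \<open>Coordinate restrictions\<close>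

text \<open>Coordinates are zeroed instead of deleted: all samples then live in one space, and
  reindexing by \<open>pick\<close> is confined to the passage to actual submatrices.\<close>

definition mask :: "nat set \<Rightarrow> real vec \<Rightarrow> real vec" where
  "mask I w = vec (dim_vec w) (\<lambda>i. if i \<in> I then w $ i else 0)"

lemma mask_carrier [simp]: "w \<in> carrier_vec n \<Longrightarrow> mask I w \<in> carrier_vec n"
  by (simp add: mask_def)

lemma mask_add:
  "x \<in> carrier_vec n \<Longrightarrow> y \<in> carrier_vec n \<Longrightarrow> mask I (x + y) = mask I x + mask I y"
  by (intro eq_vecI) (auto simp: mask_def)

lemma vec_norm2_sum: "w \<in> carrier_vec n \<Longrightarrow> (vec_norm2 w)\<^sup>2 = (\<Sum>i<n. (w $ i)\<^sup>2)"
  unfolding vec_norm2_sq[symmetric] by (simp add: scalar_prod_def power2_eq_square atLeast0LessThan)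

lemma vec_norm2_mask:
  assumes "w \<in> carrier_vec n" "I \<subseteq> {..<n}"
  shows "(vec_norm2 (mask I w))\<^sup>2 = (\<Sum>i\<in>I. (w $ i)\<^sup>2)"
proof -
  have "(vec_norm2 (mask I w))\<^sup>2 = (\<Sum>i<n. if i \<in> I then (w $ i)\<^sup>2 else 0)"
    using assms by (subst vec_norm2_sum[of _ n]) (auto simp: mask_def intro!: sum.cong)
  also have "\<dots> = (\<Sum>i\<in>I. (w $ i)\<^sup>2)"
    using assms(2) by (simp add: sum.inter_restrict[symmetric] Int_absorb1)
  finally show ?thesis .
qed

lemma vec_norm2_mask_le:
  assumes w: "w \<in> carrier_vec n"
  shows "vec_norm2 (mask I w) \<le> vec_norm2 w"
proof (rule power2_le_imp_le)
  show "(vec_norm2 (mask I w))\<^sup>2 \<le> (vec_norm2 w)\<^sup>2"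
    unfolding vec_norm2_sum[OF w] vec_norm2_sum[OF mask_carrier[OF w]]
    using w by (intro sum_mono) (auto simp: mask_def)
qed (rule vec_norm2_nonneg)

lemma row_submat_carrier:
  assumes "A \<in> carrier_mat n m" "I \<subseteq> {..<n}"
  shows "row_submat A I \<in> carrier_mat (card I) m"
proof -
  have "{i. i < n \<and> i \<in> I} = I" using assms(2) by auto
  then show ?thesis using assms(1) by (intro carrier_matI) (auto simp: row_submat_def dim_submatrix)
qed

lemma bij_betw_pick: "finite I \<Longrightarrow> bij_betw (pick I) {..<card I} I"
proof (rule bij_betw_imageI)
  assume fin: "finite I"
  show inj: "inj_on (pick I) {..<card I}"
    by (rule inj_onI) (metis card_pick_le lessThan_iff)
  then have "card (pick I ` {..<card I}) = card I" by (simp add: card_image)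
  moreover have "pick I ` {..<card I} \<subseteq> I" using pick_in_set_le by auto
  ultimately show "pick I ` {..<card I} = I" using fin by (simp add: card_subset_eq)
qed

lemma vec_norm2_row_submat:
  assumes A: "A \<in> carrier_mat n m" and I: "I \<subseteq> {..<n}" and v: "v \<in> carrier_vec m"
  shows "vec_norm2 (row_submat A I *\<^sub>v v) = vec_norm2 (mask I (A *\<^sub>v v))"
proof (rule power2_eq_imp_eq)
  note M = row_submat_carrier[OF A I]
  have Ieq: "{i. i < n \<and> i \<in> I} = I" using I by auto
  have fin: "finite I" using I finite_subset by blast
  have entry: "(row_submat A I *\<^sub>v v) $ i = (A *\<^sub>v v) $ pick I i" if i: "i < card I" for i
  proof -
    have p: "pick I i < n" using pick_in_set_le[OF i] I by auto
    have "row (row_submat A I) i = row A (pick I i)"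
      using i p A M by (intro eq_vecI)
        (auto simp: row_submat_def submatrix_index[of _ _ I] Ieq pick_UNIV dim_submatrix)
    then show ?thesis using i p A M by simp
  qed
  have "(vec_norm2 (row_submat A I *\<^sub>v v))\<^sup>2 = (\<Sum>i<card I. ((A *\<^sub>v v) $ pick I i)\<^sup>2)"
    using vec_norm2_sum[OF mult_mat_vec_carrier[OF M v]] by (simp add: entry)
  also have "\<dots> = (\<Sum>i\<in>I. ((A *\<^sub>v v) $ i)\<^sup>2)"
    by (rule sum.reindex_bij_betw[OF bij_betw_pick[OF fin]])
  also have "\<dots> = (vec_norm2 (mask I (A *\<^sub>v v)))\<^sup>2"
    using vec_norm2_mask[OF mult_mat_vec_carrier[OF A v] I] by simp
  finally show "(vec_norm2 (row_submat A I *\<^sub>v v))\<^sup>2 = (vec_norm2 (mask I (A *\<^sub>v v)))\<^sup>2" .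
qed (auto simp: vec_norm2_nonneg)

lemma injective_square_surj:
  fixes N :: "real mat"
  assumes N: "N \<in> carrier_mat r r" and inj: "\<And>z. z \<in> carrier_vec r \<Longrightarrow> N *\<^sub>v z = 0\<^sub>v r \<Longrightarrow> z = 0\<^sub>v r"
    and y: "y \<in> carrier_vec r"
  obtains z where "z \<in> carrier_vec r" "N *\<^sub>v z = y"
proof -
  have "det N \<noteq> 0" using det_0_iff_vec_prod_zero_field[OF N] inj by auto
  then obtain B where B: "B \<in> carrier_mat r r" "N * B = 1\<^sub>m r"
    using det_non_zero_imp_unit[OF N, of "()"] unfolding Units_def ring_mat_def by auto
  have "N *\<^sub>v (B *\<^sub>v y) = y" using assoc_mult_mat_vec[OF N B(1) y] B(2) y by simp
  then show ?thesis using that[of "B *\<^sub>v y"] B(1) y by simp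
qed

text \<open>The least-norm solution: \<open>w\<close> is sought in the range of the masked
  \<open>V\<close>, and the normal equations have an invertible Gram matrix by
  \<open>lower\<close>.\<close>

lemma restricted_coordinates_surj:
  assumes V: "V \<in> carrier_mat m r" and J: "J \<subseteq> {..<m}" and c: "0 < c"
    and lower: "\<And>u. u \<in> carrier_vec r \<Longrightarrow> c * vec_norm2 u \<le> vec_norm2 (mask J (V *\<^sub>v u))"
    and z: "z \<in> carrier_vec r"
  obtains w where "w \<in> carrier_vec m" "\<forall>i<m. i \<notin> J \<longrightarrow> w $ i = 0"
    "transpose_mat V *\<^sub>v w = z" "vec_norm2 w \<le> vec_norm2 z / c"
proof -
  define Vm where "Vm = mat m r (\<lambda>(i, j). if i \<in> J then V $$ (i, j) else 0)"
  have Vm: "Vm \<in> carrier_mat m r" by (simp add: Vm_def)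
  have VmT: "transpose_mat Vm \<in> carrier_mat r m" using Vm by simp
  have Vmu: "Vm *\<^sub>v u = mask J (V *\<^sub>v u)" if u: "u \<in> carrier_vec r" for u
    using V u by (intro eq_vecI) (auto simp: Vm_def mask_def scalar_prod_def)
  define N where "N = transpose_mat Vm * Vm"
  have N: "N \<in> carrier_mat r r" using Vm by (simp add: N_def)
  have quad: "u \<bullet> (N *\<^sub>v u) = (vec_norm2 (Vm *\<^sub>v u))\<^sup>2" if u: "u \<in> carrier_vec r" for u
  proof -
    have Vu: "Vm *\<^sub>v u \<in> carrier_vec m" using Vm u by simp
    have "u \<bullet> (N *\<^sub>v u) = u \<bullet> (transpose_mat Vm *\<^sub>v (Vm *\<^sub>v u))"
      unfolding N_def using assoc_mult_mat_vec[OF VmT Vm u] by simp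
    also have "\<dots> = (transpose_mat Vm *\<^sub>v (Vm *\<^sub>v u)) \<bullet> u"
      by (rule comm_scalar_prod[OF u mult_mat_vec_carrier[OF VmT Vu]])
    also have "\<dots> = (vec_norm2 (Vm *\<^sub>v u))\<^sup>2"
      using transpose_vec_mult_scalar[OF Vm u Vu] by (simp add: vec_norm2_sq)
    finally show ?thesis .
  qed
  have "u = 0\<^sub>v r" if u: "u \<in> carrier_vec r" and N0: "N *\<^sub>v u = 0\<^sub>v r" for u
  proof -
    have "vec_norm2 (Vm *\<^sub>v u) = 0" using quad[OF u] u by (simp add: N0)
    then have "c * vec_norm2 u \<le> 0" using lower[OF u] by (simp add: Vmu[OF u])
    then have "vec_norm2 u = 0" using c vec_norm2_nonneg[of u] by (simp add: mult_le_0_iff)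
    then show ?thesis using vec_norm2_eq_0[OF u] by simp
  qed
  then obtain u where u: "u \<in> carrier_vec r" "N *\<^sub>v u = z"
    using injective_square_surj[OF N _ z] by metis
  define w where "w = Vm *\<^sub>v u"
  have w: "w \<in> carrier_vec m" using Vm u by (simp add: w_def)
  have supp: "w $ i = 0" if "i < m" "i \<notin> J" for i
    using that V u unfolding w_def Vmu[OF u(1)] by (simp add: mask_def)
  have "transpose_mat V *\<^sub>v w = transpose_mat Vm *\<^sub>v w"
  proof (rule eq_vecI)
    fix j assume "j < dim_vec (transpose_mat Vm *\<^sub>v w)"
    then have j: "j < r" using Vm by simp
    then show "(transpose_mat V *\<^sub>v w) $ j = (transpose_mat Vm *\<^sub>v w) $ j"
      using V Vm w supp by (auto simp: scalar_prod_def Vm_def intro!: sum.cong)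
  qed (use V Vm in simp)
  also have "\<dots> = z" using u assoc_mult_mat_vec[OF VmT Vm u(1)] by (simp add: N_def w_def)
  finally have Vw: "transpose_mat V *\<^sub>v w = z" .
  have lw: "c * vec_norm2 u \<le> vec_norm2 w" using lower[OF u(1)] by (simp add: w_def Vmu[OF u(1)])
  \<comment> \<open>The normal equations give \<open>w \<bullet> w = u \<bullet> z\<close>, and
    \<open>lower\<close> bounds \<open>u\<close> by \<open>w\<close>; thus only one factor
    \<open>1 / c\<close> is lost.\<close>
  have "(vec_norm2 w)\<^sup>2 \<le> vec_norm2 u * vec_norm2 z"
    using quad[OF u(1)] scalar_prod_cauchy_schwarz[OF u(1) z] u(2) by (simp add: w_def)
  then have "c * (vec_norm2 w)\<^sup>2 \<le> (c * vec_norm2 u) * vec_norm2 z" using c by simp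
  also have "\<dots> \<le> vec_norm2 w * vec_norm2 z" by (intro mult_right_mono lw vec_norm2_nonneg)
  finally have "vec_norm2 w * (c * vec_norm2 w) \<le> vec_norm2 w * vec_norm2 z"
    by (simp add: power2_eq_square algebra_simps)
  then have "c * vec_norm2 w \<le> vec_norm2 z"
    using vec_norm2_nonneg[of w] vec_norm2_nonneg[of z] by (cases "vec_norm2 w = 0") (auto simp: mult_le_cancel_left)
  then have "vec_norm2 w \<le> vec_norm2 z / c" using c by (simp add: field_simps)
  then show ?thesis using that w supp Vw by blast
qed

section \<open>Columns selected by a strong rank-revealing QR factorization\<close>

lemma orthonormal_colsD: "orthonormal_cols Q \<Longrightarrow> Q \<in> carrier_mat n r \<Longrightarrow> transpose_mat Q * Q = 1\<^sub>m r"
  by (auto simp: orthonormal_cols_def)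

text \<open>Only the lower bound on the singular values of the selected block is used.\<close>

lemma srrqr_embedding:
  assumes M: "M \<in> carrier_mat p m" and k: "1 \<le> k" and sel: "srrqr_selects M k J"
    and r: "1 \<le> r" "r \<le> k"
  obtains L where "L \<in> carrier_mat m r" "J \<subseteq> {..<m}" "card J = k" "k \<le> m"
    "\<forall>z\<in>carrier_vec r. vec_norm2 (L *\<^sub>v z) = vec_norm2 z \<and>
      (\<forall>i<m. i \<notin> J \<longrightarrow> (L *\<^sub>v z) $ i = 0) \<and>
      sing_val r M / sqrt (real m * real k) * vec_norm2 z \<le> vec_norm2 (M *\<^sub>v (L *\<^sub>v z))"
proof -
  obtain \<pi> Q Ar Br Cr where S: "is_srrqr M k \<pi> Q Ar Br Cr" and J: "J = \<pi> ` {..<k}"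
    using sel unfolding srrqr_selects_def by auto
  have km: "k \<le> m" and perm: "\<pi> permutes {..<m}"
    and Q: "Q \<in> carrier_mat p p" "orthonormal_cols Q"
    and c: "Ar \<in> carrier_mat k k" "Br \<in> carrier_mat k (m - k)" "Cr \<in> carrier_mat (p - k) (m - k)"
    and fact: "M * perm_mat m \<pi> = Q * four_block_mat Ar Br (0\<^sub>m (p - k) k) Cr"
    and kp: "k \<le> p"
    and sv: "sing_val r Ar \<ge> sing_val r M / sqrt (1 + real k * (real m - real k))"
    using S M r unfolding is_srrqr_def Let_def by auto
  have J_sub: "J \<subseteq> {..<m}" using permutes_in_image[OF perm] km unfolding J by force
  have cardJ: "card J = k" unfolding J using card_image[OF inj_on_subset[OF permutes_inj_on[OF perm, of UNIV]]] by simp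
  obtain K where K: "K \<in> carrier_mat k r" "transpose_mat K * K = 1\<^sub>m r"
    and Kl: "\<And>z. z \<in> carrier_vec r \<Longrightarrow> sing_val r Ar * vec_norm2 z \<le> vec_norm2 (Ar *\<^sub>v (K *\<^sub>v z))"
    using sing_val_subspace[OF c(1) r] by blast
  define e where "e z = (K *\<^sub>v z) @\<^sub>v 0\<^sub>v (m - k)" for z
  have e: "e z \<in> carrier_vec m" if "z \<in> carrier_vec r" for z
    using that K km by (intro carrier_vecI) (auto simp: e_def)
  \<comment> \<open>The leading \<open>r\<close>-dimensional singular subspace of the block
    \<open>Ar\<close>, padded by zeros; the permutation then moves its support to
    \<open>J\<close>.\<close>
  define K0 where "K0 = mat m r (\<lambda>(i, j). if i < k then K $$ (i, j) else 0)"
  have K0: "K0 \<in> carrier_mat m r" by (simp add: K0_def)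
  have K0e: "K0 *\<^sub>v z = e z" if z: "z \<in> carrier_vec r" for z
    using z K km by (intro eq_vecI) (auto simp: K0_def e_def scalar_prod_def)
  have Pm: "perm_mat m \<pi> \<in> carrier_mat m m" by (simp add: perm_mat_def)
  define L where "L = perm_mat m \<pi> * K0"
  have L: "L \<in> carrier_mat m r" using Pm K0 by (simp add: L_def)
  have Lz: "L *\<^sub>v z = perm_mat m \<pi> *\<^sub>v e z" if z: "z \<in> carrier_vec r" for z
    unfolding L_def using assoc_mult_mat_vec[OF Pm K0 z] K0e[OF z] by simp
  have perm_entry: "(perm_mat m \<pi> *\<^sub>v w) $ \<pi> j = w $ j" if w: "w \<in> carrier_vec m" and j: "j < m" for w j
  proof -
    have pj: "\<pi> j < m" using permutes_in_image[OF perm] j by auto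
    have "row (perm_mat m \<pi>) (\<pi> j) = unit_vec m j"
      using pj j permutes_inj[OF perm] by (intro eq_vecI) (auto simp: perm_mat_def inj_eq)
    then show ?thesis using pj j w Pm by simp
  qed
  have norm_perm: "vec_norm2 (perm_mat m \<pi> *\<^sub>v w) = vec_norm2 w" if w: "w \<in> carrier_vec m" for w
  proof (rule power2_eq_imp_eq)
    have "(vec_norm2 (perm_mat m \<pi> *\<^sub>v w))\<^sup>2 = (\<Sum>i<m. ((perm_mat m \<pi> *\<^sub>v w) $ i)\<^sup>2)"
      using w Pm by (intro vec_norm2_sum) simp
    also have "\<dots> = (\<Sum>j<m. ((perm_mat m \<pi> *\<^sub>v w) $ \<pi> j)\<^sup>2)"
      by (rule sum.reindex_bij_betw[OF permutes_imp_bij[OF perm], symmetric])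
    also have "\<dots> = (vec_norm2 w)\<^sup>2" using w by (simp add: perm_entry vec_norm2_sum)
    finally show "(vec_norm2 (perm_mat m \<pi> *\<^sub>v w))\<^sup>2 = (vec_norm2 w)\<^sup>2" .
  qed (auto simp: vec_norm2_nonneg)
  have norm_e: "vec_norm2 (x @\<^sub>v 0\<^sub>v q) = vec_norm2 x" if "x \<in> carrier_vec s" for x q s
    using that by (simp add: vec_norm2_def scalar_prod_append[of x s "0\<^sub>v q" q])
  have "vec_norm2 (L *\<^sub>v z) = vec_norm2 z \<and> (\<forall>i<m. i \<notin> J \<longrightarrow> (L *\<^sub>v z) $ i = 0) \<and>
      sing_val r M / sqrt (real m * real k) * vec_norm2 z \<le> vec_norm2 (M *\<^sub>v (L *\<^sub>v z))"
    if z: "z \<in> carrier_vec r" for z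
  proof (intro conjI allI impI)
    have Kz: "K *\<^sub>v z \<in> carrier_vec k" using K z by simp
    have "vec_norm2 (e z) = vec_norm2 z"
      unfolding e_def norm_e[OF Kz] by (rule vec_norm2_orthonormal_mult[OF K z])
    then show "vec_norm2 (L *\<^sub>v z) = vec_norm2 z"
      unfolding Lz[OF z] norm_perm[OF e[OF z]] .
    show "(L *\<^sub>v z) $ i = 0" if i: "i < m" "i \<notin> J" for i
    proof -
      obtain j where j: "j < m" "i = \<pi> j"
        using i(1) permutes_image[OF perm] by (metis imageE lessThan_iff)
      then have "k \<le> j" using i(2) J by force
      then show ?thesis unfolding Lz[OF z] j(2) perm_entry[OF e[OF z] j(1)]
        using j(1) K by (simp add: e_def)
    qed
    have blk: "four_block_mat Ar Br (0\<^sub>m (p - k) k) Cr *\<^sub>v e z = (Ar *\<^sub>v (K *\<^sub>v z)) @\<^sub>v 0\<^sub>v (p - k)"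
    proof -
      have "four_block_mat Ar Br (0\<^sub>m (p - k) k) Cr *\<^sub>v e z
        = (Ar *\<^sub>v (K *\<^sub>v z) + Br *\<^sub>v 0\<^sub>v (m - k)) @\<^sub>v (0\<^sub>m (p - k) k *\<^sub>v (K *\<^sub>v z) + Cr *\<^sub>v 0\<^sub>v (m - k))"
        unfolding e_def by (rule four_block_mat_mult_vec[OF c(1,2) zero_carrier_mat c(3) Kz zero_carrier_vec])
      also have "Br *\<^sub>v 0\<^sub>v (m - k) = 0\<^sub>v k" using c by (intro eq_vecI) auto
      also have "Cr *\<^sub>v 0\<^sub>v (m - k) = 0\<^sub>v (p - k)" using c by (intro eq_vecI) auto
      also have "0\<^sub>m (p - k) k *\<^sub>v (K *\<^sub>v z) = 0\<^sub>v (p - k)" using Kz by (intro eq_vecI) auto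
      finally show ?thesis using c Kz by simp
    qed
    have B: "four_block_mat Ar Br (0\<^sub>m (p - k) k) Cr \<in> carrier_mat p m"
      using four_block_carrier_mat[OF c(1,3)] kp km by simp
    have "M *\<^sub>v (L *\<^sub>v z) = (M * perm_mat m \<pi>) *\<^sub>v e z"
      unfolding Lz[OF z] using assoc_mult_mat_vec[OF M Pm e[OF z]] by simp
    also have "\<dots> = Q *\<^sub>v ((Ar *\<^sub>v (K *\<^sub>v z)) @\<^sub>v 0\<^sub>v (p - k))"
      unfolding fact using assoc_mult_mat_vec[OF Q(1) B e[OF z]] blk by simp
    moreover have "(Ar *\<^sub>v (K *\<^sub>v z)) @\<^sub>v 0\<^sub>v (p - k) \<in> carrier_vec p"
      using c kp by (intro carrier_vecI) simp
    ultimately have "vec_norm2 (M *\<^sub>v (L *\<^sub>v z)) = vec_norm2 ((Ar *\<^sub>v (K *\<^sub>v z)) @\<^sub>v 0\<^sub>v (p - k))"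
      using vec_norm2_orthonormal_mult[OF Q(1) orthonormal_colsD[OF Q(2,1)]] by simp
    also have "\<dots> = vec_norm2 (Ar *\<^sub>v (K *\<^sub>v z))" by (rule norm_e[OF mult_mat_vec_carrier[OF c(1) Kz]])
    finally have norm_eq: "vec_norm2 (M *\<^sub>v (L *\<^sub>v z)) = vec_norm2 (Ar *\<^sub>v (K *\<^sub>v z))" .
    \<comment> \<open>The factor \<open>sqrt (1 + k (m - k))\<close> of the factorization is
      simplified to \<open>sqrt (m k)\<close>, using \<open>k\<^sup>2 \<ge> 1\<close>.\<close>
    have "sing_val r M / sqrt (real m * real k) \<le> sing_val r M / sqrt (1 + real k * (real m - real k))"
    proof (rule divide_left_mono)
      have "1 \<le> real k * real k" using k by (simp add: mult_ge1_I)
      then have "1 + real k * (real m - real k) \<le> real m * real k" by (simp add: algebra_simps)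
      then show "sqrt (1 + real k * (real m - real k)) \<le> sqrt (real m * real k)" by simp
      have "0 < 1 + real k * (real m - real k)" using km by (intro add_pos_nonneg) auto
      then show "0 < sqrt (real m * real k) * sqrt (1 + real k * (real m - real k))"
        using k km by (intro mult_pos_pos) auto
    qed (rule sing_val_nonneg)
    also have "\<dots> \<le> sing_val r Ar" by (rule sv)
    finally have "sing_val r M / sqrt (real m * real k) * vec_norm2 z \<le> sing_val r Ar * vec_norm2 z"
      by (intro mult_right_mono vec_norm2_nonneg)
    also have "\<dots> \<le> vec_norm2 (M *\<^sub>v (L *\<^sub>v z))" unfolding norm_eq by (rule Kl[OF z])
    finally show "sing_val r M / sqrt (real m * real k) * vec_norm2 z \<le> vec_norm2 (M *\<^sub>v (L *\<^sub>v z))" .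
  qed
  then show ?thesis by (intro that[OF L J_sub cardJ km] ballI)
qed

section \<open>Error of the projection onto the selected columns\<close>

lemma vec_norm2_add_ge:
  assumes "x \<in> carrier_vec n" "y \<in> carrier_vec n"
  shows "vec_norm2 x - vec_norm2 y \<le> vec_norm2 (x + y)"
proof -
  have "x = (x + y) - y" using assms by (intro eq_vecI) auto
  then have "vec_norm2 x \<le> vec_norm2 (x + y) + vec_norm2 y"
    using vec_norm2_minus_le[of "x + y" n y] assms by simp
  then show ?thesis by simp
qed

text \<open>\<open>U F\<close> is the part of \<open>A\<close> seen by the sampled rows and
  \<open>B\<close> the part that vanishes there; in the application \<open>U = [X1 X2]\<close>,
  \<open>F\<close> stacks \<open>Z1 Y1\<^sup>T\<close> and \<open>Z2 Y2\<^sup>T\<close>, and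
  \<open>B = X3 Z3 Y3\<^sup>T\<close>. The inner dimension \<open>r\<close> of the visible part may
  be smaller than the number \<open>k\<close> of selected columns. The assumption
  \<open>\<epsilon>_le\<close> lets \<open>E\<close> consume at most half of the lower bound that
  survives the loss \<open>sqrt (m k)\<close> of the factorization.\<close>

locale column_selection =
  fixes n m r k :: nat and A U F B E :: "real mat" and I J :: "nat set" and \<epsilon> a a' b f :: real
  assumes carriers: "A \<in> carrier_mat n m" "U \<in> carrier_mat n r" "F \<in> carrier_mat r m"
      "B \<in> carrier_mat n m" "E \<in> carrier_mat n m"
    and decomp: "\<And>x. x \<in> carrier_vec m \<Longrightarrow> A *\<^sub>v x = U *\<^sub>v (F *\<^sub>v x) + B *\<^sub>v x + E *\<^sub>v x"
    and E_le: "\<And>x. x \<in> carrier_vec m \<Longrightarrow> vec_norm2 (E *\<^sub>v x) \<le> \<epsilon> * vec_norm2 x"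
    and I: "I \<subseteq> {..<n}"
    and B0: "\<And>x. x \<in> carrier_vec m \<Longrightarrow> mask I (B *\<^sub>v x) = 0\<^sub>v n"
    and U_ge: "\<And>u. u \<in> carrier_vec r \<Longrightarrow> a * vec_norm2 u \<le> vec_norm2 (mask I (U *\<^sub>v u))"
    and U_le: "\<And>u. u \<in> carrier_vec r \<Longrightarrow> vec_norm2 (mask I (U *\<^sub>v u)) \<le> a' * vec_norm2 u"
    and F_ge: "\<And>w. w \<in> carrier_vec r \<Longrightarrow> b * vec_norm2 w \<le> vec_norm2 (transpose_mat F *\<^sub>v w)"
    and F_le: "\<And>x. x \<in> carrier_vec m \<Longrightarrow> vec_norm2 (F *\<^sub>v x) \<le> f * vec_norm2 x"
    and pos: "0 < a" "0 < b" "0 \<le> a'" "0 \<le> f" "0 \<le> \<epsilon>"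
    and k: "1 \<le> k" "r \<le> k" "k \<le> m"
    and sel: "srrqr_selects (row_submat A I) k J"
    and \<epsilon>_le: "4 * sqrt (real m * real k) * \<epsilon> \<le> a * b"
begin

text \<open>The price for moving a vector onto \<open>J\<close> without changing its image under
  \<open>F\<close>: the selection loss \<open>sqrt (m k)\<close>, the conditioning
  \<open>a' / a\<close> of the sampled \<open>U\<close> and the ratio \<open>f / b\<close> for
  \<open>F\<close>.\<close>

definition "\<omega> = 2 * sqrt (real m * real k) * a' * f / (a * b)"

lemma \<omega>_nonneg: "0 \<le> \<omega>"
  using pos by (simp add: \<omega>_def)

lemma sqrt_mk: "1 \<le> sqrt (real m * real k)"
proof -
  have "1 \<le> real m * real k" using k by (intro mult_ge1_I) auto
  then show ?thesis by simp
qed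

lemma norm_restricted:
  assumes x: "x \<in> carrier_vec m"
  shows "vec_norm2 (mask I (U *\<^sub>v (F *\<^sub>v x))) - \<epsilon> * vec_norm2 x \<le> vec_norm2 (row_submat A I *\<^sub>v x)"
    "vec_norm2 (row_submat A I *\<^sub>v x) \<le> vec_norm2 (mask I (U *\<^sub>v (F *\<^sub>v x))) + \<epsilon> * vec_norm2 x"
proof -
  have c: "U *\<^sub>v (F *\<^sub>v x) \<in> carrier_vec n" "B *\<^sub>v x \<in> carrier_vec n" "E *\<^sub>v x \<in> carrier_vec n"
    using carriers x by auto
  have mc: "mask I (U *\<^sub>v (F *\<^sub>v x)) \<in> carrier_vec n" "mask I (E *\<^sub>v x) \<in> carrier_vec n" using c by auto
  have "mask I (A *\<^sub>v x) = mask I (U *\<^sub>v (F *\<^sub>v x)) + mask I (B *\<^sub>v x) + mask I (E *\<^sub>v x)"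
    unfolding decomp[OF x] using c by (simp add: mask_add[of _ n] del: assoc_add_vec)
  then have e: "vec_norm2 (row_submat A I *\<^sub>v x) = vec_norm2 (mask I (U *\<^sub>v (F *\<^sub>v x)) + mask I (E *\<^sub>v x))"
    unfolding vec_norm2_row_submat[OF carriers(1) I x] B0[OF x] using mc by simp
  have "vec_norm2 (mask I (E *\<^sub>v x)) \<le> \<epsilon> * vec_norm2 x"
    using vec_norm2_mask_le[OF c(3), of I] E_le[OF x] by simp
  then show "vec_norm2 (mask I (U *\<^sub>v (F *\<^sub>v x))) - \<epsilon> * vec_norm2 x \<le> vec_norm2 (row_submat A I *\<^sub>v x)"
    "vec_norm2 (row_submat A I *\<^sub>v x) \<le> vec_norm2 (mask I (U *\<^sub>v (F *\<^sub>v x))) + \<epsilon> * vec_norm2 x"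
    unfolding e using vec_norm2_add_ge[OF mc] vec_norm2_triangle[OF mc] by auto
qed

text \<open>The factorization gives a map \<open>L\<close> into vectors supported on
  \<open>J\<close>, and \<open>F L\<close> is square. It is bounded below, hence bijective:
  \<open>row_submat A I\<close> is bounded below on the range of \<open>L\<close> and acts, up to
  \<open>\<epsilon>\<close>, only through \<open>F\<close>.\<close>

lemma selected_preimage:
  assumes x: "x \<in> carrier_vec m"
  obtains v where "v \<in> carrier_vec m" "\<forall>i<m. i \<notin> J \<longrightarrow> v $ i = 0" "F *\<^sub>v v = F *\<^sub>v x"
    "vec_norm2 v \<le> \<omega> * vec_norm2 x"
proof (cases "r = 0")
  \<comment> \<open>This happens for \<open>k1 = k2 = 0\<close>; \<open>F\<close> then imposes no
    condition and the zero vector will do.\<close>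
  case True
  have "F *\<^sub>v 0\<^sub>v m = F *\<^sub>v x" using carriers True by (intro eq_vecI) auto
  then show ?thesis using that[of "0\<^sub>v m"] \<omega>_nonneg vec_norm2_nonneg[of x] by simp
next
  case False
  then have r: "1 \<le> r" by simp
  note M = row_submat_carrier[OF carriers(1) I]
  have FT: "transpose_mat F \<in> carrier_mat m r" using carriers by simp
  \<comment> \<open>\<open>F\<close> is bounded below on the range of its transpose, and this range
    is the test subspace for the \<open>r\<close>-th singular value of the sampled rows.\<close>
  have FF: "b * vec_norm2 (transpose_mat F *\<^sub>v w) \<le> vec_norm2 (F *\<^sub>v (transpose_mat F *\<^sub>v w))"
    if w: "w \<in> carrier_vec r" for w
  proof -
    let ?h = "transpose_mat F *\<^sub>v w"
    have h: "?h \<in> carrier_vec m" using FT w by simp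
    have Fh: "F *\<^sub>v ?h \<in> carrier_vec r" using carriers h by simp
    have "(vec_norm2 ?h)\<^sup>2 = w \<bullet> (F *\<^sub>v ?h)"
      using transpose_vec_mult_scalar[OF carriers(3) h w] by (simp add: vec_norm2_sq)
    also have "\<dots> \<le> vec_norm2 w * vec_norm2 (F *\<^sub>v ?h)"
      using scalar_prod_cauchy_schwarz[OF w Fh] by simp
    finally have "b * (vec_norm2 ?h)\<^sup>2 \<le> (b * vec_norm2 w) * vec_norm2 (F *\<^sub>v ?h)"
      using pos(2) by simp
    also have "\<dots> \<le> vec_norm2 ?h * vec_norm2 (F *\<^sub>v ?h)"
      by (intro mult_right_mono F_ge w vec_norm2_nonneg)
    finally have "vec_norm2 ?h * (b * vec_norm2 ?h) \<le> vec_norm2 ?h * vec_norm2 (F *\<^sub>v ?h)"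
      by (simp add: power2_eq_square algebra_simps)
    then show ?thesis
      using vec_norm2_nonneg[of ?h] vec_norm2_nonneg[of "F *\<^sub>v ?h"]
      by (cases "vec_norm2 ?h = 0") (auto simp: mult_le_cancel_left)
  qed
  have \<epsilon>_ab: "4 * \<epsilon> \<le> a * b"
  proof -
    have "4 * \<epsilon> \<le> 4 * sqrt (real m * real k) * \<epsilon>"
      using mult_right_mono[OF sqrt_mk, of "4 * \<epsilon>"] pos by (simp add: algebra_simps)
    then show ?thesis using \<epsilon>_le by linarith
  qed
  have sM: "a * b - \<epsilon> \<le> sing_val r (row_submat A I)"
  proof (rule sing_val_ge[OF M FT r])
    show "0 \<le> a * b - \<epsilon>" using \<epsilon>_ab pos by simp
    fix w :: "real vec" assume w: "w \<in> carrier_vec r"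
    let ?h = "transpose_mat F *\<^sub>v w"
    have h: "?h \<in> carrier_vec m" using FT w by simp
    show "?h \<noteq> 0\<^sub>v m" if "w \<noteq> 0\<^sub>v r"
    proof -
      have "0 < b * vec_norm2 w" using pos vec_norm2_pos[OF w that] by simp
      then show ?thesis using F_ge[OF w] by auto
    qed
    have "a * (b * vec_norm2 ?h) \<le> a * vec_norm2 (F *\<^sub>v ?h)"
      using pos by (intro mult_left_mono FF w) auto
    also have "\<dots> \<le> vec_norm2 (mask I (U *\<^sub>v (F *\<^sub>v ?h)))"
      using carriers h by (intro U_ge) simp
    finally show "(a * b - \<epsilon>) * vec_norm2 ?h \<le> vec_norm2 (row_submat A I *\<^sub>v ?h)"
      using norm_restricted(1)[OF h] by (simp add: algebra_simps)
  qed
  obtain L where L: "L \<in> carrier_mat m r" and Lz: "\<forall>z\<in>carrier_vec r. vec_norm2 (L *\<^sub>v z) = vec_norm2 z \<and>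
      (\<forall>i<m. i \<notin> J \<longrightarrow> (L *\<^sub>v z) $ i = 0) \<and>
      sing_val r (row_submat A I) / sqrt (real m * real k) * vec_norm2 z \<le> vec_norm2 (row_submat A I *\<^sub>v (L *\<^sub>v z))"
    using srrqr_embedding[OF M k(1) sel r k(2)] .
  define N where "N = F * L"
  have N: "N \<in> carrier_mat r r" using carriers L by (simp add: N_def)
  have NL: "N *\<^sub>v z = F *\<^sub>v (L *\<^sub>v z)" if "z \<in> carrier_vec r" for z
    unfolding N_def using assoc_mult_mat_vec[OF carriers(3) L that] .
  \<comment> \<open>Half of \<open>a b / sqrt (m k)\<close>; the other half absorbs the error in the
    singular value and the error of replacing the sampled rows by \<open>U F\<close>.\<close>
  define t where "t = a * b / (2 * sqrt (real m * real k))"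
  have t: "0 < t" using pos sqrt_mk by (simp add: t_def)
  have Nge: "t * vec_norm2 z \<le> a' * vec_norm2 (N *\<^sub>v z)" if z: "z \<in> carrier_vec r" for z
  proof -
    note lz = Lz[rule_format, OF z]
    have Lc: "L *\<^sub>v z \<in> carrier_vec m" using L z by simp
    have "t \<le> (a * b - \<epsilon>) / sqrt (real m * real k) - \<epsilon>"
    proof -
      have "a * b \<le> 2 * (a * b - \<epsilon>) - 2 * \<epsilon> * sqrt (real m * real k)"
        using \<epsilon>_le \<epsilon>_ab by (simp add: mult.commute mult.left_commute)
      moreover have "u / (2 * q) \<le> (u - \<epsilon>) / q - \<epsilon>"
        if "u \<le> 2 * (u - \<epsilon>) - 2 * \<epsilon> * q" "1 \<le> q" for u q
        using that by (simp add: field_simps)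
      ultimately show ?thesis using sqrt_mk unfolding t_def by blast
    qed
    also have "\<dots> \<le> sing_val r (row_submat A I) / sqrt (real m * real k) - \<epsilon>"
      using sM by (intro diff_right_mono divide_right_mono) auto
    finally have "t * vec_norm2 z \<le> (sing_val r (row_submat A I) / sqrt (real m * real k) - \<epsilon>) * vec_norm2 z"
      by (intro mult_right_mono vec_norm2_nonneg)
    also have "\<dots> \<le> vec_norm2 (mask I (U *\<^sub>v (F *\<^sub>v (L *\<^sub>v z))))"
      using lz norm_restricted(2)[OF Lc] by (simp add: algebra_simps)
    also have "\<dots> \<le> a' * vec_norm2 (N *\<^sub>v z)"
      unfolding NL[OF z] using carriers Lc by (intro U_le) simp
    finally show ?thesis .
  qed
  have "z = 0\<^sub>v r" if z: "z \<in> carrier_vec r" and N0: "N *\<^sub>v z = 0\<^sub>v r" for z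
  proof -
    have "t * vec_norm2 z \<le> 0" using Nge[OF z] by (simp add: N0)
    then have "vec_norm2 z = 0" using t vec_norm2_nonneg[of z] by (simp add: mult_le_0_iff)
    then show ?thesis using vec_norm2_eq_0[OF z] by simp
  qed
  moreover have Fx: "F *\<^sub>v x \<in> carrier_vec r" using carriers x by simp
  ultimately obtain z where z: "z \<in> carrier_vec r" "N *\<^sub>v z = F *\<^sub>v x"
    using injective_square_surj[OF N] by metis
  have "t * vec_norm2 z \<le> a' * (f * vec_norm2 x)"
    using Nge[OF z(1)] mult_left_mono[OF F_le[OF x] pos(3)] unfolding z(2) by simp
  then have "vec_norm2 z \<le> a' * f * vec_norm2 x / t" using t by (simp add: field_simps)
  also have "\<dots> = \<omega> * vec_norm2 x"
    using pos sqrt_mk by (simp add: t_def \<omega>_def)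
  finally have "vec_norm2 z \<le> \<omega> * vec_norm2 x" .
  then show ?thesis
    using that[of "L *\<^sub>v z"] L z Lz[rule_format, OF z(1)] NL[OF z(1)] by simp
qed

end

text \<open>The range of \<open>D\<close> is almost spanned by the columns \<open>J\<^sub>b\<close>, up to an error of size \<open>\<epsilon> / a\<^sub>b\<close>. This
  controls the part \<open>B\<close>, which is invisible in the rows \<open>I\<close>; the rest is spanned by the columns \<open>J\<close>.\<close>

lemma (in column_selection) projection_error:
  fixes P D V G :: "real mat"
  assumes P: "P \<in> carrier_mat n n" and P_le: "\<And>y. y \<in> carrier_vec n \<Longrightarrow> vec_norm2 (P *\<^sub>v y) \<le> vec_norm2 y"
    and PA: "\<And>v. v \<in> carrier_vec m \<Longrightarrow> \<forall>i<m. i \<notin> J \<union> Jb \<longrightarrow> v $ i = 0 \<Longrightarrow> P *\<^sub>v (A *\<^sub>v v) = 0\<^sub>v n"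
    and D: "D \<in> carrier_mat n r'" and V: "V \<in> carrier_mat m r'" and G: "G \<in> carrier_mat n m"
    and decomp': "\<And>x. x \<in> carrier_vec m \<Longrightarrow> A *\<^sub>v x = D *\<^sub>v (transpose_mat V *\<^sub>v x) + G *\<^sub>v x + E *\<^sub>v x"
    and Jb: "Jb \<subseteq> {..<m}" and ab: "0 < ab"
    and V_ge: "\<And>u. u \<in> carrier_vec r' \<Longrightarrow> ab * vec_norm2 u \<le> vec_norm2 (mask Jb (V *\<^sub>v u))"
    and G0: "\<And>v. v \<in> carrier_vec m \<Longrightarrow> \<forall>i<m. i \<notin> Jb \<longrightarrow> v $ i = 0 \<Longrightarrow> G *\<^sub>v v = 0\<^sub>v n"
    and BD: "\<And>x. x \<in> carrier_vec m \<Longrightarrow> \<exists>z\<in>carrier_vec r'. vec_norm2 z \<le> vec_norm2 x \<and> B *\<^sub>v x = D *\<^sub>v z"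
    and BD': "\<And>v. v \<in> carrier_vec m \<Longrightarrow> \<forall>i<m. i \<notin> J \<longrightarrow> v $ i = 0 \<Longrightarrow>
      \<exists>z\<in>carrier_vec r'. vec_norm2 z \<le> \<kappa> * vec_norm2 v \<and> B *\<^sub>v v = D *\<^sub>v z"
    and \<kappa>: "0 \<le> \<kappa>" and x: "x \<in> carrier_vec m"
  shows "vec_norm2 (P *\<^sub>v (A *\<^sub>v x)) \<le> \<epsilon> * ((1 + \<kappa> / ab) * \<omega> + 1 / ab + 1) * vec_norm2 x"
proof -
  have PE: "vec_norm2 (P *\<^sub>v (E *\<^sub>v y)) \<le> \<epsilon> * vec_norm2 y" if "y \<in> carrier_vec m" for y
    using P_le[of "E *\<^sub>v y"] E_le[OF that] carriers that by fastforce
  \<comment> \<open>Write \<open>z = V\<^sup>T w\<close> with \<open>w\<close> supported on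
    \<open>Jb\<close>: there \<open>G\<close> vanishes and \<open>P\<close> kills
    \<open>A w\<close>, so \<open>P D z = - P E w\<close>.\<close>
  have PD: "vec_norm2 (P *\<^sub>v (D *\<^sub>v z)) \<le> \<epsilon> / ab * vec_norm2 z" if z: "z \<in> carrier_vec r'" for z
  proof -
    obtain w where w: "w \<in> carrier_vec m" "\<forall>i<m. i \<notin> Jb \<longrightarrow> w $ i = 0"
      "transpose_mat V *\<^sub>v w = z" "vec_norm2 w \<le> vec_norm2 z / ab"
      using restricted_coordinates_surj[OF V Jb ab V_ge z] .
    have c: "D *\<^sub>v z \<in> carrier_vec n" "E *\<^sub>v w \<in> carrier_vec n" using D z carriers w by auto
    have "P *\<^sub>v (A *\<^sub>v w) = 0\<^sub>v n" using w by (intro PA) auto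
    moreover have "A *\<^sub>v w = D *\<^sub>v z + E *\<^sub>v w"
      unfolding decomp'[OF w(1)] w(3) G0[OF w(1,2)] using c by simp
    ultimately have s: "P *\<^sub>v (D *\<^sub>v z) + P *\<^sub>v (E *\<^sub>v w) = 0\<^sub>v n"
      using mult_add_distrib_mat_vec[OF P c] by simp
    have pc: "P *\<^sub>v (D *\<^sub>v z) \<in> carrier_vec n" "P *\<^sub>v (E *\<^sub>v w) \<in> carrier_vec n" using P c by auto
    have "vec_norm2 (P *\<^sub>v (D *\<^sub>v z)) \<le> vec_norm2 (P *\<^sub>v (E *\<^sub>v w))"
      using vec_norm2_add_ge[OF pc] by (simp add: s)
    also have "\<dots> \<le> \<epsilon> * vec_norm2 w" by (rule PE[OF w(1)])
    also have "\<dots> \<le> \<epsilon> * (vec_norm2 z / ab)" using w(4) pos by (intro mult_left_mono) auto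
    finally show ?thesis by simp
  qed
  have \<epsilon>ab: "0 \<le> \<epsilon> / ab" using pos ab by simp
  obtain v where v: "v \<in> carrier_vec m" "\<forall>i<m. i \<notin> J \<longrightarrow> v $ i = 0" "F *\<^sub>v v = F *\<^sub>v x"
    "vec_norm2 v \<le> \<omega> * vec_norm2 x"
    using selected_preimage[OF x] .
  obtain z where z: "z \<in> carrier_vec r'" "vec_norm2 z \<le> vec_norm2 x" "B *\<^sub>v x = D *\<^sub>v z" using BD[OF x] by blast
  obtain z' where z': "z' \<in> carrier_vec r'" "vec_norm2 z' \<le> \<kappa> * vec_norm2 v" "B *\<^sub>v v = D *\<^sub>v z'" using BD'[OF v(1,2)] by blast
  have c: "U *\<^sub>v (F *\<^sub>v x) \<in> carrier_vec n" "B *\<^sub>v x \<in> carrier_vec n" "E *\<^sub>v x \<in> carrier_vec n"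
    "B *\<^sub>v v \<in> carrier_vec n" "E *\<^sub>v v \<in> carrier_vec n"
    using carriers x v by auto
  have pc: "P *\<^sub>v (U *\<^sub>v (F *\<^sub>v x)) \<in> carrier_vec n" "P *\<^sub>v (B *\<^sub>v x) \<in> carrier_vec n" "P *\<^sub>v (E *\<^sub>v x) \<in> carrier_vec n"
    "P *\<^sub>v (B *\<^sub>v v) \<in> carrier_vec n" "P *\<^sub>v (E *\<^sub>v v) \<in> carrier_vec n"
    using P c by auto
  have lin: "P *\<^sub>v (p + q + s) = P *\<^sub>v p + P *\<^sub>v q + P *\<^sub>v s"
    if "p \<in> carrier_vec n" "q \<in> carrier_vec n" "s \<in> carrier_vec n" for p q s
    using that P by (simp add: mult_add_distrib_mat_vec[of P n n] del: assoc_add_vec)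
  \<comment> \<open>Because \<open>F v = F x\<close>, this expresses \<open>P U F x\<close> through
    the \<open>B\<close> and \<open>E\<close> parts of \<open>v\<close> alone.\<close>
  have "P *\<^sub>v (A *\<^sub>v v) = 0\<^sub>v n" using v by (intro PA) auto
  then have s: "P *\<^sub>v (U *\<^sub>v (F *\<^sub>v x)) + (P *\<^sub>v (B *\<^sub>v v) + P *\<^sub>v (E *\<^sub>v v)) = 0\<^sub>v n"
    unfolding decomp[OF v(1)] v(3) using lin[OF c(1,4,5)] pc by simp
  have "vec_norm2 (P *\<^sub>v (U *\<^sub>v (F *\<^sub>v x))) \<le> vec_norm2 (P *\<^sub>v (B *\<^sub>v v) + P *\<^sub>v (E *\<^sub>v v))"
    using vec_norm2_add_ge[of "P *\<^sub>v (U *\<^sub>v (F *\<^sub>v x))" n "P *\<^sub>v (B *\<^sub>v v) + P *\<^sub>v (E *\<^sub>v v)"] pc by (simp add: s)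
  also have "\<dots> \<le> vec_norm2 (P *\<^sub>v (B *\<^sub>v v)) + vec_norm2 (P *\<^sub>v (E *\<^sub>v v))"
    by (rule vec_norm2_triangle[OF pc(4,5)])
  also have "\<dots> \<le> \<epsilon> / ab * (\<kappa> * vec_norm2 v) + \<epsilon> * vec_norm2 v"
    unfolding z'(3) using PD[OF z'(1)] mult_left_mono[OF z'(2) \<epsilon>ab] PE[OF v(1)] by simp
  also have "\<dots> = \<epsilon> * (1 + \<kappa> / ab) * vec_norm2 v" by (simp add: algebra_simps)
  also have "\<dots> \<le> \<epsilon> * (1 + \<kappa> / ab) * (\<omega> * vec_norm2 x)"
    using v(4) pos \<kappa> ab by (intro mult_left_mono) auto
  finally have 1: "vec_norm2 (P *\<^sub>v (U *\<^sub>v (F *\<^sub>v x))) \<le> \<epsilon> * (1 + \<kappa> / ab) * (\<omega> * vec_norm2 x)" .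
  have 2: "vec_norm2 (P *\<^sub>v (B *\<^sub>v x)) \<le> \<epsilon> / ab * vec_norm2 x"
    unfolding z(3) using PD[OF z(1)] mult_left_mono[OF z(2) \<epsilon>ab] by simp
  have "vec_norm2 (P *\<^sub>v (A *\<^sub>v x)) = vec_norm2 (P *\<^sub>v (U *\<^sub>v (F *\<^sub>v x)) + P *\<^sub>v (B *\<^sub>v x) + P *\<^sub>v (E *\<^sub>v x))"
    unfolding decomp[OF x] lin[OF c(1,2,3)] ..
  also have "\<dots> \<le> vec_norm2 (P *\<^sub>v (U *\<^sub>v (F *\<^sub>v x))) + vec_norm2 (P *\<^sub>v (B *\<^sub>v x)) + vec_norm2 (P *\<^sub>v (E *\<^sub>v x))"
    using vec_norm2_triangle[of "P *\<^sub>v (U *\<^sub>v (F *\<^sub>v x)) + P *\<^sub>v (B *\<^sub>v x)" n "P *\<^sub>v (E *\<^sub>v x)"]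
      vec_norm2_triangle[OF pc(1,2)] pc by simp
  also have "\<dots> \<le> \<epsilon> * (1 + \<kappa> / ab) * (\<omega> * vec_norm2 x) + \<epsilon> / ab * vec_norm2 x + \<epsilon> * vec_norm2 x"
    using 1 2 PE[OF x] by simp
  also have "\<dots> = \<epsilon> * ((1 + \<kappa> / ab) * \<omega> + 1 / ab + 1) * vec_norm2 x" by (simp add: algebra_simps)
  finally show ?thesis .
qed

section \<open>Sampling events\<close>

lemma prob_uniform_subset:
  assumes "l \<le> n"
  shows "measure_pmf.prob (uniform_subset n l) {I. Q I}
    = real (card {I \<in> subsets_of_size n l. Q I}) / (n choose l)"
proof -
  have "card (subsets_of_size n l) \<noteq> 0" using assms by (simp add: card_subsets_of_size)
  then have ne: "subsets_of_size n l \<noteq> {}" by auto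
  have "uniform_subset n l = pmf_of_set (subsets_of_size n l)"
    by (simp add: uniform_subset_def subsets_of_size_def)
  moreover have "subsets_of_size n l \<inter> {I. Q I} = {I \<in> subsets_of_size n l. Q I}" by auto
  ultimately show ?thesis by (simp add: measure_pmf_of_set[OF ne] card_subsets_of_size)
qed

lemma set_pmf_uniform_subset: "l \<le> n \<Longrightarrow> set_pmf (uniform_subset n l) = subsets_of_size n l"
proof -
  assume "l \<le> n"
  then have "card (subsets_of_size n l) \<noteq> 0" by (simp add: card_subsets_of_size)
  then have "subsets_of_size n l \<noteq> {}" by auto
  then show ?thesis by (simp add: uniform_subset_def subsets_of_size_def[symmetric])
qed

lemma prob_uniform_subset_mono:
  assumes l: "l \<le> n" and imp: "\<And>I. I \<in> subsets_of_size n l \<Longrightarrow> Q I \<Longrightarrow> Q' I"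
  shows "measure_pmf.prob (uniform_subset n l) {I. Q I} \<le> measure_pmf.prob (uniform_subset n l) {I. Q' I}"
proof -
  have "card {I \<in> subsets_of_size n l. Q I} \<le> card {I \<in> subsets_of_size n l. Q' I}"
    using imp by (intro card_mono) auto
  then show ?thesis unfolding prob_uniform_subset[OF l] by (intro divide_right_mono) auto
qed

text \<open>Removing \<open>i\<close> leaves a subset of size \<open>l - 1\<close> of the other
  indices, and the absorption identity evaluates the quotient of binomials.\<close>

lemma prob_member_uniform_subset:
  assumes l: "l \<le> n" and i: "i < n"
  shows "measure_pmf.prob (uniform_subset n l) {I. i \<in> I} = real l / real n"
proof (cases l)
  case 0
  then have "{I \<in> subsets_of_size n l. i \<in> I} = {}"
    by (auto simp: subsets_of_size_def dest: finite_subset[OF _ finite_lessThan])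
  then show ?thesis using 0 unfolding prob_uniform_subset[OF l] by simp
next
  case (Suc t)
  let ?S = "{K. K \<subseteq> {..<n} - {i} \<and> card K = t}"
  have fin: "finite K" if "K \<subseteq> {..<n}" for K using that finite_subset by blast
  have "bij_betw (\<lambda>K. insert i K) ?S {I \<in> subsets_of_size n l. i \<in> I}"
  proof (rule bij_betwI[where g = "\<lambda>I. I - {i}"])
    show "insert i \<in> ?S \<rightarrow> {I \<in> subsets_of_size n l. i \<in> I}"
    proof
      fix K assume K: "K \<in> ?S"
      then have "finite K" "i \<notin> K" by (auto intro: fin)
      then show "insert i K \<in> {I \<in> subsets_of_size n l. i \<in> I}"
        using K i Suc by (auto simp: subsets_of_size_def)
    qed
    show "(\<lambda>I. I - {i}) \<in> {I \<in> subsets_of_size n l. i \<in> I} \<rightarrow> ?S"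
      using Suc by (auto simp: subsets_of_size_def card_Diff_singleton fin)
  qed auto
  then have "card {I \<in> subsets_of_size n l. i \<in> I} = card ?S" by (rule bij_betw_same_card[symmetric])
  also have "\<dots> = (n - 1) choose t" using n_subsets[of "{..<n} - {i}" t] i by simp
  finally have c: "card {I \<in> subsets_of_size n l. i \<in> I} = (n - 1) choose t" .
  have "Suc t * (n choose Suc t) = n * ((n - 1) choose t)" by (rule binomial_absorption)
  then have "real l * real (n choose l) = real n * real ((n - 1) choose t)"
    unfolding Suc by (metis of_nat_mult)
  moreover have "0 < real (n choose l)" using l by simp
  ultimately have "real ((n - 1) choose t) / real (n choose l) = real l / real n"
    using i by (simp add: field_simps)
  then show ?thesis unfolding prob_uniform_subset[OF l] c .
qed

lemma prob_hit_le:
  assumes l: "l \<le> n" and T: "T \<subseteq> {..<n}"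
  shows "measure_pmf.prob (uniform_subset n l) {I. I \<inter> T \<noteq> {}} \<le> real (card T) * (real l / real n)"
proof -
  have fin: "finite T" using T finite_subset by blast
  have "measure_pmf.prob (uniform_subset n l) {I. I \<inter> T \<noteq> {}}
    \<le> measure_pmf.prob (uniform_subset n l) (\<Union>i\<in>T. {I. i \<in> I})"
    by (intro measure_pmf.finite_measure_mono) auto
  also have "\<dots> \<le> (\<Sum>i\<in>T. measure_pmf.prob (uniform_subset n l) {I. i \<in> I})"
    by (intro measure_pmf.finite_measure_subadditive_finite fin) auto
  also have "\<dots> = (\<Sum>i\<in>T. real l / real n)"
    using T by (intro sum.cong refl prob_member_uniform_subset l) auto
  finally show ?thesis by simp
qed

section \<open>Coherent matrices and their random row samples\<close>

lemma max_norm_entry: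
  assumes "U \<in> carrier_mat n d" "i < n" "j < d"
  shows "\<bar>U $$ (i, j)\<bar> \<le> max_norm U"
proof -
  have "elements_mat U = (\<lambda>(i, j). U $$ (i, j)) ` ({..<dim_row U} \<times> {..<dim_col U})"
    using elements_matI[of U "dim_row U" "dim_col U"] elements_matD[of _ U] by fastforce
  then have "finite (elements_mat U)" by simp
  then show ?thesis unfolding max_norm_def
    using assms by (intro Max_ge) auto
qed

lemma coherent_entry:
  assumes U: "U \<in> carrier_mat n d" and coh: "coherent \<mu> U" and ij: "i < n" "j < d"
  shows "(U $$ (i, j))\<^sup>2 \<le> \<mu> / real n"
proof -
  have "\<mu> = real n * (max_norm U)\<^sup>2" using coh U ij by (auto simp: coherent_def)
  moreover have "(U $$ (i, j))\<^sup>2 \<le> (max_norm U)\<^sup>2"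
    using max_norm_entry[OF U ij] by (simp add: abs_le_square_iff[symmetric])
  ultimately show ?thesis using ij by simp
qed

lemma coherent_orthonormal: "U \<in> carrier_mat n d \<Longrightarrow> coherent \<mu> U \<Longrightarrow> transpose_mat U * U = 1\<^sub>m d"
  by (auto simp: coherent_def orthonormal_cols_def)

text \<open>A unit column spreads mass 1 over \<open>n\<close> entries with squares at most
  \<open>\<mu> / n\<close>. This makes the prescribed sample sizes positive, and at least
  \<open>k\<close> when \<open>\<alpha> \<ge> 1\<close>.\<close>

lemma coherent_ge_1:
  assumes U: "U \<in> carrier_mat n d" and coh: "coherent \<mu> U" and d: "0 < d"
  shows "1 \<le> \<mu>" "0 < n"
proof -
  have "(\<Sum>i<n. (U $$ (i, 0))\<^sup>2) = (transpose_mat U * U) $$ (0, 0)"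
    using U d by (simp add: scalar_prod_def power2_eq_square atLeast0LessThan)
  then have 1: "(\<Sum>i<n. (U $$ (i, 0))\<^sup>2) = 1" using d by (simp add: coherent_orthonormal[OF U coh])
  then show n: "0 < n" by (cases n) auto
  have "(\<Sum>i<n. (U $$ (i, 0))\<^sup>2) \<le> (\<Sum>i<n. \<mu> / real n)"
    using d by (intro sum_mono coherent_entry[OF U coh]) auto
  then show "1 \<le> \<mu>" using 1 n by simp
qed

text \<open>Rows multiplied by the root of \<open>\<rho> = \<alpha> n / l = n / (\<mu> k)\<close>
  have norm at most 1, because a row has at most \<open>k\<close> entries with squares at most
  \<open>\<mu> / n\<close>. Orthonormality of the columns is isotropy with total
  \<open>\<rho>\<close>.\<close>

lemma coherent_sample:
  assumes U: "U \<in> carrier_mat n d" and coh: "coherent \<mu> U" and d: "0 < d" "d \<le> k"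
    and l: "real l = \<alpha> * \<mu> * real k" "l \<le> n" and \<alpha>: "0 < \<alpha>"
  obtains v Q s where "isotropic_sample d n l v \<alpha> Q s"
    "\<forall>I\<in>subsets_of_size n l. \<forall>u\<in>carrier_vec d.
      (\<Sum>i\<in>I. (v i \<bullet> u)\<^sup>2) = \<alpha> * real n / real l * (vec_norm2 (mask I (U *\<^sub>v u)))\<^sup>2"
proof -
  note \<mu> = coherent_ge_1(1)[OF U coh d(1)] and n = coherent_ge_1(2)[OF U coh d(1)]
  have "0 < \<alpha> * \<mu> * real k" using \<mu> \<alpha> d by simp
  then have l0: "0 < l" unfolding l(1)[symmetric] by simp
  define \<rho> where "\<rho> = \<alpha> * real n / real l"
  have \<rho>: "0 < \<rho>" using l0 \<alpha> n by (simp add: \<rho>_def)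
  have \<rho>eq: "\<rho> * (\<mu> * real k / real n) = 1" using n \<mu> \<alpha> d by (simp add: \<rho>_def l(1) field_simps)
  \<comment> \<open>Zero beyond \<open>n\<close>, as the locale asks for a vector at every
    index.\<close>
  define v where "v i = (if i < n then sqrt \<rho> \<cdot>\<^sub>v row U i else 0\<^sub>v d)" for i
  have v: "v i \<in> carrier_vec d" for i using U by (simp add: v_def)
  have vx: "v i \<bullet> x = sqrt \<rho> * (U *\<^sub>v x) $ i" if "i < n" "x \<in> carrier_vec d" for i x
    using that U by (simp add: v_def smult_scalar_prod_distrib[OF row_carrier_vec[OF that(1) U] that(2)])
  have iso: "(\<Sum>i<n. (v i \<bullet> x) * (v i \<bullet> y)) = \<alpha> * real n / real l * (x \<bullet> y)"
    if x: "x \<in> carrier_vec d" and y: "y \<in> carrier_vec d" for x y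
  proof -
    have UT: "transpose_mat U \<in> carrier_mat d n" using U by simp
    have "(\<Sum>i<n. (v i \<bullet> x) * (v i \<bullet> y)) = (\<Sum>i<n. \<rho> * ((U *\<^sub>v x) $ i * (U *\<^sub>v y) $ i))"
      using \<rho> by (intro sum.cong) (auto simp: vx x y)
    also have "\<dots> = \<rho> * ((U *\<^sub>v x) \<bullet> (U *\<^sub>v y))"
      using U by (simp add: scalar_prod_def sum_distrib_left atLeast0LessThan)
    also have "(U *\<^sub>v x) \<bullet> (U *\<^sub>v y) = (transpose_mat U *\<^sub>v (U *\<^sub>v x)) \<bullet> y"
      using U x by (intro transpose_vec_mult_scalar[OF U y, symmetric]) simp
    also have "transpose_mat U *\<^sub>v (U *\<^sub>v x) = x"
      using assoc_mult_mat_vec[OF UT U x] x by (simp add: coherent_orthonormal[OF U coh])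
    finally show ?thesis by (simp add: \<rho>_def)
  qed
  have vle: "v i \<bullet> v i \<le> 1" if i: "i < n" for i
  proof -
    have "v i \<bullet> v i = \<rho> * (\<Sum>j<d. (U $$ (i, j))\<^sup>2)"
      using i U \<rho> by (simp add: v_def smult_scalar_prod_distrib[OF row_carrier_vec[OF i U]]
          scalar_prod_smult_distrib[OF row_carrier_vec[OF i U] row_carrier_vec[OF i U]])
        (simp add: scalar_prod_def power2_eq_square atLeast0LessThan)
    also have "\<dots> \<le> \<rho> * (\<Sum>j<d. \<mu> / real n)"
      using \<rho> i by (intro mult_left_mono sum_mono coherent_entry[OF U coh]) auto
    also have "\<dots> \<le> \<rho> * (\<mu> * real k / real n)"
    proof -
      have "real d * \<mu> \<le> real k * \<mu>" using d \<mu> by (intro mult_right_mono) auto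
      then show ?thesis using \<rho> n by (simp add: divide_right_mono mult.commute)
    qed
    finally show ?thesis by (simp only: \<rho>eq)
  qed
  obtain Q s where "isotropic_sample d n l v \<alpha> Q s"
    using isotropic_sample_exists[OF d(1) l0 l(2) \<alpha> v vle iso] by auto
  moreover have "(\<Sum>i\<in>I. (v i \<bullet> u)\<^sup>2) = \<alpha> * real n / real l * (vec_norm2 (mask I (U *\<^sub>v u)))\<^sup>2"
    if I: "I \<in> subsets_of_size n l" and u: "u \<in> carrier_vec d" for I u
  proof -
    have Isub: "I \<subseteq> {..<n}" using subsets_of_sizeD(2)[OF I] .
    have "(\<Sum>i\<in>I. (v i \<bullet> u)\<^sup>2) = (\<Sum>i\<in>I. \<rho> * ((U *\<^sub>v u) $ i)\<^sup>2)"
      using Isub \<rho> u by (intro sum.cong refl) (auto simp: vx power_mult_distrib)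
    also have "\<dots> = \<rho> * (vec_norm2 (mask I (U *\<^sub>v u)))\<^sup>2"
      using vec_norm2_mask[OF mult_mat_vec_carrier[OF U u] Isub] by (simp add: sum_distrib_left)
    finally show ?thesis by (simp add: \<rho>_def)
  qed
  ultimately show ?thesis using that by blast
qed

text \<open>The tail thresholds \<open>\<alpha> / 10\<close> here and \<open>99 * \<alpha>\<close>
  in \<open>sample_upper\<close>, divided by the scale \<open>\<alpha> n / l\<close> of
  \<open>coherent_sample\<close>; the square roots pass from squares to norms.\<close>

definition sample_lower :: "nat \<Rightarrow> nat \<Rightarrow> real mat \<Rightarrow> nat set \<Rightarrow> bool" where
  "sample_lower n l U I \<longleftrightarrow> (\<forall>u\<in>carrier_vec (dim_col U).
    sqrt (real l / (10 * real n)) * vec_norm2 u \<le> vec_norm2 (mask I (U *\<^sub>v u)))"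

definition sample_upper :: "nat \<Rightarrow> nat \<Rightarrow> real mat \<Rightarrow> nat set \<Rightarrow> bool" where
  "sample_upper n l U I \<longleftrightarrow> (\<forall>u\<in>carrier_vec (dim_col U).
    vec_norm2 (mask I (U *\<^sub>v u)) \<le> sqrt (99 * real l / real n) * vec_norm2 u)"

definition rows_vanish :: "real mat \<Rightarrow> nat set \<Rightarrow> bool" where
  "rows_vanish S I \<longleftrightarrow> (\<forall>i\<in>I. \<forall>j<dim_col S. S $$ (i, j) = 0)"

lemma vec_norm2_dim_0: "u \<in> carrier_vec 0 \<Longrightarrow> vec_norm2 u = 0"
  by (simp add: vec_norm2_def scalar_prod_def)

lemma prob_sample_lower:
  assumes U: "U \<in> carrier_mat n d" and coh: "coherent \<mu> U" and dk: "d \<le> k"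
    and l: "real l = \<alpha> * \<mu> * real k" "l \<le> n" and q: "2 * real (Suc q) \<le> \<alpha>"
  shows "measure_pmf.prob (uniform_subset n l) {I. \<not> sample_lower n l U I} \<le> 2 * real k * (19 / 20) ^ q"
proof (cases "d = 0")
  \<comment> \<open>\<open>isotropic_sample\<close> requires a positive dimension; without columns
    the event is certain.\<close>
  case True
  then have "{I. \<not> sample_lower n l U I} = {}" using U
    by (auto simp: sample_lower_def vec_norm2_dim_0 vec_norm2_nonneg)
  then show ?thesis by (simp only: measure_empty) simp
next
  case False
  have \<alpha>: "0 < \<alpha>" using q by simp
  obtain v Q s where iso: "isotropic_sample d n l v \<alpha> Q s" and
    vI: "\<forall>I\<in>subsets_of_size n l. \<forall>u\<in>carrier_vec d.
      (\<Sum>i\<in>I. (v i \<bullet> u)\<^sup>2) = \<alpha> * real n / real l * (vec_norm2 (mask I (U *\<^sub>v u)))\<^sup>2"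
    using coherent_sample[OF U coh _ dk l \<alpha>] False by auto
  interpret isotropic_sample d n l v \<alpha> Q s by (rule iso)
  have n: "0 < n" using l by simp
  have "measure_pmf.prob (uniform_subset n l) {I. \<not> sample_lower n l U I}
    \<le> measure_pmf.prob (uniform_subset n l) {I. \<exists>x\<in>carrier_vec d. (\<Sum>i\<in>I. (v i \<bullet> x)\<^sup>2) < \<alpha> / 10 * (x \<bullet> x)}"
  proof (rule prob_uniform_subset_mono[OF l(2)])
    fix I assume I: "I \<in> subsets_of_size n l" and "\<not> sample_lower n l U I"
    then obtain u where u: "u \<in> carrier_vec d"
      and lt: "vec_norm2 (mask I (U *\<^sub>v u)) < sqrt (real l / (10 * real n)) * vec_norm2 u"
      using U by (auto simp: sample_lower_def not_le)
    have "(vec_norm2 (mask I (U *\<^sub>v u)))\<^sup>2 < (sqrt (real l / (10 * real n)) * vec_norm2 u)\<^sup>2"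
      using lt vec_norm2_nonneg by (intro power_strict_mono) auto
    then have "(vec_norm2 (mask I (U *\<^sub>v u)))\<^sup>2 < real l / (10 * real n) * (u \<bullet> u)"
      by (simp add: power_mult_distrib vec_norm2_sq)
    then have "\<alpha> * real n / real l * (vec_norm2 (mask I (U *\<^sub>v u)))\<^sup>2
      < \<alpha> * real n / real l * (real l / (10 * real n) * (u \<bullet> u))"
      using n \<alpha> isotropic_sample_axioms by (intro mult_strict_left_mono) (auto simp: isotropic_sample_def)
    also have "\<dots> = \<alpha> / 10 * (u \<bullet> u)" using n isotropic_sample_axioms by (simp add: isotropic_sample_def)
    finally have "(\<Sum>i\<in>I. (v i \<bullet> u)\<^sup>2) < \<alpha> / 10 * (u \<bullet> u)" using vI I u by simp
    then show "\<exists>x\<in>carrier_vec d. (\<Sum>i\<in>I. (v i \<bullet> x)\<^sup>2) < \<alpha> / 10 * (x \<bullet> x)" using u by blast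
  qed
  also have "\<dots> \<le> 2 * real d * (19 / 20) ^ q"
    unfolding prob_uniform_subset[OF l(2)] by (rule lower_tail[OF q])
  also have "\<dots> \<le> 2 * real k * (19 / 20) ^ q" using dk by (intro mult_right_mono) auto
  finally show ?thesis .
qed

lemma prob_sample_upper:
  assumes U: "U \<in> carrier_mat n d" and coh: "coherent \<mu> U" and dk: "d \<le> k"
    and l: "real l = \<alpha> * \<mu> * real k" "l \<le> n" and q: "2 * real (Suc q) \<le> \<alpha>"
  shows "measure_pmf.prob (uniform_subset n l) {I. \<not> sample_upper n l U I} \<le> real k * (19 / 20) ^ q"
proof (cases "d = 0")
  case True
  have "mask I (U *\<^sub>v u) = 0\<^sub>v n" if "u \<in> carrier_vec 0" for I u
    using that U True by (intro eq_vecI) (auto simp: mask_def scalar_prod_def)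
  then have "{I. \<not> sample_upper n l U I} = {}" using U True
    by (auto simp: sample_upper_def vec_norm2_dim_0)
  then show ?thesis by (simp only: measure_empty) simp
next
  case False
  have \<alpha>: "0 < \<alpha>" using q by simp
  obtain v Q s where iso: "isotropic_sample d n l v \<alpha> Q s" and
    vI: "\<forall>I\<in>subsets_of_size n l. \<forall>u\<in>carrier_vec d.
      (\<Sum>i\<in>I. (v i \<bullet> u)\<^sup>2) = \<alpha> * real n / real l * (vec_norm2 (mask I (U *\<^sub>v u)))\<^sup>2"
    using coherent_sample[OF U coh _ dk l \<alpha>] False by auto
  interpret isotropic_sample d n l v \<alpha> Q s by (rule iso)
  have n: "0 < n" using l by simp
  have "measure_pmf.prob (uniform_subset n l) {I. \<not> sample_upper n l U I}
    \<le> measure_pmf.prob (uniform_subset n l) {I. \<exists>x\<in>carrier_vec d. 99 * \<alpha> * (x \<bullet> x) < (\<Sum>i\<in>I. (v i \<bullet> x)\<^sup>2)}"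
  proof (rule prob_uniform_subset_mono[OF l(2)])
    fix I assume I: "I \<in> subsets_of_size n l" and "\<not> sample_upper n l U I"
    then obtain u where u: "u \<in> carrier_vec d"
      and lt: "sqrt (99 * real l / real n) * vec_norm2 u < vec_norm2 (mask I (U *\<^sub>v u))"
      using U by (auto simp: sample_upper_def not_le)
    have "(sqrt (99 * real l / real n) * vec_norm2 u)\<^sup>2 < (vec_norm2 (mask I (U *\<^sub>v u)))\<^sup>2"
      using lt vec_norm2_nonneg by (intro power_strict_mono) auto
    then have "99 * real l / real n * (u \<bullet> u) < (vec_norm2 (mask I (U *\<^sub>v u)))\<^sup>2"
      by (simp add: power_mult_distrib vec_norm2_sq)
    then have "\<alpha> * real n / real l * (99 * real l / real n * (u \<bullet> u))
      < \<alpha> * real n / real l * (vec_norm2 (mask I (U *\<^sub>v u)))\<^sup>2"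
      using n \<alpha> isotropic_sample_axioms by (intro mult_strict_left_mono) (auto simp: isotropic_sample_def)
    moreover have "\<alpha> * real n / real l * (99 * real l / real n * (u \<bullet> u)) = 99 * \<alpha> * (u \<bullet> u)"
      using n isotropic_sample_axioms by (simp add: isotropic_sample_def)
    ultimately have "99 * \<alpha> * (u \<bullet> u) < (\<Sum>i\<in>I. (v i \<bullet> u)\<^sup>2)" using vI I u by simp
    then show "\<exists>x\<in>carrier_vec d. 99 * \<alpha> * (x \<bullet> x) < (\<Sum>i\<in>I. (v i \<bullet> x)\<^sup>2)" using u by blast
  qed
  also have "\<dots> \<le> real d * (19 / 20) ^ q"
    unfolding prob_uniform_subset[OF l(2)] by (rule upper_tail[OF q])
  also have "\<dots> \<le> real k * (19 / 20) ^ q" using dk by (intro mult_right_mono) auto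
  finally show ?thesis .
qed

text \<open>All columns together have nonzero entries in at most \<open>k \<beta>\<close> rows, and
  the sample has to avoid these rows.\<close>

lemma prob_rows_vanish:
  assumes S: "S \<in> carrier_mat n d" and sp: "sparse_cols \<beta> S" and d: "d \<le> k" and l: "l \<le> n"
  shows "measure_pmf.prob (uniform_subset n l) {I. \<not> rows_vanish S I} \<le> real k * (real \<beta> * real l / real n)"
proof -
  define T where "T = (\<Union>j<d. {i. i < n \<and> S $$ (i, j) \<noteq> 0})"
  have T: "T \<subseteq> {..<n}" by (auto simp: T_def)
  have "card T \<le> (\<Sum>j<d. card {i. i < n \<and> S $$ (i, j) \<noteq> 0})" unfolding T_def by (rule card_UN_le) simp
  also have "\<dots> \<le> (\<Sum>j<d. \<beta>)" using sp S by (intro sum_mono) (auto simp: sparse_cols_def)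
  also have "\<dots> \<le> k * \<beta>" using d by simp
  finally have cT: "real (card T) \<le> real k * real \<beta>" by (metis of_nat_le_iff of_nat_mult)
  have "measure_pmf.prob (uniform_subset n l) {I. \<not> rows_vanish S I}
    \<le> measure_pmf.prob (uniform_subset n l) {I. I \<inter> T \<noteq> {}}"
  proof (rule prob_uniform_subset_mono[OF l])
    fix I assume "I \<in> subsets_of_size n l" "\<not> rows_vanish S I"
    then obtain i j where "i \<in> I" "j < d" "S $$ (i, j) \<noteq> 0" "i < n"
      using S subsets_of_sizeD(2) by (fastforce simp: rows_vanish_def)
    then show "I \<inter> T \<noteq> {}" by (auto simp: T_def)
  qed
  also have "\<dots> \<le> real (card T) * (real l / real n)" by (rule prob_hit_le[OF l T])
  also have "\<dots> \<le> real k * real \<beta> * (real l / real n)" by (intro mult_right_mono cT) auto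
  finally show ?thesis by simp
qed

text \<open>Conditioning on one draw: on its good outcomes the remaining draws fail with probability
  at most \<open>e\<close>. Failure probabilities thus add up along the program, although the
  selected sets depend on earlier draws.\<close>

lemma prob_bind_ge:
  assumes bad: "measure_pmf.prob p {x. \<not> G x} \<le> \<delta>" and e: "0 \<le> e"
    and good: "\<And>x. x \<in> set_pmf p \<Longrightarrow> G x \<Longrightarrow> 1 - e \<le> measure_pmf.prob (f x) S"
  shows "1 - (\<delta> + e) \<le> measure_pmf.prob (bind_pmf p f) S"
proof -
  have int1: "integrable (measure_pmf p) (\<lambda>x. indicator {x. \<not> G x} x :: real)"
    by (rule measure_pmf.integrable_const_bound[where B = 1]) (auto simp: indicator_def)
  have int2: "integrable (measure_pmf p) (\<lambda>x. measure_pmf.prob (f x) S)"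
    by (rule measure_pmf.integrable_const_bound[where B = 1]) auto
  have "1 - (\<delta> + e) \<le> (1 - e) - measure_pmf.prob p {x. \<not> G x}" using bad by simp
  also have "\<dots> = measure_pmf.expectation p (\<lambda>x. (1 - e) - indicator {x. \<not> G x} x)"
    using int1 by (simp add: measure_pmf.prob_space)
  also have "\<dots> \<le> measure_pmf.expectation p (\<lambda>x. measure_pmf.prob (f x) S)"
  proof (rule integral_mono_AE)
    \<comment> \<open>On bad outcomes the left-hand side is \<open>- e\<close>, which is below any
      probability.\<close>
    show "AE x in measure_pmf p. (1 - e) - indicator {x. \<not> G x} x \<le> measure_pmf.prob (f x) S"
      using good e by (auto simp: AE_measure_pmf_iff indicator_def intro: order_trans[of "- e" 0])
  qed (use int1 int2 in auto)
  also have "\<dots> = measure_pmf.prob (bind_pmf p f) S"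
    by (simp add: measure_pmf_bind measure_pmf.measure_bind[where N = "count_space UNIV"]
        measure_pmf_in_subprob_algebra measurable_def)
  finally show ?thesis .
qed

section \<open>Block matrices and low-rank factorizations\<close>

lemma zero_mat_mult_vec: "v \<in> carrier_vec q \<Longrightarrow> 0\<^sub>m p q *\<^sub>v v = 0\<^sub>v p"
  by (intro eq_vecI) auto

lemma mat_mult_zero_vec: "A \<in> carrier_mat p q \<Longrightarrow> A *\<^sub>v 0\<^sub>v q = (0\<^sub>v p :: real vec)"
  by (intro eq_vecI) auto

lemma append_cols_carrier:
  "A \<in> carrier_mat n p \<Longrightarrow> B \<in> carrier_mat n q \<Longrightarrow> append_cols A B \<in> carrier_mat n (p + q)"
  by (auto simp: append_cols_def)

lemma append_cols_mult:
  assumes A: "A \<in> carrier_mat n p" and B: "B \<in> carrier_mat n q"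
    and u: "u \<in> carrier_vec p" and w: "w \<in> carrier_vec q"
  shows "append_cols A B *\<^sub>v (u @\<^sub>v w) = A *\<^sub>v u + B *\<^sub>v w"
proof -
  have "append_cols A B *\<^sub>v (u @\<^sub>v w)
    = (A *\<^sub>v u + B *\<^sub>v w) @\<^sub>v (0\<^sub>m 0 p *\<^sub>v u + 0\<^sub>m 0 q *\<^sub>v w)"
    unfolding append_cols_def using A B
    by (simp add: four_block_mat_mult_vec[OF A B zero_carrier_mat zero_carrier_mat u w])
  then show ?thesis using A B u w by (intro eq_vecI) auto
qed

lemma append_cols_transpose_mult:
  assumes A: "A \<in> carrier_mat n p" and B: "B \<in> carrier_mat n q" and x: "x \<in> carrier_vec n"
  shows "transpose_mat (append_cols A B) *\<^sub>v x = (transpose_mat A *\<^sub>v x) @\<^sub>v (transpose_mat B *\<^sub>v x)"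
proof (rule eq_vecI)
  fix i assume "i < dim_vec ((transpose_mat A *\<^sub>v x) @\<^sub>v (transpose_mat B *\<^sub>v x))"
  then have i: "i < p + q" using A B by simp
  then have "(transpose_mat (append_cols A B) *\<^sub>v x) $ i = col (append_cols A B) i \<bullet> x"
    using append_cols_carrier[OF A B] by simp
  also have "col (append_cols A B) i = (if i < p then col A i else col B (i - p))"
    using A B i by (intro eq_vecI) (auto simp: append_cols_def)
  finally show "(transpose_mat (append_cols A B) *\<^sub>v x) $ i = ((transpose_mat A *\<^sub>v x) @\<^sub>v (transpose_mat B *\<^sub>v x)) $ i"
    using A B i by auto
qed (use A B append_cols_carrier[OF A B] in auto)

lemma vec_norm2_append:
  assumes "u \<in> carrier_vec p" "w \<in> carrier_vec q"
  shows "(vec_norm2 (u @\<^sub>v w))\<^sup>2 = (vec_norm2 u)\<^sup>2 + (vec_norm2 w)\<^sup>2"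
  unfolding vec_norm2_sq[symmetric] using scalar_prod_append[OF assms assms] .

lemma append_carrier: "u \<in> carrier_vec p \<Longrightarrow> w \<in> carrier_vec q \<Longrightarrow> u @\<^sub>v w \<in> carrier_vec (p + q)"
  by (rule carrier_vecI) simp

lemma vec_split:
  assumes "v \<in> carrier_vec (p + q)"
  obtains u w where "u \<in> carrier_vec p" "w \<in> carrier_vec q" "v = u @\<^sub>v w"
proof
  show "vec p (\<lambda>i. v $ i) \<in> carrier_vec p" "vec q (\<lambda>i. v $ (p + i)) \<in> carrier_vec q" by auto
  show "v = vec p (\<lambda>i. v $ i) @\<^sub>v vec q (\<lambda>i. v $ (p + i))" using assms by (intro eq_vecI) auto
qed

section \<open>The block diagonal core\<close>

lemma diag_block_mat_3:
  assumes Z: "Z1 \<in> carrier_mat k1 k1" "Z2 \<in> carrier_mat k2 k2" "Z3 \<in> carrier_mat k3 k3"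
  shows "diag_block_mat [Z1, Z2, Z3] = four_block_mat Z1 (0\<^sub>m k1 (k2 + k3)) (0\<^sub>m (k2 + k3) k1)
    (four_block_mat Z2 (0\<^sub>m k2 k3) (0\<^sub>m k3 k2) Z3)"
proof -
  have "four_block_mat Z3 (0\<^sub>m k3 0) (0\<^sub>m 0 k3) (0\<^sub>m 0 0) = Z3"
    by (rule eq_matI) (use Z in auto)
  then show ?thesis using Z by (simp add: Let_def)
qed

lemma diag_block_mat_3_carrier:
  assumes "Z1 \<in> carrier_mat k1 k1" "Z2 \<in> carrier_mat k2 k2" "Z3 \<in> carrier_mat k3 k3"
  shows "diag_block_mat [Z1, Z2, Z3] \<in> carrier_mat (k1 + (k2 + k3)) (k1 + (k2 + k3))"
  unfolding diag_block_mat_3[OF assms] using assms by (intro four_block_carrier_mat)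

lemma diag_block_mat_3_transpose:
  assumes Z: "Z1 \<in> carrier_mat k1 k1" "Z2 \<in> carrier_mat k2 k2" "Z3 \<in> carrier_mat k3 k3"
  shows "transpose_mat (diag_block_mat [Z1, Z2, Z3])
    = diag_block_mat [transpose_mat Z1, transpose_mat Z2, transpose_mat Z3]"
proof -
  have 23: "transpose_mat (four_block_mat Z2 (0\<^sub>m k2 k3) (0\<^sub>m k3 k2) Z3)
    = four_block_mat (transpose_mat Z2) (0\<^sub>m k2 k3) (0\<^sub>m k3 k2) (transpose_mat Z3)"
    using Z by (subst transpose_four_block_mat[of _ k2 k2 _ k3 _ k3]) auto
  have "transpose_mat (four_block_mat Z1 (0\<^sub>m k1 (k2 + k3)) (0\<^sub>m (k2 + k3) k1) (four_block_mat Z2 (0\<^sub>m k2 k3) (0\<^sub>m k3 k2) Z3))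
    = four_block_mat (transpose_mat Z1) (0\<^sub>m k1 (k2 + k3)) (0\<^sub>m (k2 + k3) k1)
      (transpose_mat (four_block_mat Z2 (0\<^sub>m k2 k3) (0\<^sub>m k3 k2) Z3))"
    using Z by (subst transpose_four_block_mat[of _ k1 k1 _ "k2 + k3" _ "k2 + k3"]) auto
  moreover have ZT: "transpose_mat Z1 \<in> carrier_mat k1 k1" "transpose_mat Z2 \<in> carrier_mat k2 k2"
    "transpose_mat Z3 \<in> carrier_mat k3 k3" using Z by auto
  ultimately show ?thesis unfolding diag_block_mat_3[OF Z] diag_block_mat_3[OF ZT] 23 by simp
qed

lemma diag_block_mat_3_mult:
  assumes Z: "Z1 \<in> carrier_mat k1 k1" "Z2 \<in> carrier_mat k2 k2" "Z3 \<in> carrier_mat k3 k3"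
    and w: "w1 \<in> carrier_vec k1" "w2 \<in> carrier_vec k2" "w3 \<in> carrier_vec k3"
  shows "diag_block_mat [Z1, Z2, Z3] *\<^sub>v (w1 @\<^sub>v (w2 @\<^sub>v w3)) = (Z1 *\<^sub>v w1) @\<^sub>v ((Z2 *\<^sub>v w2) @\<^sub>v (Z3 *\<^sub>v w3))"
proof -
  let ?D = "four_block_mat Z2 (0\<^sub>m k2 k3) (0\<^sub>m k3 k2) Z3"
  have D: "?D \<in> carrier_mat (k2 + k3) (k2 + k3)" using Z by simp
  have w23: "w2 @\<^sub>v w3 \<in> carrier_vec (k2 + k3)" by (rule append_carrier[OF w(2,3)])
  have c: "Z1 *\<^sub>v w1 \<in> carrier_vec k1" "Z2 *\<^sub>v w2 \<in> carrier_vec k2" "Z3 *\<^sub>v w3 \<in> carrier_vec k3" using Z w by auto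
  have 23: "?D *\<^sub>v (w2 @\<^sub>v w3) = (Z2 *\<^sub>v w2) @\<^sub>v (Z3 *\<^sub>v w3)"
    unfolding four_block_mat_mult_vec[OF Z(2) zero_carrier_mat zero_carrier_mat Z(3) w(2,3)]
    using w c by (simp add: zero_mat_mult_vec)
  have "four_block_mat Z1 (0\<^sub>m k1 (k2 + k3)) (0\<^sub>m (k2 + k3) k1) ?D *\<^sub>v (w1 @\<^sub>v (w2 @\<^sub>v w3))
    = (Z1 *\<^sub>v w1) @\<^sub>v ((Z2 *\<^sub>v w2) @\<^sub>v (Z3 *\<^sub>v w3))"
    unfolding four_block_mat_mult_vec[OF Z(1) zero_carrier_mat zero_carrier_mat D w(1) w23]
    using w w23 c append_carrier[OF c(2,3)] by (simp add: zero_mat_mult_vec 23)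
  then show ?thesis unfolding diag_block_mat_3[OF Z] .
qed

lemma append_orthonormal_norm_le:
  assumes A: "A \<in> carrier_mat n p" "transpose_mat A * A = 1\<^sub>m p"
    and B: "B \<in> carrier_mat n q" "transpose_mat B * B = 1\<^sub>m q"
    and u: "u \<in> carrier_vec p" and w: "w \<in> carrier_vec q"
  shows "(vec_norm2 (A *\<^sub>v u + B *\<^sub>v w))\<^sup>2 \<le> 2 * ((vec_norm2 u)\<^sup>2 + (vec_norm2 w)\<^sup>2)"
proof -
  have "vec_norm2 (A *\<^sub>v u + B *\<^sub>v w) \<le> vec_norm2 u + vec_norm2 w"
    using vec_norm2_triangle[OF mult_mat_vec_carrier[OF A(1) u] mult_mat_vec_carrier[OF B(1) w]]
    by (simp add: vec_norm2_orthonormal_mult[OF A u] vec_norm2_orthonormal_mult[OF B w])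
  then have "(vec_norm2 (A *\<^sub>v u + B *\<^sub>v w))\<^sup>2 \<le> (vec_norm2 u + vec_norm2 w)\<^sup>2"
    by (intro power_mono vec_norm2_nonneg)
  also have "\<dots> \<le> 2 * ((vec_norm2 u)\<^sup>2 + (vec_norm2 w)\<^sup>2)"
    using zero_le_power2[of "vec_norm2 u - vec_norm2 w"] by (simp add: power2_sum power2_diff)
  finally show ?thesis .
qed

text \<open>The rank yields \<open>k\<close> independent columns, that is \<open>B K = C\<close>
  with \<open>K\<close> a column selector and \<open>C\<close> injective. The left inverse
  \<open>pinv C\<close> bounds \<open>B\<close> below on the range of \<open>K\<close>, and
  \<open>sing_val_ge\<close> applies.\<close>

lemma sing_val_rank_pos:
  assumes B: "B \<in> carrier_mat n m" and rk: "vec_space.rank n B = k" and k: "1 \<le> k"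
  shows "0 < sing_val k B"
proof -
  interpret vec_space "TYPE(real)" n .
  have cols: "set (cols B) \<subseteq> carrier_vec n" using cols_dim B by blast
  obtain S where S: "maximal S (\<lambda>T. T \<subseteq> set (cols B) \<and> lin_indpt T)"
    using maximal_exists_superset[of "set (cols B)" "\<lambda>T. T \<subseteq> set (cols B) \<and> lin_indpt T" "{}"]
    by (metis List.finite_set empty_subsetI finite_lin_indpt2 finite.emptyI empty_iff)
  have cS: "card S = k" using rank_card_indpt[OF B S] rk by simp
  have Ssub: "S \<subseteq> set (cols B)" "lin_indpt S" using S by (auto simp: maximal_def)
  obtain vs where vs: "set vs = S" "distinct vs" using finite_distinct_list[of S] Ssub finite_subset by blast
  have len: "length vs = k" using distinct_card[OF vs(2)] vs(1) cS by simp
  have "\<exists>i. i < m \<and> vs ! j = col B i" if "j < k" for j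
  proof -
    have "vs ! j \<in> set (cols B)" using that vs Ssub len nth_mem by blast
    then show ?thesis using B by (auto simp: cols_def)
  qed
  then obtain idx where idx: "\<And>j. j < k \<Longrightarrow> idx j < m" "\<And>j. j < k \<Longrightarrow> vs ! j = col B (idx j)" by metis
  define K where "K = mat m k (\<lambda>(i, j). if i = idx j then 1 else (0::real))"
  have K: "K \<in> carrier_mat m k" by (simp add: K_def)
  define C where "C = mat_of_cols n vs"
  have C: "C \<in> carrier_mat n k" using mat_of_cols_carrier(1)[of n vs] unfolding C_def len .
  have vsn: "set vs \<subseteq> carrier_vec n" using vs Ssub cols by blast
  have colsC: "cols C = vs" unfolding C_def by (rule cols_mat_of_cols[OF vsn])
  have BK: "B * K = C"
  proof (rule eq_matI)
    fix i j assume "i < dim_row C" "j < dim_col C"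
    then have ij: "i < n" "j < k" using C by auto
    have "col K j = unit_vec m (idx j)" using ij idx(1)[OF ij(2)] by (intro eq_vecI) (auto simp: K_def)
    then have "(B * K) $$ (i, j) = B $$ (i, idx j)" using ij B K idx(1)[OF ij(2)] by simp
    also have "\<dots> = C $$ (i, j)" using ij B idx len by (simp add: C_def mat_of_cols_def)
    finally show "(B * K) $$ (i, j) = C $$ (i, j)" .
  qed (use B K C in auto)
  have Cinj: "z = 0\<^sub>v k" if z: "z \<in> carrier_vec k" "C *\<^sub>v z = 0\<^sub>v n" for z
    using lin_depI[OF C z(1) _ z(2)] vs Ssub(2) by (auto simp: colsC)
  \<comment> \<open>The summand 1 keeps \<open>N\<close> positive without a case
    distinction.\<close>
  define N where "N = spectral_norm K * spectral_norm (pinv C) + 1"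
  have N: "0 < N" using spectral_norm_nonneg[of K] spectral_norm_nonneg[of "pinv C"] by (simp add: N_def add_nonneg_pos)
  have "1 / N \<le> sing_val k B"
  proof (rule sing_val_ge[OF B K k])
    show "0 \<le> 1 / N" using N by simp
    fix z :: "real vec" assume z: "z \<in> carrier_vec k"
    have Cz: "C *\<^sub>v z = B *\<^sub>v (K *\<^sub>v z)" unfolding BK[symmetric] by (rule assoc_mult_mat_vec[OF B K z])
    have Czc: "C *\<^sub>v z \<in> carrier_vec n" using C z by simp
    show "K *\<^sub>v z \<noteq> 0\<^sub>v m" if "z \<noteq> 0\<^sub>v k"
      using that Cinj[OF z] Cz mat_mult_zero_vec[OF B] by auto
    have "vec_norm2 (K *\<^sub>v z) \<le> spectral_norm K * vec_norm2 z" by (rule spectral_norm_bound[OF K z])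
    also have "vec_norm2 z = vec_norm2 (pinv C *\<^sub>v (C *\<^sub>v z))" using pinv_left_inverse[OF C z Cinj] by simp
    also have "spectral_norm K * \<dots> \<le> spectral_norm K * (spectral_norm (pinv C) * vec_norm2 (C *\<^sub>v z))"
      by (intro mult_left_mono spectral_norm_bound[OF pinv_carrier[OF C] Czc] spectral_norm_nonneg)
    also have "\<dots> \<le> N * vec_norm2 (C *\<^sub>v z)" using vec_norm2_nonneg[of "C *\<^sub>v z"] by (simp add: N_def algebra_simps)
    finally show "1 / N * vec_norm2 (K *\<^sub>v z) \<le> vec_norm2 (B *\<^sub>v (K *\<^sub>v z))"
      using N by (simp add: Cz[symmetric] field_simps)
  qed
  then show ?thesis using N by (meson less_le_trans zero_less_divide_1_iff)
qed

text \<open>A square matrix and its transpose have the same smallest singular value. Concretely, the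
  bound makes \<open>N\<close> onto; with \<open>w = N z\<close>, pairing \<open>w\<close> with
  itself moves \<open>N\<close> across.\<close>

lemma square_lower_bound_transpose:
  fixes N :: "real mat"
  assumes N: "N \<in> carrier_mat k k" and c: "0 < c"
    and lower: "\<And>z. z \<in> carrier_vec k \<Longrightarrow> c * vec_norm2 z \<le> vec_norm2 (N *\<^sub>v z)"
    and w: "w \<in> carrier_vec k"
  shows "c * vec_norm2 w \<le> vec_norm2 (transpose_mat N *\<^sub>v w)"
proof -
  have "z = 0\<^sub>v k" if z: "z \<in> carrier_vec k" and N0: "N *\<^sub>v z = 0\<^sub>v k" for z
  proof -
    have "c * vec_norm2 z \<le> 0" using lower[OF z] by (simp add: N0)
    then have "vec_norm2 z = 0" using c vec_norm2_nonneg[of z] by (simp add: mult_le_0_iff)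
    then show ?thesis using vec_norm2_eq_0[OF z] by simp
  qed
  then obtain z where z: "z \<in> carrier_vec k" "N *\<^sub>v z = w" using injective_square_surj[OF N _ w] by metis
  have NT: "transpose_mat N *\<^sub>v w \<in> carrier_vec k" using N w by simp
  have "(vec_norm2 w)\<^sup>2 = (transpose_mat N *\<^sub>v w) \<bullet> z"
    using transpose_vec_mult_scalar[OF N z(1) w] by (simp add: vec_norm2_sq z(2))
  also have "\<dots> \<le> vec_norm2 (transpose_mat N *\<^sub>v w) * vec_norm2 z"
    using scalar_prod_cauchy_schwarz[OF NT z(1)] by simp
  finally have "c * (vec_norm2 w)\<^sup>2 \<le> vec_norm2 (transpose_mat N *\<^sub>v w) * (c * vec_norm2 z)" using c by simp
  also have "\<dots> \<le> vec_norm2 (transpose_mat N *\<^sub>v w) * vec_norm2 w"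
    using lower[OF z(1)] z(2) by (intro mult_left_mono vec_norm2_nonneg) simp
  finally have "vec_norm2 w * (c * vec_norm2 w) \<le> vec_norm2 w * vec_norm2 (transpose_mat N *\<^sub>v w)"
    by (simp add: power2_eq_square algebra_simps)
  then show ?thesis
    using vec_norm2_nonneg[of w] vec_norm2_nonneg[of "transpose_mat N *\<^sub>v w"]
    by (cases "vec_norm2 w = 0") (auto simp: mult_le_cancel_left)
qed

lemma square_lower_bound_surj:
  fixes N :: "real mat"
  assumes N: "N \<in> carrier_mat k k" and c: "0 < c"
    and lower: "\<And>z. z \<in> carrier_vec k \<Longrightarrow> c * vec_norm2 z \<le> vec_norm2 (N *\<^sub>v z)"
    and w: "w \<in> carrier_vec k"
  obtains z where "z \<in> carrier_vec k" "N *\<^sub>v z = w"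
proof -
  have "z = 0\<^sub>v k" if z: "z \<in> carrier_vec k" and N0: "N *\<^sub>v z = 0\<^sub>v k" for z
  proof -
    have "c * vec_norm2 z \<le> 0" using lower[OF z] by (simp add: N0)
    then have "vec_norm2 z = 0" using c vec_norm2_nonneg[of z] by (simp add: mult_le_0_iff)
    then show ?thesis using vec_norm2_eq_0[OF z] by simp
  qed
  then show ?thesis using injective_square_surj[OF N _ w] that by metis
qed

text \<open>The constant \<open>sqrt 2\<close> arises because \<open>X\<close> consists of two
  orthonormal groups, \<open>[X1 X2]\<close> and \<open>X3\<close>, that need not be orthogonal to
  each other; likewise \<open>Y\<close> with \<open>[Y1 Y3]\<close> and \<open>Y2\<close>.\<close>

locale low_rank_factorization =
  fixes n m k :: nat and X Z Y B :: "real mat"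
  assumes X: "X \<in> carrier_mat n k" and Z: "Z \<in> carrier_mat k k" and Y: "Y \<in> carrier_mat m k"
    and B: "B = X * Z * transpose_mat Y" and k: "1 \<le> k" and rank: "vec_space.rank n B = k"
    and X_le: "\<And>w. w \<in> carrier_vec k \<Longrightarrow> vec_norm2 (X *\<^sub>v w) \<le> sqrt 2 * vec_norm2 w"
    and Y_le: "\<And>w. w \<in> carrier_vec k \<Longrightarrow> vec_norm2 (Y *\<^sub>v w) \<le> sqrt 2 * vec_norm2 w"
begin

lemma transposes: "transpose_mat X \<in> carrier_mat k n" "transpose_mat Y \<in> carrier_mat k m" "transpose_mat Z \<in> carrier_mat k k"
  using X Y Z by auto

lemma B_carrier: "B \<in> carrier_mat n m"
  using X Z transposes by (simp add: B)

lemma B_mult: "x \<in> carrier_vec m \<Longrightarrow> B *\<^sub>v x = X *\<^sub>v (Z *\<^sub>v (transpose_mat Y *\<^sub>v x))"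
  unfolding B using assoc_mult_mat_vec[OF mult_carrier_mat[OF X Z] transposes(2)]
    assoc_mult_mat_vec[OF X Z mult_mat_vec_carrier[OF transposes(2)]] by simp

lemma k_le: "k \<le> m"
  using vec_space.rank_le_nc[OF B_carrier] rank by simp

lemma sing_val_pos: "0 < sing_val k B"
  by (rule sing_val_rank_pos[OF B_carrier rank k])

lemma subspace:
  obtains K where "K \<in> carrier_mat m k" "transpose_mat K * K = 1\<^sub>m k"
    "\<And>z. z \<in> carrier_vec k \<Longrightarrow> sing_val k B * vec_norm2 z \<le> vec_norm2 (B *\<^sub>v (K *\<^sub>v z))"
  using sing_val_subspace[OF B_carrier k k_le] by metis

lemma sing_val_le: "sing_val k B \<le> sing_val 1 B"
proof -
  obtain K where K: "K \<in> carrier_mat m k" "transpose_mat K * K = 1\<^sub>m k"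
    and Kz: "\<And>z. z \<in> carrier_vec k \<Longrightarrow> sing_val k B * vec_norm2 z \<le> vec_norm2 (B *\<^sub>v (K *\<^sub>v z))"
    using subspace by blast
  let ?z = "unit_vec k 0 :: real vec"
  have z: "?z \<in> carrier_vec k" by simp
  have pos: "0 < vec_norm2 ?z" using k by (intro vec_norm2_pos[of _ k]) auto
  have "sing_val k B * vec_norm2 ?z \<le> vec_norm2 (B *\<^sub>v (K *\<^sub>v ?z))" by (rule Kz[OF z])
  also have "\<dots> \<le> sing_val 1 B * vec_norm2 (K *\<^sub>v ?z)"
    using K by (intro norm_mult_le_sing_val[OF B_carrier]) simp
  also have "vec_norm2 (K *\<^sub>v ?z) = vec_norm2 ?z" by (rule vec_norm2_orthonormal_mult[OF K z])
  finally show ?thesis using pos by simp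
qed

text \<open>Restriction to the span of the \<open>k\<close> leading right singular vectors
  \<open>K\<close> makes the factors square: \<open>B K = X N\<close> with \<open>N = Z R\<close>
  and \<open>R = Y\<^sup>T K\<close>. The upper bound of \<open>X\<close> turns the bound of
  \<open>B\<close> into a lower bound of \<open>N\<close>; transposing \<open>N\<close> and dropping
  the contraction \<open>K\<^sup>T\<close> gives the claim for \<open>Y Z\<^sup>T\<close>. For
  \<open>X Z\<close>, one writes \<open>w = R z\<close> and uses the upper bound
  \<open>sqrt 2\<close> of \<open>R\<close>.\<close>

lemma factor_bounds:
  assumes w: "w \<in> carrier_vec k"
  shows "sing_val k B / sqrt 2 * vec_norm2 w \<le> vec_norm2 (Y *\<^sub>v (transpose_mat Z *\<^sub>v w))"
    "sing_val k B / sqrt 2 * vec_norm2 w \<le> vec_norm2 (X *\<^sub>v (Z *\<^sub>v w))"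
proof -
  let ?s = "sing_val k B"
  have s: "0 < ?s / sqrt 2" using sing_val_pos by simp
  obtain K where K: "K \<in> carrier_mat m k" "transpose_mat K * K = 1\<^sub>m k"
    and Kz: "\<And>z. z \<in> carrier_vec k \<Longrightarrow> ?s * vec_norm2 z \<le> vec_norm2 (B *\<^sub>v (K *\<^sub>v z))"
    using subspace by blast
  have KT: "transpose_mat K \<in> carrier_mat k m" using K by simp
  define R where "R = transpose_mat Y * K"
  have R: "R \<in> carrier_mat k k" using K Y by (simp add: R_def)
  have Rz: "R *\<^sub>v z = transpose_mat Y *\<^sub>v (K *\<^sub>v z)" if "z \<in> carrier_vec k" for z
    unfolding R_def by (rule assoc_mult_mat_vec[OF transposes(2) K(1) that])
  have BK: "B *\<^sub>v (K *\<^sub>v z) = X *\<^sub>v (Z *\<^sub>v (R *\<^sub>v z))" if z: "z \<in> carrier_vec k" for z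
    using B_mult[of "K *\<^sub>v z"] K z Rz[OF z] by simp
  have R_le: "vec_norm2 (R *\<^sub>v z) \<le> sqrt 2 * vec_norm2 z" if z: "z \<in> carrier_vec k" for z
    using adjoint_norm_le[OF Y Y_le, of "K *\<^sub>v z"] K z vec_norm2_orthonormal_mult[OF K z] by (simp add: Rz)
  define N where "N = Z * R"
  have N: "N \<in> carrier_mat k k" using Z R by (simp add: N_def)
  have Nz: "N *\<^sub>v z = Z *\<^sub>v (R *\<^sub>v z)" if "z \<in> carrier_vec k" for z
    unfolding N_def by (rule assoc_mult_mat_vec[OF Z R that])
  have N_ge: "?s / sqrt 2 * vec_norm2 z \<le> vec_norm2 (N *\<^sub>v z)" if z: "z \<in> carrier_vec k" for z
  proof -
    have "?s * vec_norm2 z \<le> sqrt 2 * vec_norm2 (N *\<^sub>v z)"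
      using Kz[OF z] X_le[of "N *\<^sub>v z"] N z unfolding BK[OF z] Nz[OF z, symmetric] by simp
    then show ?thesis by (simp add: field_simps)
  qed
  have "?s / sqrt 2 * vec_norm2 w \<le> vec_norm2 (transpose_mat N *\<^sub>v w)"
    by (rule square_lower_bound_transpose[OF N s N_ge w])
  also have "transpose_mat N *\<^sub>v w = transpose_mat K *\<^sub>v (Y *\<^sub>v (transpose_mat Z *\<^sub>v w))"
  proof -
    have "transpose_mat N = transpose_mat K * Y * transpose_mat Z"
      unfolding N_def R_def
      using transpose_mult[OF Z mult_carrier_mat[OF transposes(2) K(1)]] transpose_mult[OF transposes(2) K(1)] by simp
    then show ?thesis
      using assoc_mult_mat_vec[OF mult_carrier_mat[OF KT Y] transposes(3) w]
        assoc_mult_mat_vec[OF KT Y mult_mat_vec_carrier[OF transposes(3) w]] by simp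
  qed
  also have "vec_norm2 \<dots> \<le> 1 * vec_norm2 (Y *\<^sub>v (transpose_mat Z *\<^sub>v w))"
  proof (rule adjoint_norm_le[OF K(1)])
    show "Y *\<^sub>v (transpose_mat Z *\<^sub>v w) \<in> carrier_vec m" using Y transposes w by simp
  qed (auto simp: vec_norm2_orthonormal_mult[OF K])
  finally show "?s / sqrt 2 * vec_norm2 w \<le> vec_norm2 (Y *\<^sub>v (transpose_mat Z *\<^sub>v w))" by simp
  \<comment> \<open>This serves to show that \<open>R\<close> is onto, so a constant depending on
    \<open>Z\<close> is harmless and does not reach the conclusion.\<close>
  have R_ge: "?s / (sqrt 2 * (1 + spectral_norm Z)) * vec_norm2 z \<le> vec_norm2 (R *\<^sub>v z)" if z: "z \<in> carrier_vec k" for z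
  proof -
    have Rc: "R *\<^sub>v z \<in> carrier_vec k" using R z by simp
    have "?s / sqrt 2 * vec_norm2 z \<le> spectral_norm Z * vec_norm2 (R *\<^sub>v z)"
      using N_ge[OF z] spectral_norm_bound[OF Z Rc] unfolding Nz[OF z] by simp
    also have "\<dots> \<le> (1 + spectral_norm Z) * vec_norm2 (R *\<^sub>v z)"
      by (intro mult_right_mono vec_norm2_nonneg) simp
    finally have "?s / sqrt 2 * vec_norm2 z / (1 + spectral_norm Z)
      \<le> (1 + spectral_norm Z) * vec_norm2 (R *\<^sub>v z) / (1 + spectral_norm Z)"
      using spectral_norm_nonneg[of Z] by (intro divide_right_mono) auto
    also have "\<dots> = vec_norm2 (R *\<^sub>v z)"
      using spectral_norm_nonneg[of Z] by (intro nonzero_mult_div_cancel_left) auto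
    finally show ?thesis by simp
  qed
  have cpos: "0 < ?s / (sqrt 2 * (1 + spectral_norm Z))"
    using sing_val_pos spectral_norm_nonneg[of Z] by (simp add: add_pos_nonneg)
  obtain z where z: "z \<in> carrier_vec k" "R *\<^sub>v z = w"
    using square_lower_bound_surj[OF R cpos R_ge w] .
  have "?s / sqrt 2 * vec_norm2 w \<le> ?s / sqrt 2 * (sqrt 2 * vec_norm2 z)"
    using R_le[OF z(1)] s unfolding z(2) by (intro mult_left_mono) auto
  also have "\<dots> = ?s * vec_norm2 z" by simp
  also have "\<dots> \<le> vec_norm2 (X *\<^sub>v (Z *\<^sub>v w))" using Kz[OF z(1)] unfolding BK[OF z(1)] z(2) .
  finally show "?s / sqrt 2 * vec_norm2 w \<le> vec_norm2 (X *\<^sub>v (Z *\<^sub>v w))" .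
qed

text \<open>\<open>factor_bounds\<close> gives injectivity of \<open>X Z\<close>; for
  \<open>X\<close> itself \<open>Z\<close> has to be onto, which follows from its lower bound by
  half of the singular value. The same holds with \<open>Z\<^sup>T\<close> for
  \<open>Y\<close>.\<close>

lemma X_injective: "w \<in> carrier_vec k \<Longrightarrow> X *\<^sub>v w = 0\<^sub>v n \<Longrightarrow> w = 0\<^sub>v k"
  and Y_injective: "w \<in> carrier_vec k \<Longrightarrow> Y *\<^sub>v w = 0\<^sub>v m \<Longrightarrow> w = 0\<^sub>v k"
proof -
  let ?s = "sing_val k B"
  have s: "0 < ?s / 2" using sing_val_pos by simp
  have half: "?s / 2 * a \<le> c / sqrt 2" if "?s / sqrt 2 * a \<le> c" for a c :: real
  proof -
    have "?s / sqrt 2 * a / sqrt 2 \<le> c / sqrt 2" using that by (intro divide_right_mono) auto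
    then show ?thesis by simp
  qed
  have half': "c / sqrt 2 \<le> a" if "c \<le> sqrt 2 * a" for a c :: real
    using that by (simp add: field_simps)
  have Z_ge: "?s / 2 * vec_norm2 z \<le> vec_norm2 (Z *\<^sub>v z)" if z: "z \<in> carrier_vec k" for z
    by (rule order_trans[OF half[OF factor_bounds(2)[OF z]] half'[OF X_le[OF mult_mat_vec_carrier[OF Z z]]]])
  have ZT_ge: "?s / 2 * vec_norm2 z \<le> vec_norm2 (transpose_mat Z *\<^sub>v z)" if z: "z \<in> carrier_vec k" for z
    by (rule order_trans[OF half[OF factor_bounds(1)[OF z]] half'[OF Y_le[OF mult_mat_vec_carrier[OF transposes(3) z]]]])
  show "w = 0\<^sub>v k" if w: "w \<in> carrier_vec k" "X *\<^sub>v w = 0\<^sub>v n"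
  proof -
    obtain z where z: "z \<in> carrier_vec k" "Z *\<^sub>v z = w" using square_lower_bound_surj[OF Z s Z_ge w(1)] .
    have "?s / sqrt 2 * vec_norm2 z \<le> 0" using factor_bounds(2)[OF z(1)] by (simp add: z(2) w(2))
    then have "vec_norm2 z = 0" using sing_val_pos vec_norm2_nonneg[of z] by (simp add: mult_le_0_iff divide_le_0_iff)
    then have "z = 0\<^sub>v k" using vec_norm2_eq_0[OF z(1)] by simp
    then show ?thesis using z(2) mat_mult_zero_vec[OF Z] by simp
  qed
  show "w = 0\<^sub>v k" if w: "w \<in> carrier_vec k" "Y *\<^sub>v w = 0\<^sub>v m"
  proof -
    obtain z where z: "z \<in> carrier_vec k" "transpose_mat Z *\<^sub>v z = w"
      using square_lower_bound_surj[OF transposes(3) s ZT_ge w(1)] .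
    have "?s / sqrt 2 * vec_norm2 z \<le> 0" using factor_bounds(1)[OF z(1)] by (simp add: z(2) w(2))
    then have "vec_norm2 z = 0" using sing_val_pos vec_norm2_nonneg[of z] by (simp add: mult_le_0_iff divide_le_0_iff)
    then have "z = 0\<^sub>v k" using vec_norm2_eq_0[OF z(1)] by simp
    then show ?thesis using z(2) mat_mult_zero_vec[OF transposes(3)] by simp
  qed
qed

lemma pinv_bounds:
  assumes w: "w \<in> carrier_vec k"
  shows "vec_norm2 w \<le> spectral_norm (pinv X) * vec_norm2 (X *\<^sub>v w)"
    "vec_norm2 w \<le> spectral_norm (pinv Y) * vec_norm2 (Y *\<^sub>v w)"
  using pinv_left_inverse[OF X w X_injective] pinv_left_inverse[OF Y w Y_injective]
    spectral_norm_bound[OF pinv_carrier[OF X] mult_mat_vec_carrier[OF X w]]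
    spectral_norm_bound[OF pinv_carrier[OF Y] mult_mat_vec_carrier[OF Y w]] by auto

text \<open>Evaluation at a unit vector. It lets additive constants be absorbed into a multiple of
  the pseudoinverse norm in the final bound.\<close>

lemma pinv_norm_ge: "1 \<le> sqrt 2 * spectral_norm (pinv X)" "1 \<le> sqrt 2 * spectral_norm (pinv Y)"
proof -
  let ?w = "unit_vec k 0 :: real vec"
  have w: "?w \<in> carrier_vec k" by simp
  have pos: "0 < vec_norm2 ?w" using k by (intro vec_norm2_pos[of _ k]) auto
  have "1 * vec_norm2 ?w \<le> (sqrt 2 * spectral_norm (pinv X)) * vec_norm2 ?w"
    using pinv_bounds(1)[OF w] mult_left_mono[OF X_le[OF w] spectral_norm_nonneg[of "pinv X"]] by (simp add: mult_ac)
  then show "1 \<le> sqrt 2 * spectral_norm (pinv X)" using pos mult_le_cancel_right_pos by blast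
  have "1 * vec_norm2 ?w \<le> (sqrt 2 * spectral_norm (pinv Y)) * vec_norm2 ?w"
    using pinv_bounds(2)[OF w] mult_left_mono[OF Y_le[OF w] spectral_norm_nonneg[of "pinv Y"]] by (simp add: mult_ac)
  then show "1 \<le> sqrt 2 * spectral_norm (pinv Y)" using pos mult_le_cancel_right_pos by blast
qed

text \<open>\<open>Z Y\<^sup>T = X\<^sup>\<dagger> B\<close>, and transposed
  \<open>Z\<^sup>T X\<^sup>T = Y\<^sup>\<dagger> B\<^sup>T\<close>. This is where the pseudoinverse
  norms and the largest singular value enter the final bound.\<close>

lemma core_bounds:
  shows "x \<in> carrier_vec m \<Longrightarrow> vec_norm2 (Z *\<^sub>v (transpose_mat Y *\<^sub>v x)) \<le> spectral_norm (pinv X) * sing_val 1 B * vec_norm2 x"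
    and "y \<in> carrier_vec n \<Longrightarrow> vec_norm2 (transpose_mat Z *\<^sub>v (transpose_mat X *\<^sub>v y)) \<le> spectral_norm (pinv Y) * sing_val 1 B * vec_norm2 y"
proof -
  assume x: "x \<in> carrier_vec m"
  have c: "Z *\<^sub>v (transpose_mat Y *\<^sub>v x) \<in> carrier_vec k" using Z transposes x by simp
  show "vec_norm2 (Z *\<^sub>v (transpose_mat Y *\<^sub>v x)) \<le> spectral_norm (pinv X) * sing_val 1 B * vec_norm2 x"
    using pinv_bounds(1)[OF c] mult_left_mono[OF norm_mult_le_sing_val[OF B_carrier x] spectral_norm_nonneg[of "pinv X"]]
    by (simp add: B_mult[OF x] mult.assoc)
next
  assume y: "y \<in> carrier_vec n"
  have c: "transpose_mat Z *\<^sub>v (transpose_mat X *\<^sub>v y) \<in> carrier_vec k" using transposes y by simp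
  have BT: "transpose_mat B = Y * (transpose_mat Z * transpose_mat X)"
    unfolding B using transpose_mult[OF mult_carrier_mat[OF X Z] transposes(2)] transpose_mult[OF X Z] by simp
  have e: "transpose_mat B *\<^sub>v y = Y *\<^sub>v (transpose_mat Z *\<^sub>v (transpose_mat X *\<^sub>v y))"
    unfolding BT using assoc_mult_mat_vec[OF Y mult_carrier_mat[OF transposes(3,1)] y] assoc_mult_mat_vec[OF transposes(3,1) y] by simp
  have "vec_norm2 (transpose_mat B *\<^sub>v y) \<le> sing_val 1 B * vec_norm2 y"
    by (rule adjoint_norm_le[OF B_carrier norm_mult_le_sing_val[OF B_carrier] sing_val_nonneg y])
  then show "vec_norm2 (transpose_mat Z *\<^sub>v (transpose_mat X *\<^sub>v y)) \<le> spectral_norm (pinv Y) * sing_val 1 B * vec_norm2 y"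
    using pinv_bounds(2)[OF c] mult_left_mono[OF _ spectral_norm_nonneg[of "pinv Y"]] unfolding e
    by (smt (verit) mult.assoc)
qed

end

section \<open>The one-sided error bound\<close>

lemma srrqr_selects_card:
  assumes "srrqr_selects M k J"
  shows "J \<subseteq> {..<dim_col M}" "card J = k"
proof -
  obtain \<pi> Q Ar Br Cr where S: "is_srrqr M k \<pi> Q Ar Br Cr" and J: "J = \<pi> ` {..<k}"
    using assms unfolding srrqr_selects_def by auto
  have km: "k \<le> dim_col M" and perm: "\<pi> permutes {..<dim_col M}"
    using S unfolding is_srrqr_def Let_def by auto
  show "J \<subseteq> {..<dim_col M}" using permutes_in_image[OF perm] km unfolding J by force
  show "card J = k" unfolding J
    using card_image[OF inj_on_subset[OF permutes_inj_on[OF perm, of UNIV]]] by simp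
qed

text \<open>Only \<open>k\<close> rows of \<open>V\<close> matter, each with at most
  \<open>k\<close> entries of modulus at most \<open>sqrt (\<mu> / m)\<close>; the Frobenius norm of
  this block is at most \<open>k * sqrt (\<mu> / m)\<close>.\<close>

lemma coherent_few_rows:
  assumes V: "V \<in> carrier_mat m r" and coh: "coherent \<mu> V" and rk: "r \<le> k" and \<mu>: "0 \<le> \<mu>"
    and J: "J \<subseteq> {..<m}" "card J = k" and v: "v \<in> carrier_vec m" "\<forall>i<m. i \<notin> J \<longrightarrow> v $ i = 0"
  shows "vec_norm2 (transpose_mat V *\<^sub>v v) \<le> real k * sqrt (\<mu> / real m) * vec_norm2 v"
proof (rule power2_le_imp_le)
  have fin: "finite J" using J finite_subset by blast
  have VT: "transpose_mat V *\<^sub>v v \<in> carrier_vec r" using V v by simp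
  have entry: "((transpose_mat V *\<^sub>v v) $ j)\<^sup>2 \<le> real k * (\<mu> / real m) * (vec_norm2 v)\<^sup>2" if j: "j < r" for j
  proof -
    have "(transpose_mat V *\<^sub>v v) $ j = (\<Sum>i<m. V $$ (i, j) * v $ i)"
      using V v j by (simp add: scalar_prod_def atLeast0LessThan)
    also have "\<dots> = (\<Sum>i\<in>J. V $$ (i, j) * v $ i)"
      using J v by (intro sum.mono_neutral_right) auto
    finally have "((transpose_mat V *\<^sub>v v) $ j)\<^sup>2 \<le> (\<Sum>i\<in>J. (V $$ (i, j))\<^sup>2) * (\<Sum>i\<in>J. (v $ i)\<^sup>2)"
      using Cauchy_Schwarz_ineq_sum[of "\<lambda>i. V $$ (i, j)" "\<lambda>i. v $ i" J] by simp
    also have "\<dots> \<le> (\<Sum>i\<in>J. \<mu> / real m) * (\<Sum>i<m. (v $ i)\<^sup>2)"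
      using J j \<mu> by (intro mult_mono sum_mono coherent_entry[OF V coh] sum_mono2 sum_nonneg) auto
    also have "\<dots> = real k * (\<mu> / real m) * (vec_norm2 v)\<^sup>2"
      using J v by (simp add: vec_norm2_sum)
    finally show ?thesis .
  qed
  have "(vec_norm2 (transpose_mat V *\<^sub>v v))\<^sup>2 \<le> (\<Sum>j<r. real k * (\<mu> / real m) * (vec_norm2 v)\<^sup>2)"
    unfolding vec_norm2_sum[OF VT] by (intro sum_mono entry) auto
  also have "\<dots> = real r * (real k * (\<mu> / real m) * (vec_norm2 v)\<^sup>2)" by simp
  also have "\<dots> \<le> real k * (real k * (\<mu> / real m) * (vec_norm2 v)\<^sup>2)"
    using rk \<mu> by (intro mult_right_mono) auto
  also have "\<dots> = (real k * sqrt (\<mu> / real m) * vec_norm2 v)\<^sup>2"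
    using \<mu> by (simp add: power_mult_distrib power2_eq_square[of "real k"])
  finally show "(vec_norm2 (transpose_mat V *\<^sub>v v))\<^sup>2 \<le> (real k * sqrt (\<mu> / real m) * vec_norm2 v)\<^sup>2" .
qed (use \<mu> vec_norm2_nonneg in auto)

text \<open>Origin of 460: \<open>sqrt 990\<close> from the two sampling bounds,
  \<open>sqrt 2\<close> from \<open>s / sqrt 2\<close> and the 2 in \<open>\<omega>\<close> multiply
  to at most 90; the factor with \<open>\<kappa>\<close> is at most \<open>5 * sqrt (n / l)\<close>,
  and \<open>sqrt (n / l) * sqrt (m * k)\<close> is the announced root, which makes 450. The other
  summands are at most 5 times that root and turn into at most 10 by
  \<open>1 \<le> sqrt 2 * \<xi>\<close>.\<close>

lemma error_constant:
  fixes n m k l \<alpha> \<mu> s s1 \<xi> \<epsilon> \<kappa> :: real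
  assumes pos: "1 \<le> n" "1 \<le> m" "1 \<le> k" "0 < l" "l \<le> n" "l \<le> m" "0 < s" "s \<le> s1" "0 \<le> \<epsilon>"
    and \<xi>: "1 \<le> sqrt 2 * \<xi>"
    and \<kappa>: "0 \<le> \<kappa>" "\<kappa> / sqrt (l / (10 * m)) \<le> 4 * sqrt (n / l)"
  shows "\<epsilon> * ((1 + \<kappa> / sqrt (l / (10 * m)))
      * (2 * sqrt (m * k) * sqrt (99 * l / n) * (\<xi> * s1) / (sqrt (l / (10 * n)) * (s / sqrt 2)))
      + 1 / sqrt (l / (10 * m)) + 1) \<le> 460 * \<epsilon> * sqrt (n * m * k / l) * (s1 / s) * \<xi>"
proof -
  define t where "t = \<xi> * (s1 / s)"
  have \<xi>0: "0 < \<xi>"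
    by (rule ccontr) (use \<xi> mult_nonneg_nonpos[of "sqrt 2" \<xi>] in simp)
  have t1: "1 \<le> sqrt 2 * t"
  proof -
    have "1 \<le> s1 / s" using pos by simp
    then have "sqrt 2 * \<xi> * 1 \<le> sqrt 2 * \<xi> * (s1 / s)" using \<xi>0 by (intro mult_left_mono) auto
    then show ?thesis using \<xi> by (simp add: t_def)
  qed
  have sqrt2: "sqrt 2 \<le> (3 / 2 :: real)" by (rule real_le_lsqrt) (auto simp: power2_eq_square)
  have t0: "0 < t" using \<xi>0 pos by (simp add: t_def)
  have "sqrt 2 * t \<le> 3 / 2 * t" by (rule mult_right_mono[OF sqrt2]) (use t0 in simp)
  then have t32: "1 \<le> 3 / 2 * t" using t1 by linarith
  define S where "S = sqrt (n * m * k / l)"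
  define \<omega> where "\<omega> = 2 * sqrt (m * k) * sqrt (99 * l / n) * (\<xi> * s1) / (sqrt (l / (10 * n)) * (s / sqrt 2))"
  have nl: "1 \<le> sqrt (n / l)" using pos by simp
  have mS: "sqrt (m / l) \<le> S"
  proof -
    have "1 * 1 \<le> n * k" using pos by (intro mult_mono) auto
    then have "m * 1 \<le> m * (n * k)" using pos by (intro mult_left_mono) auto
    then have "m / l \<le> n * m * k / l" using pos by (intro divide_right_mono) (auto simp: mult_ac)
    then show ?thesis by (simp add: S_def)
  qed
  have S1: "1 \<le> S"
  proof -
    have "1 \<le> sqrt (m / l)" using pos by simp
    then show ?thesis using mS by linarith
  qed
  have \<omega>_le: "\<omega> \<le> 90 * sqrt (m * k) * t"
  proof -
    have q: "0 < sqrt (l / (10 * n))" using pos by simp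
    have "99 * l / n = 990 * (l / (10 * n))" using pos by (simp add: field_simps)
    then have e: "sqrt (99 * l / n) = sqrt 990 * sqrt (l / (10 * n))" by (simp only: real_sqrt_mult)
    have "\<omega> = 2 * sqrt (m * k) * (sqrt 990 * sqrt 2) * t"
      unfolding \<omega>_def e t_def using q pos by (simp add: field_simps)
    also have "sqrt 990 * sqrt 2 = sqrt (1980::real)" by (simp add: real_sqrt_mult[symmetric])
    also have "2 * sqrt (m * k) * sqrt 1980 * t \<le> 2 * sqrt (m * k) * 45 * t"
      using t0 pos by (intro mult_right_mono mult_left_mono real_le_lsqrt) auto
    finally show ?thesis by simp
  qed
  have "(1 + \<kappa> / sqrt (l / (10 * m))) * \<omega> \<le> (5 * sqrt (n / l)) * (90 * sqrt (m * k) * t)"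
  proof (rule mult_mono)
    show "1 + \<kappa> / sqrt (l / (10 * m)) \<le> 5 * sqrt (n / l)" using \<kappa>(2) nl by linarith
    show "0 \<le> \<omega>" using pos \<xi>0 by (simp add: \<omega>_def)
  qed (use \<omega>_le pos in auto)
  also have "\<dots> = 450 * (sqrt (n / l) * sqrt (m * k)) * t" by simp
  also have "sqrt (n / l) * sqrt (m * k) = S"
    unfolding S_def real_sqrt_mult[symmetric] by (simp add: mult_ac)
  finally have 1: "(1 + \<kappa> / sqrt (l / (10 * m))) * \<omega> \<le> 450 * S * t" .
  have 2: "1 / sqrt (l / (10 * m)) \<le> 4 * S"
  proof -
    have "1 / sqrt (l / (10 * m)) = sqrt 10 * sqrt (m / l)"
      unfolding real_sqrt_mult[symmetric] by (simp add: real_sqrt_divide)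
    also have "\<dots> \<le> 4 * sqrt (m / l)" using pos by (intro mult_right_mono real_le_lsqrt) auto
    finally show ?thesis using mS by simp
  qed
  have "S * 1 \<le> S * (3 / 2 * t)" using t32 S1 by (intro mult_left_mono) auto
  then have "S \<le> 3 / 2 * (S * t)" by (simp only: mult_1_right mult.left_commute)
  then have "(1 + \<kappa> / sqrt (l / (10 * m))) * \<omega> + 1 / sqrt (l / (10 * m)) + 1 \<le> 460 * S * t"
    using 1 2 S1 unfolding mult.assoc by linarith
  then have "\<epsilon> * ((1 + \<kappa> / sqrt (l / (10 * m))) * \<omega> + 1 / sqrt (l / (10 * m)) + 1) \<le> \<epsilon> * (460 * S * t)"
    using pos by (intro mult_left_mono) auto
  also have "\<dots> = 460 * \<epsilon> * S * (s1 / s) * \<xi>" by (simp add: t_def mult_ac)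
  finally show ?thesis unfolding \<omega>_def S_def .
qed

text \<open>The factors enter through matrix-vector identities and pointwise bounds, and
  \<open>P\<close> is an abstract contraction that kills the selected columns; in this form the row
  side is a second instance of the same statement.\<close>

lemma one_sided_error:
  fixes n m k k1 k2 k3 l :: nat
  assumes X: "X1 \<in> carrier_mat n k1" "X2 \<in> carrier_mat n k2" "X3 \<in> carrier_mat n k3"
    and Y: "Y1 \<in> carrier_mat m k1" "Y2 \<in> carrier_mat m k2" "Y3 \<in> carrier_mat m k3"
    and Z: "Z1 \<in> carrier_mat k1 k1" "Z2 \<in> carrier_mat k2 k2" "Z3 \<in> carrier_mat k3 k3"
    and AE: "A \<in> carrier_mat n m" "E \<in> carrier_mat n m"
    and ksum: "k1 + k2 + k3 = k" and k: "1 \<le> k" "k \<le> m"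
    and A_eq: "\<And>x. x \<in> carrier_vec m \<Longrightarrow> A *\<^sub>v x = X1 *\<^sub>v (Z1 *\<^sub>v (transpose_mat Y1 *\<^sub>v x))
      + X2 *\<^sub>v (Z2 *\<^sub>v (transpose_mat Y2 *\<^sub>v x)) + X3 *\<^sub>v (Z3 *\<^sub>v (transpose_mat Y3 *\<^sub>v x)) + E *\<^sub>v x"
    and E_le: "\<And>x. x \<in> carrier_vec m \<Longrightarrow> vec_norm2 (E *\<^sub>v x) \<le> \<epsilon> * vec_norm2 x"
    and lower: "\<And>w1 w2. w1 \<in> carrier_vec k1 \<Longrightarrow> w2 \<in> carrier_vec k2 \<Longrightarrow>
      s / sqrt 2 * vec_norm2 (w1 @\<^sub>v w2)
        \<le> vec_norm2 (Y1 *\<^sub>v (transpose_mat Z1 *\<^sub>v w1) + Y2 *\<^sub>v (transpose_mat Z2 *\<^sub>v w2))"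
    and upper: "\<And>x. x \<in> carrier_vec m \<Longrightarrow>
      vec_norm2 ((Z1 *\<^sub>v (transpose_mat Y1 *\<^sub>v x)) @\<^sub>v (Z2 *\<^sub>v (transpose_mat Y2 *\<^sub>v x))) \<le> \<xi> * s1 * vec_norm2 x"
    and coh: "coherent \<mu> (append_cols Y1 Y3)"
    and I: "I \<subseteq> {..<n}" "sample_lower n l (append_cols X1 X2) I" "sample_upper n l (append_cols X1 X2) I"
      "rows_vanish X3 I"
    and Jb: "Jb \<subseteq> {..<m}" "sample_lower m l (append_cols Y1 Y3) Jb" "rows_vanish Y2 Jb"
    and sel: "srrqr_selects (row_submat A I) k J"
    and P: "P \<in> carrier_mat n n" "\<And>y. y \<in> carrier_vec n \<Longrightarrow> vec_norm2 (P *\<^sub>v y) \<le> vec_norm2 y"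
      "\<And>v. v \<in> carrier_vec m \<Longrightarrow> \<forall>i<m. i \<notin> J \<union> Jb \<longrightarrow> v $ i = 0 \<Longrightarrow> P *\<^sub>v (A *\<^sub>v v) = 0\<^sub>v n"
    and l: "real l = \<alpha> * \<mu> * real k" "l \<le> n" "l \<le> m" "0 < l" and \<alpha>: "1 \<le> \<alpha>"
    and kl: "k3 \<noteq> 0 \<Longrightarrow> k * l \<le> n"
    and s: "0 < s" "s \<le> s1" and \<xi>: "1 \<le> sqrt 2 * \<xi>" and \<epsilon>: "0 \<le> \<epsilon>"
    and gap: "\<epsilon> * sqrt (real n * real m * real k / real l) \<le> 1 / 20 * s"
    and x: "x \<in> carrier_vec m"
  shows "vec_norm2 (P *\<^sub>v (A *\<^sub>v x)) \<le> 460 * \<epsilon> * sqrt (real n * real m * real k / real l) * (s1 / s) * \<xi> * vec_norm2 x"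
proof -
  have n: "0 < n" and m: "0 < m" using l(2-4) by auto
  have \<xi>0: "0 < \<xi>"
    by (rule ccontr) (use \<xi> mult_nonneg_nonpos[of "sqrt 2" \<xi>] in simp)
  define U where "U = append_cols X1 X2"
  define V where "V = append_cols Y1 Y3"
  \<comment> \<open>\<open>D\<close> and \<open>V\<close> regroup blocks one and three, which the
    columns \<open>Jb\<close> reproduce; \<open>G\<close> below is block two, which vanishes on
    vectors supported on \<open>Jb\<close>.\<close>
  define D where "D = append_cols (X1 * Z1) (X3 * Z3)"
  define F where "F = mat (k1 + k2) m (\<lambda>(i, j). if i < k1 then (Z1 * transpose_mat Y1) $$ (i, j) else (Z2 * transpose_mat Y2) $$ (i - k1, j))"
  define B where "B = X3 * (Z3 * transpose_mat Y3)"
  define G where "G = X2 * (Z2 * transpose_mat Y2)"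
  have YT: "transpose_mat Y1 \<in> carrier_mat k1 m" "transpose_mat Y2 \<in> carrier_mat k2 m" "transpose_mat Y3 \<in> carrier_mat k3 m"
    using Y by auto
  have ZT: "transpose_mat Z1 \<in> carrier_mat k1 k1" "transpose_mat Z2 \<in> carrier_mat k2 k2" using Z by auto
  have U: "U \<in> carrier_mat n (k1 + k2)" unfolding U_def by (rule append_cols_carrier[OF X(1,2)])
  have V: "V \<in> carrier_mat m (k1 + k3)" unfolding V_def by (rule append_cols_carrier[OF Y(1,3)])
  have XZ: "X1 * Z1 \<in> carrier_mat n k1" "X3 * Z3 \<in> carrier_mat n k3" using X Z by auto
  have D: "D \<in> carrier_mat n (k1 + k3)" unfolding D_def by (rule append_cols_carrier[OF XZ])
  have F: "F \<in> carrier_mat (k1 + k2) m" by (simp add: F_def)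
  have FT: "transpose_mat F \<in> carrier_mat m (k1 + k2)" using F by simp
  have B: "B \<in> carrier_mat n m" using X Z YT by (simp add: B_def)
  have G: "G \<in> carrier_mat n m" using X Z YT by (simp add: G_def)
  have Yx: "transpose_mat Y1 *\<^sub>v y \<in> carrier_vec k1" "transpose_mat Y2 *\<^sub>v y \<in> carrier_vec k2" "transpose_mat Y3 *\<^sub>v y \<in> carrier_vec k3"
    if "y \<in> carrier_vec m" for y using that YT by auto
  have ZYx: "Z1 *\<^sub>v (transpose_mat Y1 *\<^sub>v y) \<in> carrier_vec k1" "Z2 *\<^sub>v (transpose_mat Y2 *\<^sub>v y) \<in> carrier_vec k2"
    "Z3 *\<^sub>v (transpose_mat Y3 *\<^sub>v y) \<in> carrier_vec k3"
    if "y \<in> carrier_vec m" for y using Yx[OF that] Z by auto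
  have Fx: "F *\<^sub>v y = (Z1 *\<^sub>v (transpose_mat Y1 *\<^sub>v y)) @\<^sub>v (Z2 *\<^sub>v (transpose_mat Y2 *\<^sub>v y))" if y: "y \<in> carrier_vec m" for y
  proof (rule eq_vecI)
    fix i assume "i < dim_vec ((Z1 *\<^sub>v (transpose_mat Y1 *\<^sub>v y)) @\<^sub>v (Z2 *\<^sub>v (transpose_mat Y2 *\<^sub>v y)))"
    then have i: "i < k1 + k2" using Z by simp
    have "row F i = (if i < k1 then row (Z1 * transpose_mat Y1) i else row (Z2 * transpose_mat Y2) (i - k1))"
      using i Z YT by (intro eq_vecI) (auto simp: F_def)
    then have "(F *\<^sub>v y) $ i = (if i < k1 then ((Z1 * transpose_mat Y1) *\<^sub>v y) $ i else ((Z2 * transpose_mat Y2) *\<^sub>v y) $ (i - k1))"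
      using i F Z YT by simp
    then show "(F *\<^sub>v y) $ i = ((Z1 *\<^sub>v (transpose_mat Y1 *\<^sub>v y)) @\<^sub>v (Z2 *\<^sub>v (transpose_mat Y2 *\<^sub>v y))) $ i"
      using i Z assoc_mult_mat_vec[OF Z(1) YT(1) y] assoc_mult_mat_vec[OF Z(2) YT(2) y] by simp
  qed (use F Z in simp)
  have UFx: "U *\<^sub>v (F *\<^sub>v y) = X1 *\<^sub>v (Z1 *\<^sub>v (transpose_mat Y1 *\<^sub>v y)) + X2 *\<^sub>v (Z2 *\<^sub>v (transpose_mat Y2 *\<^sub>v y))"
    if y: "y \<in> carrier_vec m" for y
    unfolding Fx[OF y] U_def by (rule append_cols_mult[OF X(1,2) ZYx(1,2)[OF y]])
  have Bx: "B *\<^sub>v y = X3 *\<^sub>v (Z3 *\<^sub>v (transpose_mat Y3 *\<^sub>v y))" if y: "y \<in> carrier_vec m" for y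
    unfolding B_def using assoc_mult_mat_vec[OF X(3) mult_carrier_mat[OF Z(3) YT(3)] y] assoc_mult_mat_vec[OF Z(3) YT(3) y] by simp
  have Gx: "G *\<^sub>v y = X2 *\<^sub>v (Z2 *\<^sub>v (transpose_mat Y2 *\<^sub>v y))" if y: "y \<in> carrier_vec m" for y
    unfolding G_def using assoc_mult_mat_vec[OF X(2) mult_carrier_mat[OF Z(2) YT(2)] y] assoc_mult_mat_vec[OF Z(2) YT(2) y] by simp
  have Duw: "D *\<^sub>v (u @\<^sub>v w) = X1 *\<^sub>v (Z1 *\<^sub>v u) + X3 *\<^sub>v (Z3 *\<^sub>v w)"
    if "u \<in> carrier_vec k1" "w \<in> carrier_vec k3" for u w
    unfolding D_def append_cols_mult[OF XZ that]
    using assoc_mult_mat_vec[OF X(1) Z(1) that(1)] assoc_mult_mat_vec[OF X(3) Z(3) that(2)] by simp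
  have Vx: "transpose_mat V *\<^sub>v y = (transpose_mat Y1 *\<^sub>v y) @\<^sub>v (transpose_mat Y3 *\<^sub>v y)" if y: "y \<in> carrier_vec m" for y
    unfolding V_def by (rule append_cols_transpose_mult[OF Y(1,3) y])
  have cohV: "coherent \<mu> V" using coh by (simp add: V_def)
  have V_le: "vec_norm2 (transpose_mat V *\<^sub>v y) \<le> vec_norm2 y" if y: "y \<in> carrier_vec m" for y
    using adjoint_norm_le[OF V _ _ y, of 1] vec_norm2_orthonormal_mult[OF V coherent_orthonormal[OF V cohV]] by simp
  have Y3_le: "vec_norm2 (transpose_mat Y3 *\<^sub>v y) \<le> vec_norm2 (transpose_mat V *\<^sub>v y)" if y: "y \<in> carrier_vec m" for y
    using vec_norm2_append[OF Yx(1,3)[OF y]] by (intro power2_le_imp_le[OF _ vec_norm2_nonneg]) (simp add: Vx[OF y])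
  have BD0: "\<exists>z\<in>carrier_vec (k1 + k3). vec_norm2 z = vec_norm2 (transpose_mat Y3 *\<^sub>v y) \<and> B *\<^sub>v y = D *\<^sub>v z" if y: "y \<in> carrier_vec m" for y
  proof (intro bexI conjI)
    let ?z = "0\<^sub>v k1 @\<^sub>v (transpose_mat Y3 *\<^sub>v y)"
    show "?z \<in> carrier_vec (k1 + k3)" by (rule append_carrier[OF zero_carrier_vec Yx(3)[OF y]])
    have "(vec_norm2 ?z)\<^sup>2 = (vec_norm2 (transpose_mat Y3 *\<^sub>v y))\<^sup>2"
      using vec_norm2_append[OF zero_carrier_vec Yx(3)[OF y], of k1] by simp
    then show "vec_norm2 ?z = vec_norm2 (transpose_mat Y3 *\<^sub>v y)"
      by (rule power2_eq_imp_eq) (auto simp: vec_norm2_nonneg)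
    have c3: "X3 *\<^sub>v (Z3 *\<^sub>v (transpose_mat Y3 *\<^sub>v y)) \<in> carrier_vec n" using X ZYx(3)[OF y] by simp
    show "B *\<^sub>v y = D *\<^sub>v ?z"
      unfolding Duw[OF zero_carrier_vec Yx(3)[OF y]] Bx[OF y] mat_mult_zero_vec[OF Z(1)] mat_mult_zero_vec[OF X(1)]
      using c3 by simp
  qed
  have B0: "mask I (B *\<^sub>v y) = 0\<^sub>v n" if y: "y \<in> carrier_vec m" for y
  proof (rule eq_vecI)
    fix i assume "i < dim_vec (0\<^sub>v n :: real vec)"
    then have i: "i < n" by simp
    have "(B *\<^sub>v y) $ i = 0" if "i \<in> I"
    proof -
      have "row X3 i = 0\<^sub>v k3" using that I(4) i X by (intro eq_vecI) (auto simp: rows_vanish_def)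
      then show ?thesis unfolding Bx[OF y] using i X ZYx(3)[OF y] by simp
    qed
    then show "mask I (B *\<^sub>v y) $ i = (0\<^sub>v n :: real vec) $ i" using i B by (simp add: mask_def)
  qed (use B in \<open>simp add: mask_def\<close>)
  have G0: "G *\<^sub>v v = 0\<^sub>v n" if v: "v \<in> carrier_vec m" "\<forall>i<m. i \<notin> Jb \<longrightarrow> v $ i = 0" for v
  proof -
    have "transpose_mat Y2 *\<^sub>v v = 0\<^sub>v k2"
    proof (rule eq_vecI)
      fix j assume "j < dim_vec (0\<^sub>v k2 :: real vec)"
      then have j: "j < k2" by simp
      have "(\<Sum>i = 0..<m. Y2 $$ (i, j) * v $ i) = 0"
        using v(2) Jb(3) j Y by (intro sum.neutral) (auto simp: rows_vanish_def)
      then show "(transpose_mat Y2 *\<^sub>v v) $ j = (0\<^sub>v k2 :: real vec) $ j" using j Y v by (simp add: scalar_prod_def)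
    qed (use Y in simp)
    then show ?thesis unfolding Gx[OF v(1)] by (simp add: mat_mult_zero_vec[OF Z(2)] mat_mult_zero_vec[OF X(2)])
  qed
  have F_ge: "s / sqrt 2 * vec_norm2 w \<le> vec_norm2 (transpose_mat F *\<^sub>v w)" if w: "w \<in> carrier_vec (k1 + k2)" for w
  proof -
    obtain w1 w2 where w12: "w1 \<in> carrier_vec k1" "w2 \<in> carrier_vec k2" "w = w1 @\<^sub>v w2" using vec_split[OF w] .
    have c: "Y1 *\<^sub>v (transpose_mat Z1 *\<^sub>v w1) \<in> carrier_vec m" "Y2 *\<^sub>v (transpose_mat Z2 *\<^sub>v w2) \<in> carrier_vec m" using Y ZT w12 by auto
    let ?h = "Y1 *\<^sub>v (transpose_mat Z1 *\<^sub>v w1) + Y2 *\<^sub>v (transpose_mat Z2 *\<^sub>v w2)"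
    have h: "?h \<in> carrier_vec m" using c by simp
    have "transpose_mat F *\<^sub>v w = ?h"
    proof (rule eq_vecI)
      fix j assume "j < dim_vec ?h"
      then have j: "j < m" using Y by simp
      let ?e = "unit_vec m j :: real vec"
      have e: "?e \<in> carrier_vec m" by simp
      have "(transpose_mat F *\<^sub>v w) $ j = (transpose_mat F *\<^sub>v w) \<bullet> ?e" using j by simp
      also have "\<dots> = w \<bullet> (F *\<^sub>v ?e)" by (rule transpose_vec_mult_scalar[OF F e w])
      also have "\<dots> = w1 \<bullet> (Z1 *\<^sub>v (transpose_mat Y1 *\<^sub>v ?e)) + w2 \<bullet> (Z2 *\<^sub>v (transpose_mat Y2 *\<^sub>v ?e))"
        unfolding Fx[OF e] w12(3) by (rule scalar_prod_append[OF w12(1,2) ZYx(1,2)[OF e]])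
      also have "w1 \<bullet> (Z1 *\<^sub>v (transpose_mat Y1 *\<^sub>v ?e)) = (Y1 *\<^sub>v (transpose_mat Z1 *\<^sub>v w1)) \<bullet> ?e"
        using transpose_vec_mult_scalar[OF Z(1) Yx(1)[OF e] w12(1)]
          transpose_vec_mult_scalar[OF YT(1) e mult_mat_vec_carrier[OF ZT(1) w12(1)]] by simp
      also have "w2 \<bullet> (Z2 *\<^sub>v (transpose_mat Y2 *\<^sub>v ?e)) = (Y2 *\<^sub>v (transpose_mat Z2 *\<^sub>v w2)) \<bullet> ?e"
        using transpose_vec_mult_scalar[OF Z(2) Yx(2)[OF e] w12(2)]
          transpose_vec_mult_scalar[OF YT(2) e mult_mat_vec_carrier[OF ZT(2) w12(2)]] by simp
      also have "(Y1 *\<^sub>v (transpose_mat Z1 *\<^sub>v w1)) \<bullet> ?e + (Y2 *\<^sub>v (transpose_mat Z2 *\<^sub>v w2)) \<bullet> ?e = ?h $ j"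
        using j c Y by simp
      finally show "(transpose_mat F *\<^sub>v w) $ j = ?h $ j" .
    qed (use F Y in simp)
    then show ?thesis using lower[OF w12(1,2)] w12(3) by simp
  qed
  define a where "a = sqrt (real l / (10 * real n))"
  define a' where "a' = sqrt (99 * real l / real n)"
  define aj where "aj = sqrt (real l / (10 * real m))"
  define \<kappa> where "\<kappa> = (if k3 = 0 then 0 else real k * sqrt (\<mu> / real m))"
  have apos: "0 < a" "0 < aj" "0 \<le> a'" using l(4) n m by (auto simp: a_def aj_def a'_def)
  have dimU: "dim_col U = k1 + k2" and dimV: "dim_col V = k1 + k3" using U V by auto
  have \<mu>0: "0 \<le> \<mu>"
  proof (rule ccontr)
    assume "\<not> 0 \<le> \<mu>"
    then have "\<alpha> * \<mu> * real k \<le> 0" using \<alpha> by (simp add: mult_le_0_iff)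
    moreover have "0 < real l" using l(4) by simp
    ultimately show False using l(1) by linarith
  qed
  \<comment> \<open>Origin of the gap constant \<open>1 / 20\<close>: it turns the factor 4 into
    \<open>1 / 5\<close>, which is at most \<open>1 / sqrt 20\<close>, and \<open>sqrt 20\<close>
    collects \<open>sqrt 10\<close> from the sampling bound and \<open>sqrt 2\<close> from
    \<open>s / sqrt 2\<close>.\<close>
  have gap': "4 * sqrt (real m * real k) * \<epsilon> \<le> a * (s / sqrt 2)"
  proof -
    have ln: "0 < sqrt (real l / real n)" using l(4) n by simp
    have "real m * real k = (real n * real m * real k / real l) * (real l / real n)" using l(4) n by simp
    then have e: "sqrt (real m * real k) = sqrt (real n * real m * real k / real l) * sqrt (real l / real n)"
      by (metis real_sqrt_mult)
    have "4 * sqrt (real m * real k) * \<epsilon> = 4 * (\<epsilon> * sqrt (real n * real m * real k / real l)) * sqrt (real l / real n)"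
      unfolding e by simp
    also have "\<dots> \<le> 4 * (1 / 20 * s) * sqrt (real l / real n)" using gap ln by (intro mult_right_mono) auto
    also have "\<dots> = 1 / 5 * s * sqrt (real l / real n)" by simp
    also have "\<dots> \<le> (1 / sqrt 20) * s * sqrt (real l / real n)"
    proof (intro mult_right_mono)
      have "sqrt 20 \<le> (5::real)" by (rule real_le_lsqrt) auto
      then show "1 / 5 \<le> 1 / sqrt (20::real)" by (intro divide_left_mono) auto
    qed (use s ln in auto)
    also have "\<dots> = a * (s / sqrt 2)"
    proof -
      have "sqrt (20::real) = sqrt 10 * sqrt 2" by (simp add: real_sqrt_mult[symmetric])
      then show ?thesis by (simp add: a_def real_sqrt_divide real_sqrt_mult mult_ac)
    qed
    finally show ?thesis .
  qed
  interpret column_selection n m "k1 + k2" k A U F B E I J \<epsilon> a a' "s / sqrt 2" "\<xi> * s1"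
  proof
    show "A *\<^sub>v y = U *\<^sub>v (F *\<^sub>v y) + B *\<^sub>v y + E *\<^sub>v y" if "y \<in> carrier_vec m" for y
      unfolding UFx[OF that] Bx[OF that] by (rule A_eq[OF that])
    show "a * vec_norm2 u \<le> vec_norm2 (mask I (U *\<^sub>v u))" if "u \<in> carrier_vec (k1 + k2)" for u
      using I(2) that unfolding sample_lower_def a_def U_def[symmetric] dimU by blast
    show "vec_norm2 (mask I (U *\<^sub>v u)) \<le> a' * vec_norm2 u" if "u \<in> carrier_vec (k1 + k2)" for u
      using I(3) that unfolding sample_upper_def a'_def U_def[symmetric] dimU by blast
    show "vec_norm2 (F *\<^sub>v y) \<le> \<xi> * s1 * vec_norm2 y" if "y \<in> carrier_vec m" for y
      unfolding Fx[OF that] by (rule upper[OF that])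
    show "k1 + k2 \<le> k" using ksum by simp
    show "0 \<le> \<xi> * s1" using \<xi>0 s by simp
    show "0 < s / sqrt 2" using s by simp
  qed (use AE U F B E_le I(1) B0 F_ge apos \<epsilon> k sel gap' in auto)
  have Jsub: "J \<subseteq> {..<m}" "card J = k"
    using srrqr_selects_card[OF sel] row_submat_carrier[OF AE(1) I(1)] by auto
  have "vec_norm2 (P *\<^sub>v (A *\<^sub>v x)) \<le> \<epsilon> * ((1 + \<kappa> / aj) * \<omega> + 1 / aj + 1) * vec_norm2 x"
  proof (rule projection_error[OF P D V G _ Jb(1) apos(2) _ G0 _ _ _ x])
    show "A *\<^sub>v y = D *\<^sub>v (transpose_mat V *\<^sub>v y) + G *\<^sub>v y + E *\<^sub>v y" if y: "y \<in> carrier_vec m" for y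
    proof -
      have c: "X1 *\<^sub>v (Z1 *\<^sub>v (transpose_mat Y1 *\<^sub>v y)) \<in> carrier_vec n" "X2 *\<^sub>v (Z2 *\<^sub>v (transpose_mat Y2 *\<^sub>v y)) \<in> carrier_vec n"
        "X3 *\<^sub>v (Z3 *\<^sub>v (transpose_mat Y3 *\<^sub>v y)) \<in> carrier_vec n"
        using X ZYx[OF y] by auto
      have swap: "p + q + r = p + r + q" if "p \<in> carrier_vec n" "q \<in> carrier_vec n" "r \<in> carrier_vec n" for p q r :: "real vec"
        using that by (intro eq_vecI) auto
      show ?thesis
        unfolding A_eq[OF y] Vx[OF y] Duw[OF Yx(1,3)[OF y]] Gx[OF y] swap[OF c] ..
    qed
    show "aj * vec_norm2 u \<le> vec_norm2 (mask Jb (V *\<^sub>v u))" if "u \<in> carrier_vec (k1 + k3)" for u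
      using Jb(2) that unfolding sample_lower_def aj_def V_def[symmetric] dimV by blast
    show "\<exists>z\<in>carrier_vec (k1 + k3). vec_norm2 z \<le> vec_norm2 y \<and> B *\<^sub>v y = D *\<^sub>v z" if y: "y \<in> carrier_vec m" for y
      using BD0[OF y] order_trans[OF Y3_le[OF y] V_le[OF y]] by metis
    show "\<exists>z\<in>carrier_vec (k1 + k3). vec_norm2 z \<le> \<kappa> * vec_norm2 v \<and> B *\<^sub>v v = D *\<^sub>v z"
      if v: "v \<in> carrier_vec m" "\<forall>i<m. i \<notin> J \<longrightarrow> v $ i = 0" for v
    proof -
      have "vec_norm2 (transpose_mat Y3 *\<^sub>v v) \<le> \<kappa> * vec_norm2 v"
      proof (cases "k3 = 0")
        case True
        then show ?thesis using vec_norm2_dim_0 Yx(3)[OF v(1)] by (simp add: \<kappa>_def)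
      next
        case False
        have "vec_norm2 (transpose_mat V *\<^sub>v v) \<le> real k * sqrt (\<mu> / real m) * vec_norm2 v"
          using ksum by (intro coherent_few_rows[OF V cohV _ \<mu>0 Jsub v]) simp
        then show ?thesis using Y3_le[OF v(1)] False by (simp add: \<kappa>_def)
      qed
      then show ?thesis using BD0[OF v(1)] by metis
    qed
    show "0 \<le> \<kappa>" using \<mu>0 by (simp add: \<kappa>_def)
  qed
  also have "\<dots> \<le> 460 * \<epsilon> * sqrt (real n * real m * real k / real l) * (s1 / s) * \<xi> * vec_norm2 x"
  proof (rule mult_right_mono)
    have \<kappa>0: "0 \<le> \<kappa>" using \<mu>0 by (simp add: \<kappa>_def)
    have \<kappa>_le: "\<kappa> / sqrt (real l / (10 * real m)) \<le> 4 * sqrt (real n / real l)"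
    proof (cases "k3 = 0")
      case True
      then show ?thesis by (simp add: \<kappa>_def)
    next
      case False
      \<comment> \<open>\<open>\<alpha> \<ge> 1\<close> gives \<open>\<mu> k \<le> l\<close>, and
        \<open>k l \<le> n\<close> then bounds the square of the quotient by
        \<open>10 n / l\<close>.\<close>
      have "1 * (\<mu> * real k) \<le> \<alpha> * (\<mu> * real k)" using \<alpha> \<mu>0 by (intro mult_right_mono) auto
      then have "\<mu> * real k \<le> real l" unfolding l(1) by (simp add: mult.assoc)
      then have "real k * (\<mu> * real k) \<le> real k * real l" by (intro mult_left_mono) auto
      also have "\<dots> \<le> real n" using kl[OF False] by (metis of_nat_le_iff of_nat_mult)
      finally have kn: "real k * (\<mu> * real k) \<le> real n" .
      have "(\<kappa> / sqrt (real l / (10 * real m)))\<^sup>2 = 10 * (real k * (\<mu> * real k)) / real l"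
        using \<mu>0 m l(4) False by (simp add: \<kappa>_def power_divide power_mult_distrib) (simp add: power2_eq_square)
      also have "\<dots> \<le> 16 * real n / real l" by (intro divide_right_mono, use kn in linarith) simp
      also have "\<dots> = (4 * sqrt (real n / real l))\<^sup>2" by (simp add: power_mult_distrib)
      finally show ?thesis by (rule power2_le_imp_le) simp
    qed
    have pos: "1 \<le> real n" "1 \<le> real m" "1 \<le> real k" "0 < real l" "real l \<le> real n" "real l \<le> real m"
      using n m k l(2-4) by auto
    show "\<epsilon> * ((1 + \<kappa> / aj) * \<omega> + 1 / aj + 1)
        \<le> 460 * \<epsilon> * sqrt (real n * real m * real k / real l) * (s1 / s) * \<xi>"
      unfolding \<omega>_def unfolding a_def a'_def aj_def
      by (rule error_constant[OF pos s \<epsilon> \<xi> \<kappa>0 \<kappa>_le])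
  qed (rule vec_norm2_nonneg)
  finally show ?thesis .
qed

section \<open>Projections onto selected rows and columns\<close>

lemma col_submat_carrier:
  assumes "A \<in> carrier_mat n m" "J \<subseteq> {..<m}"
  shows "col_submat A J \<in> carrier_mat n (card J)"
proof -
  have "{j. j < m \<and> j \<in> J} = J" using assms(2) by auto
  then show ?thesis using assms(1) by (intro carrier_matI) (auto simp: col_submat_def dim_submatrix)
qed

lemma transpose_row_submat:
  "transpose_mat (row_submat A I) = col_submat (transpose_mat A) I"
  by (rule eq_matI) (auto simp: row_submat_def col_submat_def dim_submatrix submatrix_index pick_UNIV
      dest: pick_le)

lemma row_submat_transpose:
  "row_submat (transpose_mat A) J = transpose_mat (col_submat A J)"
  using transpose_row_submat[of "transpose_mat A" J] by (metis transpose_transpose)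

lemma col_submat_range:
  assumes A: "A \<in> carrier_mat n m" and J: "J \<subseteq> {..<m}"
    and v: "v \<in> carrier_vec m" "\<forall>j<m. j \<notin> J \<longrightarrow> v $ j = 0"
  obtains v' where "v' \<in> carrier_vec (card J)" "A *\<^sub>v v = col_submat A J *\<^sub>v v'"
proof
  let ?v' = "vec (card J) (\<lambda>i. v $ pick J i)"
  have fin: "finite J" using J finite_subset by blast
  have Jeq: "{j. j < m \<and> j \<in> J} = J" using J by auto
  note C = col_submat_carrier[OF A J]
  show "?v' \<in> carrier_vec (card J)" by simp
  show "A *\<^sub>v v = col_submat A J *\<^sub>v ?v'"
  proof (rule eq_vecI)
    fix a assume "a < dim_vec (col_submat A J *\<^sub>v ?v')"
    then have a: "a < n" using C by simp
    have "(A *\<^sub>v v) $ a = (\<Sum>j<m. A $$ (a, j) * v $ j)"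
      using a A v by (simp add: scalar_prod_def atLeast0LessThan)
    also have "\<dots> = (\<Sum>j\<in>J. A $$ (a, j) * v $ j)"
      using J v by (intro sum.mono_neutral_right) auto
    also have "\<dots> = (\<Sum>i<card J. A $$ (a, pick J i) * v $ pick J i)"
      by (rule sum.reindex_bij_betw[OF bij_betw_pick[OF fin], symmetric])
    also have "\<dots> = (\<Sum>i<card J. col_submat A J $$ (a, i) * ?v' $ i)"
      using a A by (intro sum.cong refl) (auto simp: col_submat_def submatrix_index Jeq pick_UNIV)
    also have "\<dots> = (col_submat A J *\<^sub>v ?v') $ a"
      using a C by (simp add: scalar_prod_def atLeast0LessThan)
    finally show "(A *\<^sub>v v) $ a = (col_submat A J *\<^sub>v ?v') $ a" .
  qed (use A C in simp)
qed

text \<open>Stated for any orthogonal projection that fixes the columns \<open>J\<close>, so that it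
  serves \<open>C C\<^sup>\<dagger>\<close> with \<open>A\<close> as well as
  \<open>R\<^sup>\<dagger> R\<close> with the transpose of \<open>A\<close>.\<close>

lemma residual_projection:
  assumes Q: "Q \<in> carrier_mat n n" "transpose_mat Q = Q" "Q * Q = Q"
    and A: "A \<in> carrier_mat n m" and J: "J \<subseteq> {..<m}" and QC: "Q * col_submat A J = col_submat A J"
  shows "1\<^sub>m n - Q \<in> carrier_mat n n"
    "y \<in> carrier_vec n \<Longrightarrow> (1\<^sub>m n - Q) *\<^sub>v y = y - Q *\<^sub>v y"
    "y \<in> carrier_vec n \<Longrightarrow> vec_norm2 ((1\<^sub>m n - Q) *\<^sub>v y) \<le> vec_norm2 y"
    "v \<in> carrier_vec m \<Longrightarrow> \<forall>j<m. j \<notin> J \<longrightarrow> v $ j = 0 \<Longrightarrow> (1\<^sub>m n - Q) *\<^sub>v (A *\<^sub>v v) = 0\<^sub>v n"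
proof -
  show "1\<^sub>m n - Q \<in> carrier_mat n n" using Q by (intro minus_carrier_mat)
  show e: "(1\<^sub>m n - Q) *\<^sub>v y = y - Q *\<^sub>v y" if "y \<in> carrier_vec n" for y
    using minus_mult_distrib_mat_vec[OF one_carrier_mat Q(1) that] that by simp
  show "vec_norm2 ((1\<^sub>m n - Q) *\<^sub>v y) \<le> vec_norm2 y" if "y \<in> carrier_vec n"
    unfolding e[OF that] by (rule orthogonal_projection_norm_le(2)[OF Q that])
  show "(1\<^sub>m n - Q) *\<^sub>v (A *\<^sub>v v) = 0\<^sub>v n" if v: "v \<in> carrier_vec m" "\<forall>j<m. j \<notin> J \<longrightarrow> v $ j = 0"
  proof -
    obtain v' where v': "v' \<in> carrier_vec (card J)" "A *\<^sub>v v = col_submat A J *\<^sub>v v'"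
      using col_submat_range[OF A J v] .
    have Av: "A *\<^sub>v v \<in> carrier_vec n" using A v by simp
    have "Q *\<^sub>v (A *\<^sub>v v) = (Q * col_submat A J) *\<^sub>v v'"
      unfolding v'(2) using assoc_mult_mat_vec[OF Q(1) col_submat_carrier[OF A J] v'(1)] by simp
    then have "Q *\<^sub>v (A *\<^sub>v v) = A *\<^sub>v v" by (simp add: QC v'(2))
    then show ?thesis using e[OF Av] Av by simp
  qed
qed

text \<open>\<open>A - P A P' = (A - P A) + P (A - A P')\<close>, so the two one-sided residuals add up.\<close>

lemma skeleton_norm_le:
  assumes A: "A \<in> carrier_mat n m" and I: "I \<subseteq> {..<n}" and J: "J \<subseteq> {..<m}"
    and c: "0 \<le> c" "0 \<le> c'"
    and cols: "\<And>x. x \<in> carrier_vec m \<Longrightarrow>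
      vec_norm2 ((1\<^sub>m n - col_submat A J * pinv (col_submat A J)) *\<^sub>v (A *\<^sub>v x)) \<le> c * vec_norm2 x"
    and rows: "\<And>y. y \<in> carrier_vec n \<Longrightarrow>
      vec_norm2 ((1\<^sub>m m - pinv (row_submat A I) * row_submat A I) *\<^sub>v (transpose_mat A *\<^sub>v y)) \<le> c' * vec_norm2 y"
  shows "spectral_norm (A - skeleton_approx A I J) \<le> c + c'"
proof -
  define C where "C = col_submat A J"
  define R where "R = row_submat A I"
  have Cc: "C \<in> carrier_mat n (card J)" unfolding C_def by (rule col_submat_carrier[OF A J])
  have Rc: "R \<in> carrier_mat (card I) m" unfolding R_def by (rule row_submat_carrier[OF A I])
  define P where "P = C * pinv C"
  define Q where "Q = pinv R * R"
  note pc = pinv_projections(1-4)[OF Cc, folded P_def] and pr = pinv_projections(5-8)[OF Rc, folded Q_def]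
  have AT: "transpose_mat A \<in> carrier_mat m n" using A by simp
  have skel: "skeleton_approx A I J = P * A * Q"
    unfolding skeleton_approx_def C_def[symmetric] R_def[symmetric] P_def Q_def
    using assoc_mult_mat[OF mult_carrier_mat[OF mult_carrier_mat[OF Cc pinv_carrier[OF Cc]] A] pinv_carrier[OF Rc] Rc]
    by simp
  have PAQ: "P * A * Q \<in> carrier_mat n m" using pc pr A by simp
  show ?thesis unfolding skel
  proof (rule spectral_norm_le)
    show "A - P * A * Q \<in> carrier_mat n m" using PAQ by (rule minus_carrier_mat)
    show "0 \<le> c + c'" using c by simp
    fix x :: "real vec" assume x: "x \<in> carrier_vec m"
    have Qx: "Q *\<^sub>v x \<in> carrier_vec m" using pr x by simp
    have Ax: "A *\<^sub>v x \<in> carrier_vec n" "A *\<^sub>v (Q *\<^sub>v x) \<in> carrier_vec n" using A x Qx by auto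
    have Px: "P *\<^sub>v (A *\<^sub>v x) \<in> carrier_vec n" "P *\<^sub>v (A *\<^sub>v (Q *\<^sub>v x)) \<in> carrier_vec n" using pc Ax by auto
    let ?M = "(1\<^sub>m m - Q) * transpose_mat A"
    have IQ: "1\<^sub>m m - Q \<in> carrier_mat m m" using pr by (intro minus_carrier_mat)
    have M: "?M \<in> carrier_mat m n" using IQ A by simp
    have "transpose_mat ?M = A * (1\<^sub>m m - Q)"
      using transpose_mult[OF IQ AT] transpose_minus[OF one_carrier_mat pr(4)] by (simp add: pr(1))
    then have Mx: "transpose_mat ?M *\<^sub>v x = A *\<^sub>v x - A *\<^sub>v (Q *\<^sub>v x)"
      using assoc_mult_mat_vec[OF A IQ x] minus_mult_distrib_mat_vec[OF one_carrier_mat pr(4) x]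
        mult_minus_distrib_mat_vec[OF A x Qx] x by simp
    have row_err: "vec_norm2 (A *\<^sub>v x - A *\<^sub>v (Q *\<^sub>v x)) \<le> c' * vec_norm2 x"
      unfolding Mx[symmetric]
    proof (rule adjoint_norm_le[OF M _ c(2) x])
      fix y :: "real vec" assume y: "y \<in> carrier_vec n"
      show "vec_norm2 (?M *\<^sub>v y) \<le> c' * vec_norm2 y"
        using rows[OF y] assoc_mult_mat_vec[OF IQ AT y] by (simp add: Q_def R_def)
    qed
    have col_err: "vec_norm2 (A *\<^sub>v x - P *\<^sub>v (A *\<^sub>v x)) \<le> c * vec_norm2 x"
      using cols[OF x] minus_mult_distrib_mat_vec[OF one_carrier_mat pc(4) Ax(1)] Ax by (simp add: P_def C_def)
    have "(A - P * A * Q) *\<^sub>v x = A *\<^sub>v x - P *\<^sub>v (A *\<^sub>v (Q *\<^sub>v x))"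
      using minus_mult_distrib_mat_vec[OF A PAQ x] assoc_mult_mat_vec[OF mult_carrier_mat[OF pc(4) A] pr(4) x]
        assoc_mult_mat_vec[OF pc(4) A Qx] by simp
    also have "\<dots> = (A *\<^sub>v x - P *\<^sub>v (A *\<^sub>v x)) + P *\<^sub>v (A *\<^sub>v x - A *\<^sub>v (Q *\<^sub>v x))"
      unfolding mult_minus_distrib_mat_vec[OF pc(4) Ax] using Ax Px by (intro eq_vecI) auto
    also have "vec_norm2 \<dots> \<le> vec_norm2 (A *\<^sub>v x - P *\<^sub>v (A *\<^sub>v x)) + vec_norm2 (P *\<^sub>v (A *\<^sub>v x - A *\<^sub>v (Q *\<^sub>v x)))"
      using Ax Px pc by (intro vec_norm2_triangle[of _ n]) auto
    also have "\<dots> \<le> c * vec_norm2 x + c' * vec_norm2 x"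
      using col_err row_err orthogonal_projection_norm_le(1)[OF pc(4,1,2), of "A *\<^sub>v x - A *\<^sub>v (Q *\<^sub>v x)"] Ax by simp
    finally show "vec_norm2 ((A - P * A * Q) *\<^sub>v x) \<le> (c + c') * vec_norm2 x" by (simp add: distrib_right)
  qed
qed

text \<open>A unit column has a nonzero entry. Combined with \<open>2 k \<beta> l / n < 1\<close>,
  this is what yields \<open>k l \<le> n\<close> when the sparse block is present.\<close>

lemma sparse_orthonormal_pos:
  assumes X: "X \<in> carrier_mat n d" and on: "orthonormal_cols X" and sp: "sparse_cols \<beta> X" and d: "d \<noteq> 0"
  shows "1 \<le> \<beta>"
proof (rule ccontr)
  assume "\<not> 1 \<le> \<beta>"
  moreover have "card {i. i < n \<and> X $$ (i, 0) \<noteq> 0} \<le> \<beta>" using sp X d by (auto simp: sparse_cols_def)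
  moreover have "finite {i. i < n \<and> X $$ (i, 0) \<noteq> 0}" by simp
  ultimately have "{i. i < n \<and> X $$ (i, 0) \<noteq> 0} = {}" by (metis card_0_eq le_zero_eq less_one not_le)
  then have z: "X $$ (i, 0) = 0" if "i < n" for i using that by auto
  have "(transpose_mat X * X) $$ (0, 0) = 0" using X d z by (simp add: scalar_prod_def)
  then show False using orthonormal_colsD[OF on X] d by simp
qed

text \<open>The rows of \<open>A\<close> are treated as the columns of the transpose, with the second and third block interchanged.\<close>

lemma skeleton_error:
  fixes n m k k1 k2 k3 l :: nat
  assumes Xc: "X1 \<in> carrier_mat n k1" "X2 \<in> carrier_mat n k2" "X3 \<in> carrier_mat n k3"
    and Yc: "Y1 \<in> carrier_mat m k1" "Y2 \<in> carrier_mat m k2" "Y3 \<in> carrier_mat m k3"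
    and Zc: "Z1 \<in> carrier_mat k1 k1" "Z2 \<in> carrier_mat k2 k2" "Z3 \<in> carrier_mat k3 k3"
    and AE: "A \<in> carrier_mat n m" "E \<in> carrier_mat n m"
    and ksum: "k1 + k2 + k3 = k" and k: "1 \<le> k"
    and X_def: "X = append_cols X1 (append_cols X2 X3)" and Y_def: "Y = append_cols Y1 (append_cols Y2 Y3)"
    and Z_def: "Z = diag_block_mat [Z1, Z2, Z3]"
    and A_eq: "A = X * Z * transpose_mat Y + E"
    and rank: "vec_space.rank n (X * Z * transpose_mat Y) = k"
    and E_le: "spectral_norm E \<le> \<epsilon>"
    and coh: "coherent \<mu> (append_cols X1 X2)" "coherent \<mu> (append_cols Y1 Y3)"
    and on: "orthonormal_cols X3" "orthonormal_cols Y2"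
    and I0: "I0 \<subseteq> {..<n}" "sample_lower n l (append_cols X1 X2) I0" "sample_upper n l (append_cols X1 X2) I0"
      "rows_vanish X3 I0"
    and Jb: "Jb \<subseteq> {..<m}" "sample_lower m l (append_cols Y1 Y3) Jb" "rows_vanish Y2 Jb"
    and J0: "J0 \<subseteq> {..<m}" "sample_lower m l (append_cols Y1 Y3) J0" "sample_upper m l (append_cols Y1 Y3) J0"
      "rows_vanish Y2 J0"
    and Ib: "Ib \<subseteq> {..<n}" "sample_lower n l (append_cols X1 X2) Ib" "rows_vanish X3 Ib"
    and Ja: "srrqr_selects (row_submat A I0) k Ja"
    and Ia: "srrqr_selects (transpose_mat (col_submat A J0)) k Ia"
    and l: "real l = \<alpha> * \<mu> * real k" "l \<le> n" "l \<le> m" "0 < l" and \<alpha>: "1 \<le> \<alpha>"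
    and kl: "k3 \<noteq> 0 \<Longrightarrow> k * l \<le> n" "k2 \<noteq> 0 \<Longrightarrow> k * l \<le> m"
    and gap: "\<epsilon> * sqrt (real n * real m * real k / real l) \<le> 1 / 20 * sing_val k (X * Z * transpose_mat Y)"
  shows "spectral_norm (A - skeleton_approx A (Ia \<union> Ib) (Ja \<union> Jb))
    \<le> 460 * \<epsilon> * sqrt (real n * real m * real k / real l)
      * (sing_val 1 (X * Z * transpose_mat Y) / sing_val k (X * Z * transpose_mat Y))
      * (spectral_norm (pinv X) + spectral_norm (pinv Y))"
proof -
  define B where "B = X * Z * transpose_mat Y"
  define s where "s = sing_val k B"
  define s1 where "s1 = sing_val 1 B"
  have k': "k = k1 + (k2 + k3)" using ksum by simp
  have X23: "append_cols X2 X3 \<in> carrier_mat n (k2 + k3)" by (rule append_cols_carrier[OF Xc(2,3)])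
  have Y23: "append_cols Y2 Y3 \<in> carrier_mat m (k2 + k3)" by (rule append_cols_carrier[OF Yc(2,3)])
  have X12: "append_cols X1 X2 \<in> carrier_mat n (k1 + k2)" by (rule append_cols_carrier[OF Xc(1,2)])
  have Y13: "append_cols Y1 Y3 \<in> carrier_mat m (k1 + k3)" by (rule append_cols_carrier[OF Yc(1,3)])
  have X: "X \<in> carrier_mat n k" unfolding X_def k' by (rule append_cols_carrier[OF Xc(1) X23])
  have Y: "Y \<in> carrier_mat m k" unfolding Y_def k' by (rule append_cols_carrier[OF Yc(1) Y23])
  have Z: "Z \<in> carrier_mat k k" unfolding Z_def k' by (rule diag_block_mat_3_carrier[OF Zc])
  have ZcT: "transpose_mat Z1 \<in> carrier_mat k1 k1" "transpose_mat Z2 \<in> carrier_mat k2 k2" "transpose_mat Z3 \<in> carrier_mat k3 k3"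
    using Zc by auto
  have Xw: "X *\<^sub>v (w1 @\<^sub>v (w2 @\<^sub>v w3)) = X1 *\<^sub>v w1 + X2 *\<^sub>v w2 + X3 *\<^sub>v w3"
    if w: "w1 \<in> carrier_vec k1" "w2 \<in> carrier_vec k2" "w3 \<in> carrier_vec k3" for w1 w2 w3
    unfolding X_def append_cols_mult[OF Xc(1) X23 w(1) append_carrier[OF w(2,3)]] append_cols_mult[OF Xc(2,3) w(2,3)]
    using Xc w by (intro eq_vecI) auto
  have Yw: "Y *\<^sub>v (w1 @\<^sub>v (w2 @\<^sub>v w3)) = Y1 *\<^sub>v w1 + Y2 *\<^sub>v w2 + Y3 *\<^sub>v w3"
    if w: "w1 \<in> carrier_vec k1" "w2 \<in> carrier_vec k2" "w3 \<in> carrier_vec k3" for w1 w2 w3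
    unfolding Y_def append_cols_mult[OF Yc(1) Y23 w(1) append_carrier[OF w(2,3)]] append_cols_mult[OF Yc(2,3) w(2,3)]
    using Yc w by (intro eq_vecI) auto
  have Xt: "transpose_mat X *\<^sub>v y = (transpose_mat X1 *\<^sub>v y) @\<^sub>v ((transpose_mat X2 *\<^sub>v y) @\<^sub>v (transpose_mat X3 *\<^sub>v y))"
    if "y \<in> carrier_vec n" for y
    unfolding X_def append_cols_transpose_mult[OF Xc(1) X23 that] append_cols_transpose_mult[OF Xc(2,3) that] ..
  have Yt: "transpose_mat Y *\<^sub>v x = (transpose_mat Y1 *\<^sub>v x) @\<^sub>v ((transpose_mat Y2 *\<^sub>v x) @\<^sub>v (transpose_mat Y3 *\<^sub>v x))"
    if "x \<in> carrier_vec m" for x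
    unfolding Y_def append_cols_transpose_mult[OF Yc(1) Y23 that] append_cols_transpose_mult[OF Yc(2,3) that] ..
  have Zw: "Z *\<^sub>v (w1 @\<^sub>v (w2 @\<^sub>v w3)) = (Z1 *\<^sub>v w1) @\<^sub>v ((Z2 *\<^sub>v w2) @\<^sub>v (Z3 *\<^sub>v w3))"
    if "w1 \<in> carrier_vec k1" "w2 \<in> carrier_vec k2" "w3 \<in> carrier_vec k3" for w1 w2 w3
    unfolding Z_def by (rule diag_block_mat_3_mult[OF Zc that])
  have ZTw: "transpose_mat Z *\<^sub>v (w1 @\<^sub>v (w2 @\<^sub>v w3))
      = (transpose_mat Z1 *\<^sub>v w1) @\<^sub>v ((transpose_mat Z2 *\<^sub>v w2) @\<^sub>v (transpose_mat Z3 *\<^sub>v w3))"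
    if "w1 \<in> carrier_vec k1" "w2 \<in> carrier_vec k2" "w3 \<in> carrier_vec k3" for w1 w2 w3
    unfolding Z_def diag_block_mat_3_transpose[OF Zc] by (rule diag_block_mat_3_mult[OF ZcT that])
  have norm3: "(vec_norm2 (w1 @\<^sub>v (w2 @\<^sub>v w3)))\<^sup>2 = (vec_norm2 w1)\<^sup>2 + ((vec_norm2 w2)\<^sup>2 + (vec_norm2 w3)\<^sup>2)"
    if "w1 \<in> carrier_vec p1" "w2 \<in> carrier_vec p2" "w3 \<in> carrier_vec p3" for w1 w2 w3 :: "real vec" and p1 p2 p3
    unfolding vec_norm2_append[OF that(1) append_carrier[OF that(2,3)]] vec_norm2_append[OF that(2,3)] ..
  have sqrt2_le: "vec_norm2 u \<le> sqrt 2 * vec_norm2 w" if "(vec_norm2 u)\<^sup>2 \<le> 2 * (vec_norm2 w)\<^sup>2" for u w :: "real vec"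
  proof (rule power2_le_imp_le)
    show "(vec_norm2 u)\<^sup>2 \<le> (sqrt 2 * vec_norm2 w)\<^sup>2" using that by (simp add: power_mult_distrib)
    show "0 \<le> sqrt 2 * vec_norm2 w" by (simp add: vec_norm2_nonneg)
  qed
  have split3: "\<exists>w1\<in>carrier_vec k1. \<exists>w2\<in>carrier_vec k2. \<exists>w3\<in>carrier_vec k3. w = w1 @\<^sub>v (w2 @\<^sub>v w3)"
    if wk: "w \<in> carrier_vec k" for w :: "real vec"
  proof -
    obtain w1 w' where w: "w1 \<in> carrier_vec k1" "w' \<in> carrier_vec (k2 + k3)" "w = w1 @\<^sub>v w'"
      using vec_split[OF wk[unfolded k']] .
    obtain w2 w3 where w': "w2 \<in> carrier_vec k2" "w3 \<in> carrier_vec k3" "w' = w2 @\<^sub>v w3"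
      using vec_split[OF w(2)] .
    show ?thesis using w(1,3) w' by blast
  qed
  have X_le: "vec_norm2 (X *\<^sub>v w) \<le> sqrt 2 * vec_norm2 w" if "w \<in> carrier_vec k" for w
  proof -
    obtain w1 w2 w3 where w: "w1 \<in> carrier_vec k1" "w2 \<in> carrier_vec k2" "w3 \<in> carrier_vec k3" "w = w1 @\<^sub>v (w2 @\<^sub>v w3)"
      using split3[OF \<open>w \<in> carrier_vec k\<close>] by blast
    have "X *\<^sub>v w = append_cols X1 X2 *\<^sub>v (w1 @\<^sub>v w2) + X3 *\<^sub>v w3"
      unfolding w(4) Xw[OF w(1-3)] append_cols_mult[OF Xc(1,2) w(1,2)] ..
    then show ?thesis
      using append_orthonormal_norm_le[OF X12 coherent_orthonormal[OF X12 coh(1)] Xc(3) orthonormal_colsD[OF on(1) Xc(3)]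
          append_carrier[OF w(1,2)] w(3)]
      by (intro sqrt2_le) (simp add: w(4) norm3[OF w(1-3)] vec_norm2_append[OF w(1,2)] add.assoc)
  qed
  have Y_le: "vec_norm2 (Y *\<^sub>v w) \<le> sqrt 2 * vec_norm2 w" if "w \<in> carrier_vec k" for w
  proof -
    obtain w1 w2 w3 where w: "w1 \<in> carrier_vec k1" "w2 \<in> carrier_vec k2" "w3 \<in> carrier_vec k3" "w = w1 @\<^sub>v (w2 @\<^sub>v w3)"
      using split3[OF \<open>w \<in> carrier_vec k\<close>] by blast
    have "Y *\<^sub>v w = append_cols Y1 Y3 *\<^sub>v (w1 @\<^sub>v w3) + Y2 *\<^sub>v w2"
      unfolding w(4) Yw[OF w(1-3)] append_cols_mult[OF Yc(1,3) w(1,3)]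
      using Yc w by (intro eq_vecI) auto
    then show ?thesis
      using append_orthonormal_norm_le[OF Y13 coherent_orthonormal[OF Y13 coh(2)] Yc(2) orthonormal_colsD[OF on(2) Yc(2)]
          append_carrier[OF w(1,3)] w(2)]
      by (intro sqrt2_le) (simp add: w(4) norm3[OF w(1-3)] vec_norm2_append[OF w(1,3)] algebra_simps)
  qed
  interpret low_rank_factorization n m k X Z Y B
    using X Y Z k rank X_le Y_le by unfold_locales (auto simp: B_def)
  have s: "0 < s" "s \<le> s1" using sing_val_pos sing_val_le by (auto simp: s_def s1_def)
  have \<epsilon>: "0 \<le> \<epsilon>" using E_le spectral_norm_nonneg[of E] by linarith
  have E_x: "vec_norm2 (E *\<^sub>v x) \<le> \<epsilon> * vec_norm2 x" if "x \<in> carrier_vec m" for x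
    using spectral_norm_bound[OF AE(2) that] mult_right_mono[OF E_le vec_norm2_nonneg[of x]] by linarith
  have ET: "transpose_mat E \<in> carrier_mat m n" using AE by simp
  have AT: "transpose_mat A \<in> carrier_mat m n" using AE by simp
  have ET_y: "vec_norm2 (transpose_mat E *\<^sub>v y) \<le> \<epsilon> * vec_norm2 y" if "y \<in> carrier_vec n" for y
    by (rule adjoint_norm_le[OF AE(2) E_x \<epsilon> that])
  have tc: "transpose_mat X1 \<in> carrier_mat k1 n" "transpose_mat X2 \<in> carrier_mat k2 n" "transpose_mat X3 \<in> carrier_mat k3 n"
    "transpose_mat Y1 \<in> carrier_mat k1 m" "transpose_mat Y2 \<in> carrier_mat k2 m" "transpose_mat Y3 \<in> carrier_mat k3 m"
    using Xc Yc by auto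
  \<comment> \<open>The locale provides \<open>k \<le> m\<close>; the transposed instance asks for
    \<open>k \<le> n\<close>, which injectivity of \<open>X\<close> supplies.\<close>
  have kn: "k \<le> n"
  proof (rule ccontr)
    assume "\<not> k \<le> n"
    then obtain z where "z \<in> carrier_vec k" "z \<noteq> 0\<^sub>v k" "X *\<^sub>v z = 0\<^sub>v n" using wide_matrix_kernel[OF X] by auto
    then show False using X_injective by auto
  qed
  have J_sub: "Ja \<union> Jb \<subseteq> {..<m}"
    using srrqr_selects_card(1)[OF Ja] row_submat_carrier[OF AE(1) I0(1)] Jb(1) by auto
  have Ia_T: "srrqr_selects (row_submat (transpose_mat A) J0) k Ia" using Ia by (simp add: row_submat_transpose)
  have I_sub: "Ia \<union> Ib \<subseteq> {..<n}"
    using srrqr_selects_card(1)[OF Ia] col_submat_carrier[OF AE(1) J0(1)] Ib(1) by auto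
  let ?C = "col_submat A (Ja \<union> Jb)" and ?R = "row_submat A (Ia \<union> Ib)"
  note C = col_submat_carrier[OF AE(1) J_sub] and R = row_submat_carrier[OF AE(1) I_sub]
  note pc = pinv_projections(1-4)[OF C] and pr = pinv_projections(5-8)[OF R]
  have QR: "(pinv ?R * ?R) * col_submat (transpose_mat A) (Ia \<union> Ib) = col_submat (transpose_mat A) (Ia \<union> Ib)"
  proof -
    have "transpose_mat (?R * (pinv ?R * ?R)) = transpose_mat (pinv ?R * ?R) * transpose_mat ?R"
      by (rule transpose_mult[OF R pr(4)])
    then show ?thesis unfolding pr(1,3) transpose_row_submat by simp
  qed
  note Pcol = residual_projection[OF pc(4,1,2) AE(1) J_sub pc(3)]
    and Prow = residual_projection[OF pr(4,1,2) AT I_sub QR]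
  let ?K = "460 * \<epsilon> * sqrt (real n * real m * real k / real l) * (s1 / s)"
  have cols: "vec_norm2 ((1\<^sub>m n - ?C * pinv ?C) *\<^sub>v (A *\<^sub>v x)) \<le> ?K * spectral_norm (pinv X) * vec_norm2 x"
    if x: "x \<in> carrier_vec m" for x
  proof (rule one_sided_error[OF Xc Yc Zc AE ksum k k_le _ E_x _ _ coh(2) I0 Jb Ja Pcol(1,3,4) l \<alpha> kl(1) s pinv_norm_ge(1) \<epsilon> _ x])
    show "A *\<^sub>v y = X1 *\<^sub>v (Z1 *\<^sub>v (transpose_mat Y1 *\<^sub>v y)) + X2 *\<^sub>v (Z2 *\<^sub>v (transpose_mat Y2 *\<^sub>v y))
        + X3 *\<^sub>v (Z3 *\<^sub>v (transpose_mat Y3 *\<^sub>v y)) + E *\<^sub>v y" if y: "y \<in> carrier_vec m" for y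
    proof -
      have c: "transpose_mat Y1 *\<^sub>v y \<in> carrier_vec k1" "transpose_mat Y2 *\<^sub>v y \<in> carrier_vec k2" "transpose_mat Y3 *\<^sub>v y \<in> carrier_vec k3"
        using tc y by auto
      have "A *\<^sub>v y = B *\<^sub>v y + E *\<^sub>v y"
        unfolding A_eq B_def[symmetric] by (rule add_mult_distrib_mat_vec[OF B_carrier AE(2) y])
      then show ?thesis unfolding B_mult[OF y] Yt[OF y] Zw[OF c]
        using Xw[OF mult_mat_vec_carrier[OF Zc(1) c(1)] mult_mat_vec_carrier[OF Zc(2) c(2)] mult_mat_vec_carrier[OF Zc(3) c(3)]] by simp
    qed
    show "s / sqrt 2 * vec_norm2 (w1 @\<^sub>v w2) \<le> vec_norm2 (Y1 *\<^sub>v (transpose_mat Z1 *\<^sub>v w1) + Y2 *\<^sub>v (transpose_mat Z2 *\<^sub>v w2))"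
      if w: "w1 \<in> carrier_vec k1" "w2 \<in> carrier_vec k2" for w1 w2
    proof -
      \<comment> \<open>Padding the omitted block with zero turns the bound for the whole factor
        into one for two blocks.\<close>
      let ?w = "w1 @\<^sub>v (w2 @\<^sub>v 0\<^sub>v k3)"
      have wc: "?w \<in> carrier_vec k" unfolding k' by (intro append_carrier w zero_carrier_vec)
      have zc: "transpose_mat Z1 *\<^sub>v w1 \<in> carrier_vec k1" "transpose_mat Z2 *\<^sub>v w2 \<in> carrier_vec k2" using ZcT w by auto
      have "(vec_norm2 ?w)\<^sup>2 = (vec_norm2 (w1 @\<^sub>v w2))\<^sup>2"
        by (simp add: norm3[OF w zero_carrier_vec] vec_norm2_append[OF w])
      then have "vec_norm2 ?w = vec_norm2 (w1 @\<^sub>v w2)" by (rule power2_eq_imp_eq) (auto simp: vec_norm2_nonneg)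
      moreover have "Y *\<^sub>v (transpose_mat Z *\<^sub>v ?w) = Y1 *\<^sub>v (transpose_mat Z1 *\<^sub>v w1) + Y2 *\<^sub>v (transpose_mat Z2 *\<^sub>v w2)"
        unfolding ZTw[OF w zero_carrier_vec] mat_mult_zero_vec[OF ZcT(3)] Yw[OF zc zero_carrier_vec] mat_mult_zero_vec[OF Yc(3)]
        using Yc zc by simp
      ultimately show ?thesis using factor_bounds(1)[OF wc] by (simp add: s_def)
    qed
    show "vec_norm2 ((Z1 *\<^sub>v (transpose_mat Y1 *\<^sub>v y)) @\<^sub>v (Z2 *\<^sub>v (transpose_mat Y2 *\<^sub>v y)))
        \<le> spectral_norm (pinv X) * s1 * vec_norm2 y" if y: "y \<in> carrier_vec m" for y
    proof -
      have c: "transpose_mat Y1 *\<^sub>v y \<in> carrier_vec k1" "transpose_mat Y2 *\<^sub>v y \<in> carrier_vec k2" "transpose_mat Y3 *\<^sub>v y \<in> carrier_vec k3"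
        using tc y by auto
      have zc: "Z1 *\<^sub>v (transpose_mat Y1 *\<^sub>v y) \<in> carrier_vec k1" "Z2 *\<^sub>v (transpose_mat Y2 *\<^sub>v y) \<in> carrier_vec k2"
        "Z3 *\<^sub>v (transpose_mat Y3 *\<^sub>v y) \<in> carrier_vec k3" using Zc c by auto
      have "vec_norm2 ((Z1 *\<^sub>v (transpose_mat Y1 *\<^sub>v y)) @\<^sub>v (Z2 *\<^sub>v (transpose_mat Y2 *\<^sub>v y)))
        \<le> vec_norm2 (Z *\<^sub>v (transpose_mat Y *\<^sub>v y))"
        unfolding Yt[OF y] Zw[OF c]
        by (rule power2_le_imp_le[OF _ vec_norm2_nonneg]) (simp add: norm3[OF zc] vec_norm2_append[OF zc(1,2)])
      then show ?thesis using core_bounds(1)[OF y] by (simp add: s1_def)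
    qed
    show "\<epsilon> * sqrt (real n * real m * real k / real l) \<le> 1 / 20 * s" using gap by (simp add: s_def B_def)
  qed
  have rows: "vec_norm2 ((1\<^sub>m m - pinv ?R * ?R) *\<^sub>v (transpose_mat A *\<^sub>v y)) \<le> ?K * spectral_norm (pinv Y) * vec_norm2 y"
    if y: "y \<in> carrier_vec n" for y
  proof -
    \<comment> \<open>The transposed instance exchanges \<open>n\<close> and \<open>m\<close>, so
      the product under the root appears in the other order.\<close>
    have comm: "real m * real n = real n * real m" by simp
    have ksum': "k1 + k3 + k2 = k" using ksum by simp
    show ?thesis unfolding comm[symmetric]
    proof (rule one_sided_error[OF Yc(1,3,2) Xc(1,3,2) ZcT(1,3,2) AT ET ksum' k kn _ ET_y _ _ coh(1) J0 Ib Ia_T Prow(1,3,4)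
          l(1,3,2,4) \<alpha> kl(2) s pinv_norm_ge(2) \<epsilon> _ y], unfold transpose_transpose)
      show "transpose_mat A *\<^sub>v x = Y1 *\<^sub>v (transpose_mat Z1 *\<^sub>v (transpose_mat X1 *\<^sub>v x)) + Y3 *\<^sub>v (transpose_mat Z3 *\<^sub>v (transpose_mat X3 *\<^sub>v x))
          + Y2 *\<^sub>v (transpose_mat Z2 *\<^sub>v (transpose_mat X2 *\<^sub>v x)) + transpose_mat E *\<^sub>v x" if x: "x \<in> carrier_vec n" for x
      proof -
        have c: "transpose_mat X1 *\<^sub>v x \<in> carrier_vec k1" "transpose_mat X2 *\<^sub>v x \<in> carrier_vec k2" "transpose_mat X3 *\<^sub>v x \<in> carrier_vec k3"
          using tc x by auto
        have zc: "transpose_mat Z1 *\<^sub>v (transpose_mat X1 *\<^sub>v x) \<in> carrier_vec k1" "transpose_mat Z2 *\<^sub>v (transpose_mat X2 *\<^sub>v x) \<in> carrier_vec k2"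
          "transpose_mat Z3 *\<^sub>v (transpose_mat X3 *\<^sub>v x) \<in> carrier_vec k3" using ZcT c by auto
        have BT: "transpose_mat B = Y * (transpose_mat Z * transpose_mat X)"
          unfolding B_def using transpose_mult[OF mult_carrier_mat[OF X Z] transposes(2)] transpose_mult[OF X Z] by simp
        have "transpose_mat A = transpose_mat B + transpose_mat E"
          unfolding A_eq B_def[symmetric] by (rule transpose_add[OF B_carrier AE(2)])
        then have "transpose_mat A *\<^sub>v x = transpose_mat B *\<^sub>v x + transpose_mat E *\<^sub>v x"
          using add_mult_distrib_mat_vec[of "transpose_mat B" m n "transpose_mat E" x] B_carrier ET x by simp
        also have "transpose_mat B *\<^sub>v x = Y *\<^sub>v (transpose_mat Z *\<^sub>v (transpose_mat X *\<^sub>v x))"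
          unfolding BT using assoc_mult_mat_vec[OF Y mult_carrier_mat[OF transposes(3,1)] x] assoc_mult_mat_vec[OF transposes(3,1) x] by simp
        also have "\<dots> = Y1 *\<^sub>v (transpose_mat Z1 *\<^sub>v (transpose_mat X1 *\<^sub>v x)) + Y2 *\<^sub>v (transpose_mat Z2 *\<^sub>v (transpose_mat X2 *\<^sub>v x))
          + Y3 *\<^sub>v (transpose_mat Z3 *\<^sub>v (transpose_mat X3 *\<^sub>v x))"
          unfolding Xt[OF x] ZTw[OF c] Yw[OF zc] ..
        also have "\<dots> = Y1 *\<^sub>v (transpose_mat Z1 *\<^sub>v (transpose_mat X1 *\<^sub>v x)) + Y3 *\<^sub>v (transpose_mat Z3 *\<^sub>v (transpose_mat X3 *\<^sub>v x))
          + Y2 *\<^sub>v (transpose_mat Z2 *\<^sub>v (transpose_mat X2 *\<^sub>v x))"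
          using Yc by (intro eq_vecI) auto
        finally show ?thesis .
      qed
      show "s / sqrt 2 * vec_norm2 (w1 @\<^sub>v w3) \<le> vec_norm2 (X1 *\<^sub>v (Z1 *\<^sub>v w1) + X3 *\<^sub>v (Z3 *\<^sub>v w3))"
        if w: "w1 \<in> carrier_vec k1" "w3 \<in> carrier_vec k3" for w1 w3
      proof -
        let ?w = "w1 @\<^sub>v (0\<^sub>v k2 @\<^sub>v w3)"
        have wc: "?w \<in> carrier_vec k" unfolding k' by (intro append_carrier w zero_carrier_vec)
        have zc: "Z1 *\<^sub>v w1 \<in> carrier_vec k1" "Z3 *\<^sub>v w3 \<in> carrier_vec k3" using Zc w by auto
        have "(vec_norm2 ?w)\<^sup>2 = (vec_norm2 (w1 @\<^sub>v w3))\<^sup>2"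
          by (simp add: norm3[OF w(1) zero_carrier_vec w(2)] vec_norm2_append[OF w])
        then have "vec_norm2 ?w = vec_norm2 (w1 @\<^sub>v w3)" by (rule power2_eq_imp_eq) (auto simp: vec_norm2_nonneg)
        moreover have "X *\<^sub>v (Z *\<^sub>v ?w) = X1 *\<^sub>v (Z1 *\<^sub>v w1) + X3 *\<^sub>v (Z3 *\<^sub>v w3)"
          unfolding Zw[OF w(1) zero_carrier_vec w(2)] mat_mult_zero_vec[OF Zc(2)] Xw[OF zc(1) zero_carrier_vec zc(2)] mat_mult_zero_vec[OF Xc(2)]
          using Xc zc by simp
        ultimately show ?thesis using factor_bounds(2)[OF wc] by (simp add: s_def)
      qed
      show "vec_norm2 ((transpose_mat Z1 *\<^sub>v (transpose_mat X1 *\<^sub>v x)) @\<^sub>v (transpose_mat Z3 *\<^sub>v (transpose_mat X3 *\<^sub>v x)))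
          \<le> spectral_norm (pinv Y) * s1 * vec_norm2 x" if x: "x \<in> carrier_vec n" for x
      proof -
        have c: "transpose_mat X1 *\<^sub>v x \<in> carrier_vec k1" "transpose_mat X2 *\<^sub>v x \<in> carrier_vec k2" "transpose_mat X3 *\<^sub>v x \<in> carrier_vec k3"
          using tc x by auto
        have zc: "transpose_mat Z1 *\<^sub>v (transpose_mat X1 *\<^sub>v x) \<in> carrier_vec k1" "transpose_mat Z2 *\<^sub>v (transpose_mat X2 *\<^sub>v x) \<in> carrier_vec k2"
          "transpose_mat Z3 *\<^sub>v (transpose_mat X3 *\<^sub>v x) \<in> carrier_vec k3" using ZcT c by auto
        have "vec_norm2 ((transpose_mat Z1 *\<^sub>v (transpose_mat X1 *\<^sub>v x)) @\<^sub>v (transpose_mat Z3 *\<^sub>v (transpose_mat X3 *\<^sub>v x)))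
          \<le> vec_norm2 (transpose_mat Z *\<^sub>v (transpose_mat X *\<^sub>v x))"
          unfolding Xt[OF x] ZTw[OF c]
          by (rule power2_le_imp_le[OF _ vec_norm2_nonneg]) (simp add: norm3[OF zc] vec_norm2_append[OF zc(1,3)])
        then show ?thesis using core_bounds(2)[OF x] by (simp add: s1_def)
      qed
      show "\<epsilon> * sqrt (real m * real n * real k / real l) \<le> 1 / 20 * s" using gap unfolding comm by (simp add: s_def B_def)
    qed
  qed
  have K: "0 \<le> ?K" using \<epsilon> s by simp
  have "spectral_norm (A - skeleton_approx A (Ia \<union> Ib) (Ja \<union> Jb)) \<le> ?K * spectral_norm (pinv X) + ?K * spectral_norm (pinv Y)"
    by (rule skeleton_norm_le[OF AE(1) I_sub J_sub mult_nonneg_nonneg[OF K spectral_norm_nonneg]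
          mult_nonneg_nonneg[OF K spectral_norm_nonneg] cols rows])
  then show ?thesis by (simp only: distrib_left s_def s1_def B_def)
qed

section \<open>The failure probability\<close>

text \<open>With \<open>q\<close> about \<open>\<alpha> / 2\<close> and
  \<open>t = (19/20) powr (\<alpha> / 4)\<close>, the tail \<open>(19/20) ^ q\<close> is about
  \<open>t\<^sup>2\<close>. Smallness gives \<open>t < 1/4\<close>, so one factor \<open>t\<close>
  pays for the constant 10 and for rounding, and the other one remains.\<close>

lemma sampling_exponent:
  fixes \<alpha> k :: real
  assumes k: "1 \<le> k" and small: "4 * k * ((19 / 20) powr (1 / 4)) powr \<alpha> < 1"
  obtains q :: nat where "2 * real (Suc q) \<le> \<alpha>"
    "10 * k * (19 / 20) ^ q \<le> 4 * k * ((19 / 20) powr (1 / 4)) powr \<alpha>"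
proof
  define t :: real where "t = (19 / 20) powr (\<alpha> / 4)"
  have t: "((19 / 20) powr (1 / 4)) powr \<alpha> = t" by (simp add: t_def powr_powr)
  have t0: "0 < t" by (simp add: t_def)
  have "4 * 1 * t \<le> 4 * k * t" using k t0 by (intro mult_right_mono) auto
  then have t4: "t < 1 / 4" using small t by simp
  \<comment> \<open>Otherwise \<open>t\<close> would be at least \<open>19/20\<close>.\<close>
  have \<alpha>: "2 \<le> \<alpha>"
  proof (rule ccontr)
    assume "\<not> 2 \<le> \<alpha>"
    then have "(19 / 20) powr 1 \<le> t" unfolding t_def by (intro powr_mono') auto
    then show False using t4 by simp
  qed
  \<comment> \<open>Minus one because the tail bounds ask for
    \<open>2 * real (Suc q) \<le> \<alpha>\<close>; the natural subtraction is exact since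
    \<open>\<alpha> \<ge> 2\<close>.\<close>
  let ?q = "nat \<lfloor>\<alpha> / 2\<rfloor> - 1"
  have "1 \<le> \<lfloor>\<alpha> / 2\<rfloor>" using \<alpha> by (simp add: le_floor_iff)
  then have q: "real (Suc ?q) = of_int \<lfloor>\<alpha> / 2\<rfloor>" by (simp add: of_nat_diff)
  then show "2 * real (Suc ?q) \<le> \<alpha>" using of_int_floor_le[of "\<alpha> / 2"] by (simp only:)
  have qge: "\<alpha> / 2 - 2 \<le> real ?q"
  proof -
    have "real ?q = real (Suc ?q) - 1" by (simp only: of_nat_Suc)
    also have "\<dots> = of_int \<lfloor>\<alpha> / 2\<rfloor> - 1" by (simp only: q)
    finally show ?thesis using real_of_int_floor_add_one_gt[of "\<alpha> / 2"] by linarith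
  qed
  have "(19 / 20) ^ ?q = (19 / 20) powr real ?q" by (simp add: powr_realpow)
  also have "\<dots> \<le> (19 / 20) powr (\<alpha> / 2 - 2)" using qge by (intro powr_mono') auto
  also have "\<dots> = (19 / 20) powr (\<alpha> / 4 + \<alpha> / 4) / (19 / 20) powr (real 2)" by (simp add: powr_diff)
  also have "\<dots> = t * t * (400 / 361)"
    unfolding powr_add powr_realpow[of "19 / 20" 2, simplified] by (simp add: t_def power2_eq_square)
  also have "\<dots> \<le> t * (1 / 4) * (400 / 361)" using t0 t4 by (intro mult_right_mono mult_left_mono) auto
  finally have "(19 / 20) ^ ?q \<le> t * (100 / 361)" by simp
  then have "10 * k * (19 / 20) ^ ?q \<le> 10 * k * (t * (100 / 361))" using k by (intro mult_left_mono) auto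
  also have "\<dots> \<le> 4 * k * t" using k t0 by simp
  finally show "10 * k * (19 / 20) ^ ?q \<le> 4 * k * ((19 / 20) powr (1 / 4)) powr \<alpha>" by (simp only: t)
qed

lemma prob_union_bound:
  "measure_pmf.prob p {x. \<not> (P x \<and> Q x)} \<le> a + b"
  if "measure_pmf.prob p {x. \<not> P x} \<le> a" "measure_pmf.prob p {x. \<not> Q x} \<le> b"
proof -
  have "{x. \<not> (P x \<and> Q x)} = {x. \<not> P x} \<union> {x. \<not> Q x}" by auto
  then show ?thesis
    using that measure_Un_le[of "{x. \<not> P x}" "measure_pmf p" "{x. \<not> Q x}"] by simp
qed

text \<open>Needed so that a submatrix with \<open>l\<close> sampled rows admits a
  rank-\<open>k\<close> factorization, and so that the prescribed size is the maximum of the three.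
  A coherent matrix without columns says nothing about \<open>\<mu>\<close>, hence the
  disjunction.\<close>

lemma sample_size_ge:
  fixes k l :: nat
  assumes X: "X \<in> carrier_mat n p" "coherent \<mu> X" and Y: "Y \<in> carrier_mat m r" "coherent \<mu> Y"
    and pr: "0 < p \<or> 0 < r" and l: "real l = \<alpha> * \<mu> * real k" and \<alpha>: "1 \<le> \<alpha>"
  shows "k \<le> l"
proof -
  have \<mu>: "1 \<le> \<mu>" using coherent_ge_1(1)[OF X] coherent_ge_1(1)[OF Y] pr by blast
  have "1 * 1 * real k \<le> real l" unfolding l using \<alpha> \<mu> by (intro mult_right_mono mult_mono) auto
  then show ?thesis by simp
qed

text \<open>\<open>small\<close> says that the claimed probability bound is positive.
  \<open>I0\<close> and \<open>J0\<close> have to satisfy both sampling bounds and avoid the sparse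
  block, \<open>Jb\<close> and \<open>Ib\<close> the lower bound and avoid it. As a lower bound
  costs two tail terms, the counts \<open>3 + 2 + 3 + 2\<close> give the 10 of
  \<open>sampling_exponent\<close>; each sparse block is avoided by two samples, whence the factor 2
  in front of \<open>k \<beta> l / n\<close> and \<open>k \<beta> l / m\<close>.\<close>

lemma prob_skeleton_error:
  fixes n m k k1 k2 k3 l \<beta> :: nat and \<alpha> :: real
  defines "c \<equiv> ((19 / 20) powr (1 / 4)) powr \<alpha>"
  assumes Xc: "X1 \<in> carrier_mat n k1" "X2 \<in> carrier_mat n k2" "X3 \<in> carrier_mat n k3"
    and Yc: "Y1 \<in> carrier_mat m k1" "Y2 \<in> carrier_mat m k2" "Y3 \<in> carrier_mat m k3"
    and Zc: "Z1 \<in> carrier_mat k1 k1" "Z2 \<in> carrier_mat k2 k2" "Z3 \<in> carrier_mat k3 k3"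
    and AE: "A \<in> carrier_mat n m" "E \<in> carrier_mat n m"
    and ksum: "k1 + k2 + k3 = k" and k: "1 \<le> k"
    and XYZ: "X = append_cols X1 (append_cols X2 X3)" "Y = append_cols Y1 (append_cols Y2 Y3)"
      "Z = diag_block_mat [Z1, Z2, Z3]"
    and A_eq: "A = X * Z * transpose_mat Y + E"
    and rank: "vec_space.rank n (X * Z * transpose_mat Y) = k"
    and E_le: "spectral_norm E \<le> \<epsilon>"
    and coh: "coherent \<mu> (append_cols X1 X2)" "coherent \<mu> (append_cols Y1 Y3)"
    and on: "orthonormal_cols X3" "orthonormal_cols Y2"
    and sp: "sparse_cols \<beta> X3" "sparse_cols \<beta> Y2"
    and l: "real l = \<alpha> * \<mu> * real k" "l \<le> n" "l \<le> m"
    and gap: "\<epsilon> * sqrt (real n * real m * real k / real l) \<le> 1 / 20 * sing_val k (X * Z * transpose_mat Y)"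
    and sel: "srrqr_routine sel"
    and small: "2 * real k * (real \<beta> * real l / real n + real \<beta> * real l / real m + 2 * c) < 1"
  shows "1 - 2 * real k * (real \<beta> * real l / real n + real \<beta> * real l / real m + 2 * c)
    \<le> measure_pmf.prob (randomized_srrqr sel A l k l)
      {(I, J). spectral_norm (A - skeleton_approx A I J)
        \<le> 460 * \<epsilon> * sqrt (real n * real m * real k / real l)
          * (sing_val 1 (X * Z * transpose_mat Y) / sing_val k (X * Z * transpose_mat Y))
          * (spectral_norm (pinv X) + spectral_norm (pinv Y))}"
proof -
  have X12: "append_cols X1 X2 \<in> carrier_mat n (k1 + k2)" by (rule append_cols_carrier[OF Xc(1,2)])
  have Y13: "append_cols Y1 Y3 \<in> carrier_mat m (k1 + k3)" by (rule append_cols_carrier[OF Yc(1,3)])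
  have bl: "0 \<le> 2 * real k * (real \<beta> * real l / real n)" "0 \<le> 2 * real k * (real \<beta> * real l / real m)"
    and c0: "0 \<le> 4 * real k * c" by (auto simp: c_def)
  have expand: "2 * real k * (real \<beta> * real l / real n + real \<beta> * real l / real m + 2 * c)
      = 2 * real k * (real \<beta> * real l / real n) + 2 * real k * (real \<beta> * real l / real m) + 4 * real k * c"
    by (simp add: distrib_left)
  have "4 * real k * c < 1" using small bl unfolding expand by linarith
  then obtain q where q: "2 * real (Suc q) \<le> \<alpha>" "10 * real k * (19 / 20) ^ q \<le> 4 * real k * c"
    using sampling_exponent[of "real k" \<alpha>] k unfolding c_def by auto
  have \<alpha>: "1 \<le> \<alpha>" using q(1) by simp
  have kl: "k \<le> l" using ksum k by (intro sample_size_ge[OF X12 coh(1) Y13 coh(2) _ l(1) \<alpha>]) auto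
  then have l0: "0 < l" using k by simp
  \<comment> \<open>A nonempty sparse block has \<open>\<beta> \<ge> 1\<close>, so a term
    \<open>2 k \<beta> l / N\<close> below 1 bounds \<open>k l\<close>.\<close>
  have few: "k * l \<le> N" if "1 \<le> \<beta>" "2 * real k * (real \<beta> * real l / real N) < 1" "l \<le> N" for N
  proof -
    have "real (k * l) / real N \<le> 2 * real k * (real \<beta> * real l / real N)"
    proof -
      have "real k * (1 * real l) \<le> (2 * real k) * (real \<beta> * real l)"
        using that(1) by (intro mult_mono) auto
      then show ?thesis using divide_right_mono[of _ _ "real N"] by simp
    qed
    then have "real (k * l) / real N < 1" using that(2) by linarith
    then have "real (k * l) < real N" using that(3) l0 by simp
    then show ?thesis by (simp only: of_nat_less_iff less_imp_le)
  qed
  have kl1: "k * l \<le> n" if "k3 \<noteq> 0"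
    using few[OF sparse_orthonormal_pos[OF Xc(3) on(1) sp(1) that] _ l(2)] small bl c0 unfolding expand by linarith
  have kl2: "k * l \<le> m" if "k2 \<noteq> 0"
    using few[OF sparse_orthonormal_pos[OF Yc(2) on(2) sp(2) that] _ l(3)] small bl c0 unfolding expand by linarith
  define \<theta> :: real where "\<theta> = (19 / 20) ^ q"
  define bn where "bn = real k * (real \<beta> * real l / real n)"
  define bm where "bm = real k * (real \<beta> * real l / real m)"
  define S where "S = {(I, J). spectral_norm (A - skeleton_approx A I J)
        \<le> 460 * \<epsilon> * sqrt (real n * real m * real k / real l)
          * (sing_val 1 (X * Z * transpose_mat Y) / sing_val k (X * Z * transpose_mat Y))
          * (spectral_norm (pinv X) + spectral_norm (pinv Y))}"
  have nonneg: "0 \<le> real k * \<theta>" "0 \<le> bn" "0 \<le> bm" by (auto simp: \<theta>_def bn_def bm_def)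
  have ks: "k1 + k2 \<le> k" "k1 + k3 \<le> k" "k3 \<le> k" "k2 \<le> k" using ksum by auto
  note lowX = prob_sample_lower[OF X12 coh(1) ks(1) l(1,2) q(1), folded \<theta>_def]
    and upX = prob_sample_upper[OF X12 coh(1) ks(1) l(1,2) q(1), folded \<theta>_def]
    and lowY = prob_sample_lower[OF Y13 coh(2) ks(2) l(1,3) q(1), folded \<theta>_def]
    and upY = prob_sample_upper[OF Y13 coh(2) ks(2) l(1,3) q(1), folded \<theta>_def]
    and vanX = prob_rows_vanish[OF Xc(3) sp(1) ks(3) l(2), folded bn_def]
    and vanY = prob_rows_vanish[OF Yc(2) sp(2) ks(4) l(3), folded bm_def]
  define \<delta>X where "\<delta>X = 2 * real k * \<theta> + (real k * \<theta> + bn)"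
  define \<delta>Y where "\<delta>Y = 2 * real k * \<theta> + (real k * \<theta> + bm)"
  define \<delta>X' where "\<delta>X' = 2 * real k * \<theta> + bn"
  define \<delta>Y' where "\<delta>Y' = 2 * real k * \<theta> + bm"
  note \<delta> = \<delta>X_def \<delta>Y_def \<delta>X'_def \<delta>Y'_def
  have subset: "I \<subseteq> {..<N}" "card I = l" if "I \<in> set_pmf (uniform_subset N l)" "l \<le> N" for I N
    using that by (auto simp: set_pmf_uniform_subset subsets_of_size_def)
  have dims: "dim_row A = n" "dim_col A = m" using AE by auto
  \<comment> \<open>The nested sum follows the order of the draws \<open>I0\<close>,
    \<open>Jb\<close>, \<open>J0\<close>, \<open>Ib\<close>; the final 0 belongs to the
    deterministic return.\<close>
  have "1 - (\<delta>X + (\<delta>Y' + (\<delta>Y + (\<delta>X' + 0)))) \<le> measure_pmf.prob (randomized_srrqr sel A l k l) S"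
    unfolding randomized_srrqr_def Let_def dims
  proof (rule prob_bind_ge[OF prob_union_bound[OF lowX prob_union_bound[OF upX vanX], folded \<delta>X_def]])
    show "0 \<le> \<delta>Y' + (\<delta>Y + (\<delta>X' + 0))" using nonneg unfolding \<delta> by linarith
    fix I0 assume I0: "I0 \<in> set_pmf (uniform_subset n l)"
      "sample_lower n l (append_cols X1 X2) I0 \<and> sample_upper n l (append_cols X1 X2) I0 \<and> rows_vanish X3 I0"
    note I0s = subset[OF I0(1) l(2)]
    have Ja: "srrqr_selects (row_submat A I0) k (sel (row_submat A I0) k)"
      using sel row_submat_carrier[OF AE(1) I0s(1)] I0s(2) kl l unfolding srrqr_routine_def by auto
    show "1 - (\<delta>Y' + (\<delta>Y + (\<delta>X' + 0))) \<le> measure_pmf.prob (uniform_subset m l \<bind> (\<lambda>Jb. uniform_subset m l \<bind>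
        (\<lambda>J0. uniform_subset n l \<bind> (\<lambda>Ib. return_pmf (sel (transpose_mat (col_submat A J0)) k \<union> Ib,
          sel (row_submat A I0) k \<union> Jb))))) S"
    proof (rule prob_bind_ge[OF prob_union_bound[OF lowY vanY, folded \<delta>Y'_def]])
      show "0 \<le> \<delta>Y + (\<delta>X' + 0)" using nonneg unfolding \<delta> by linarith
      fix Jb assume Jb: "Jb \<in> set_pmf (uniform_subset m l)" "sample_lower m l (append_cols Y1 Y3) Jb \<and> rows_vanish Y2 Jb"
      note Jbs = subset[OF Jb(1) l(3)]
      show "1 - (\<delta>Y + (\<delta>X' + 0)) \<le> measure_pmf.prob (uniform_subset m l \<bind>
        (\<lambda>J0. uniform_subset n l \<bind> (\<lambda>Ib. return_pmf (sel (transpose_mat (col_submat A J0)) k \<union> Ib,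
          sel (row_submat A I0) k \<union> Jb)))) S"
      proof (rule prob_bind_ge[OF prob_union_bound[OF lowY prob_union_bound[OF upY vanY], folded \<delta>Y_def]])
        show "0 \<le> \<delta>X' + 0" using nonneg unfolding \<delta> by linarith
        fix J0 assume J0: "J0 \<in> set_pmf (uniform_subset m l)"
          "sample_lower m l (append_cols Y1 Y3) J0 \<and> sample_upper m l (append_cols Y1 Y3) J0 \<and> rows_vanish Y2 J0"
        note J0s = subset[OF J0(1) l(3)]
        have Ia: "srrqr_selects (transpose_mat (col_submat A J0)) k (sel (transpose_mat (col_submat A J0)) k)"
          using sel col_submat_carrier[OF AE(1) J0s(1)] J0s(2) kl l unfolding srrqr_routine_def by auto
        show "1 - (\<delta>X' + 0) \<le> measure_pmf.prob (uniform_subset n l \<bind>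
          (\<lambda>Ib. return_pmf (sel (transpose_mat (col_submat A J0)) k \<union> Ib, sel (row_submat A I0) k \<union> Jb))) S"
        proof (rule prob_bind_ge[OF prob_union_bound[OF lowX vanX, folded \<delta>X'_def]])
          fix Ib assume Ib: "Ib \<in> set_pmf (uniform_subset n l)" "sample_lower n l (append_cols X1 X2) Ib \<and> rows_vanish X3 Ib"
          note Ibs = subset[OF Ib(1) l(2)]
          have "(sel (transpose_mat (col_submat A J0)) k \<union> Ib, sel (row_submat A I0) k \<union> Jb) \<in> S"
            unfolding S_def mem_Collect_eq prod.case
            using I0(2) J0(2) Jb(2) Ib(2)
            by (intro skeleton_error[OF Xc Yc Zc AE ksum k XYZ A_eq rank E_le coh on I0s(1) _ _ _ Jbs(1) _ _ J0s(1) _ _ _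
                  Ibs(1) _ _ Ja Ia l l0 \<alpha> kl1 kl2 gap]) auto
          then show "1 - 0 \<le> measure_pmf.prob
            (return_pmf (sel (transpose_mat (col_submat A J0)) k \<union> Ib, sel (row_submat A I0) k \<union> Jb)) S" by simp
        qed simp
      qed
    qed
  qed
  moreover have "\<delta>X + (\<delta>Y' + (\<delta>Y + (\<delta>X' + 0)))
      \<le> 2 * real k * (real \<beta> * real l / real n + real \<beta> * real l / real m + 2 * c)"
  proof -
    have "\<delta>X + (\<delta>Y' + (\<delta>Y + (\<delta>X' + 0))) = 10 * real k * \<theta> + 2 * bn + 2 * bm" by (simp add: \<delta>)
    moreover have "10 * real k * \<theta> \<le> 4 * real k * c" using q(2) by (simp only: \<theta>_def)
    moreover have "2 * real k * (real \<beta> * real l / real n) = 2 * bn" "2 * real k * (real \<beta> * real l / real m) = 2 * bm"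
      by (simp_all add: bn_def bm_def)
    ultimately show ?thesis unfolding expand by linarith
  qed
  ultimately show "1 - 2 * real k * (real \<beta> * real l / real n + real \<beta> * real l / real m + 2 * c)
    \<le> measure_pmf.prob (randomized_srrqr sel A l k l)
      {(I, J). spectral_norm (A - skeleton_approx A I J)
        \<le> 460 * \<epsilon> * sqrt (real n * real m * real k / real l)
          * (sing_val 1 (X * Z * transpose_mat Y) / sing_val k (X * Z * transpose_mat Y))
          * (spectral_norm (pinv X) + spectral_norm (pinv Y))}"
    unfolding S_def by linarith
qed

theorem corollary17:
  shows "\<exists>c1 c2 c C :: real. 0 < c1 \<and> c1 < 1 \<and> 0 < c2 \<and> c2 < 1 \<and> 0 < c \<and> 0 < C \<and>
    (\<forall>(n::nat) (m::nat) (k::nat) (k1::nat) (k2::nat) (k3::nat) (\<beta>::nat)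
      (l0::nat) (la::nat) (lb::nat) (l::nat) (\<alpha>::real) (\<mu>::real) (\<epsilon>::real)
      (A::real mat) (X::real mat) (Y::real mat) (Z::real mat) (E::real mat)
      (X1::real mat) (X2::real mat) (X3::real mat) (Y1::real mat) (Y2::real mat) (Y3::real mat)
      (Z1::real mat) (Z2::real mat) (Z3::real mat) (sel::real mat \<Rightarrow> nat \<Rightarrow> nat set).
      k \<ge> 1 \<longrightarrow> k1 + k2 + k3 = k \<longrightarrow>
      X1 \<in> carrier_mat n k1 \<longrightarrow> X2 \<in> carrier_mat n k2 \<longrightarrow> X3 \<in> carrier_mat n k3 \<longrightarrow>
      Y1 \<in> carrier_mat m k1 \<longrightarrow> Y2 \<in> carrier_mat m k2 \<longrightarrow> Y3 \<in> carrier_mat m k3 \<longrightarrow>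
      Z1 \<in> carrier_mat k1 k1 \<longrightarrow> Z2 \<in> carrier_mat k2 k2 \<longrightarrow> Z3 \<in> carrier_mat k3 k3 \<longrightarrow>
      A \<in> carrier_mat n m \<longrightarrow> E \<in> carrier_mat n m \<longrightarrow>
      X = append_cols X1 (append_cols X2 X3) \<longrightarrow>
      Y = append_cols Y1 (append_cols Y2 Y3) \<longrightarrow>
      Z = diag_block_mat [Z1, Z2, Z3] \<longrightarrow>
      A = X * Z * transpose_mat Y + E \<longrightarrow>
      vec_space.rank n (X * Z * transpose_mat Y) = k \<longrightarrow>
      spectral_norm E \<le> \<epsilon> \<longrightarrow>
      coherent \<mu> (append_cols X1 X2) \<longrightarrow> coherent \<mu> (append_cols Y1 Y3) \<longrightarrow>
      orthonormal_cols X3 \<longrightarrow> sparse_cols \<beta> X3 \<longrightarrow>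
      orthonormal_cols Y2 \<longrightarrow> sparse_cols \<beta> Y2 \<longrightarrow>
      \<alpha> > 0 \<longrightarrow>
      real l0 = \<alpha> * \<mu> * real k \<longrightarrow> real lb = \<alpha> * \<mu> * real k \<longrightarrow> la = k \<longrightarrow>
      l0 \<le> n \<longrightarrow> l0 \<le> m \<longrightarrow> lb \<le> n \<longrightarrow> lb \<le> m \<longrightarrow>
      l = max l0 (max la lb) \<longrightarrow>
      \<epsilon> * sqrt (real n * real m * real k / real l)
        \<le> c * sing_val k (X * Z * transpose_mat Y) \<longrightarrow>
      srrqr_routine sel \<longrightarrow>
      measure_pmf.prob (randomized_srrqr sel A l0 la lb)
        {(I, J). spectral_norm (A - skeleton_approx A I J)
           \<le> C * \<epsilon> * sqrt (real n * real m * real k / real l)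
               * (sing_val 1 (X * Z * transpose_mat Y) / sing_val k (X * Z * transpose_mat Y))
               * (spectral_norm (pinv X) + spectral_norm (pinv Y))}
      \<ge> 1 - 2 * real k * (real \<beta> * real l / real n + real \<beta> * real l / real m
                          + c1 powr \<alpha> + c2 powr \<alpha>))"
proof -
  \<comment> \<open>One value serves for both constants; the two equal powers together give the
    allowance \<open>4 * k * c powr \<alpha>\<close> of \<open>sampling_exponent\<close>.\<close>
  let ?c = "(19 / 20) powr (1 / 4) :: real"
  have c: "0 < ?c" "?c < 1" using powr_less_mono2[of "1 / 4" "19 / 20 :: real" 1] by auto
  show ?thesis
  proof (rule exI[of _ ?c], rule exI[of _ ?c], rule exI[of _ "1 / 20"], rule exI[of _ 460],
      intro conjI allI impI)
    fix n m k k1 k2 k3 \<beta> l0 la lb l :: nat and \<alpha> \<mu> \<epsilon> :: real and A X Y Z E X1 X2 X3 Y1 Y2 Y3 Z1 Z2 Z3 :: "real mat"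
      and sel :: "real mat \<Rightarrow> nat \<Rightarrow> nat set"
    assume k: "k \<ge> 1" and ksum: "k1 + k2 + k3 = k"
      and Xc: "X1 \<in> carrier_mat n k1" "X2 \<in> carrier_mat n k2" "X3 \<in> carrier_mat n k3"
      and Yc: "Y1 \<in> carrier_mat m k1" "Y2 \<in> carrier_mat m k2" "Y3 \<in> carrier_mat m k3"
      and Zc: "Z1 \<in> carrier_mat k1 k1" "Z2 \<in> carrier_mat k2 k2" "Z3 \<in> carrier_mat k3 k3"
      and AE: "A \<in> carrier_mat n m" "E \<in> carrier_mat n m"
      and XYZ: "X = append_cols X1 (append_cols X2 X3)" "Y = append_cols Y1 (append_cols Y2 Y3)"
        "Z = diag_block_mat [Z1, Z2, Z3]"
      and A_eq: "A = X * Z * transpose_mat Y + E"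
      and rank: "vec_space.rank n (X * Z * transpose_mat Y) = k"
      and E_le: "spectral_norm E \<le> \<epsilon>"
      and coh: "coherent \<mu> (append_cols X1 X2)" "coherent \<mu> (append_cols Y1 Y3)"
      and on1: "orthonormal_cols X3" and sp1: "sparse_cols \<beta> X3"
      and on2: "orthonormal_cols Y2" and sp2: "sparse_cols \<beta> Y2"
      and ls: "real l0 = \<alpha> * \<mu> * real k" "real lb = \<alpha> * \<mu> * real k" "la = k"
        "l0 \<le> n" "l0 \<le> m" "l = max l0 (max la lb)"
      and gap: "\<epsilon> * sqrt (real n * real m * real k / real l) \<le> 1 / 20 * sing_val k (X * Z * transpose_mat Y)"
      and sel: "srrqr_routine sel"
    let ?p = "2 * real k * (real \<beta> * real l / real n + real \<beta> * real l / real m + ?c powr \<alpha> + ?c powr \<alpha>)"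
    let ?P = "measure_pmf.prob (randomized_srrqr sel A l0 la lb)
        {(I, J). spectral_norm (A - skeleton_approx A I J)
           \<le> 460 * \<epsilon> * sqrt (real n * real m * real k / real l)
               * (sing_val 1 (X * Z * transpose_mat Y) / sing_val k (X * Z * transpose_mat Y))
               * (spectral_norm (pinv X) + spectral_norm (pinv Y))}"
    have lb: "lb = l0" using ls(1,2) by simp
    show "?P \<ge> 1 - ?p"
    proof (cases "?p < 1")
      \<comment> \<open>The claimed bound is then at most 0 and holds for every probability.\<close>
      case False
      then show ?thesis using measure_nonneg[of "measure_pmf (randomized_srrqr sel A l0 la lb)"] by (smt (verit))
    next
      case True
      \<comment> \<open>Positivity of the claimed bound forces \<open>\<alpha> \<ge> 1\<close>,
        hence \<open>k \<le> l0\<close>, which identifies \<open>l\<close> with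
        \<open>l0\<close>.\<close>
      have "0 \<le> 2 * real k * (real \<beta> * real l / real n)" "0 \<le> 2 * real k * (real \<beta> * real l / real m)" by auto
      then have "4 * real k * ?c powr \<alpha> < 1" using True unfolding distrib_left by linarith
      then obtain q where "2 * real (Suc q) \<le> \<alpha>" using sampling_exponent[of "real k" \<alpha>] k by auto
      then have "1 \<le> \<alpha>" by simp
      then have "k \<le> l0"
        using ksum k by (intro sample_size_ge[OF append_cols_carrier[OF Xc(1,2)] coh(1) append_cols_carrier[OF Yc(1,3)] coh(2) _ ls(1)]) auto
      then have ll: "l = l0" using ls(3,6) lb by simp
      have two: "real \<beta> * real l0 / real n + real \<beta> * real l0 / real m + ?c powr \<alpha> + ?c powr \<alpha>
        = real \<beta> * real l0 / real n + real \<beta> * real l0 / real m + 2 * ?c powr \<alpha>" by simp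
      show ?thesis
        using prob_skeleton_error[OF Xc Yc Zc AE ksum k XYZ A_eq rank E_le coh on1 on2 sp1 sp2 ls(1,4,5) gap[unfolded ll] sel
            True[unfolded ll two]]
        unfolding ll lb ls(3) two .
    qed
  qed (use c in auto)
qed

end
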